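(* For every integer $n>2$ and every $d\in\mathbb{N}$, $$\boldsymbol{\lambda}\big(\mathcal{P}_{\le d}(\mathbb{S}^{n-1})\big)=\frac{\Gamma\big(\frac n2\big)}{\sqrt\pi\,\Gamma(n-1)}\,\frac{\Gamma(d+n-1)}{\Gamma\big(d+\frac{n-1}{2}\big)}\int_{-1}^{1}\Big|P_d^{(\frac{n-1}{2},\frac{n-3}{2})}(t)\Big|\,(1-t^2)^{\frac{n-3}{2}}\,dt.$$
   Context: $\mathbb{N}=\{1,2,\dots\}$. $\mathbb{S}^{n-1}$ is the Euclidean unit sphere of $\mathbb{R}^n$. $\mathcal{P}_{\le d}(\mathbb{S}^{n-1})$ is the space of restrictions to $\mathbb{S}^{n-1}$ of polynomials of degree at most $d$ on $\mathbb{R}^n$ with complex coefficients, a complex Banach space under the supremum norm on $\mathbb{S}^{n-1}$. For $\alpha,\beta>-1$, the Jacobi polynomial $P_d^{(\alpha,\beta)}$ is $$P_d^{(\alpha,\beta)}(t)=\frac{(-1)^d}{2^d d!}(1-t)^{-\alpha}(1+t)^{-\beta}\Big(\frac{d}{dt}\Big)^d\big[(1-t)^{\alpha+d}(1+t)^{\beta+d}\big],$$ i.e. the degree-$d$ polynomial orthogonal on $[-1,1]$ for the weight $(1-t)^\alpha(1+t)^\beta$ to all polynomials of lower degree, normalized by $P_d^{(\alpha,\beta)}(1)=\binom{d+\alpha}{d}$. For a subspace $X$ of a Banach space $Y$, $\boldsymbol{\lambda}(X,Y)=\inf\{\|P\|: P\in\mathcal{L}(Y,X),\ P|_X=\mathrm{id}_X\}$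 (with $\inf\varnothing=\infty$). The (absolute) projection constant of $X$ is $\boldsymbol{\lambda}(X)=\sup\boldsymbol{\lambda}(I(X),Y)$, the supremum over all complex Banach spaces $Y$ and all linear isometric embeddings $I\colon X\to Y$. *)

theory Defs
  imports "HOL-Analysis.Analysis" "HOL-Algebra.Module"
begin

section \<open>Complex Banach spaces with explicit carriers\<close>

text \<open>
  The projection constant is a supremum over all complex Banach spaces, so Banach spaces have to be
  values that can be quantified over.  They are modelled as modules (in the sense of HOL-Algebra)
  over the field of complex numbers, with a norm.  The fields \<open>mult\<close> and \<open>one\<close>
  inherited from the record of rings play no role.
\<close>

definition complex_field :: "complex ring" where
  "complex_field = \<lparr>carrier = UNIV, monoid.mult = (*), one = 1, ring.zero = 0, add = (+)\<rparr>"

record 'b normed_module = "(complex, 'b) module" +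
  vnorm :: "'b \<Rightarrow> real"

locale complex_banach_space = module complex_field V
  for V :: "'b normed_module" (structure) +
  assumes vnorm_nonneg: "x \<in> carrier V \<Longrightarrow> 0 \<le> vnorm V x"
    and vnorm_eq_0_iff: "x \<in> carrier V \<Longrightarrow> vnorm V x = 0 \<longleftrightarrow> x = \<zero>\<^bsub>V\<^esub>"
    and vnorm_smult: "x \<in> carrier V \<Longrightarrow> vnorm V (c \<odot>\<^bsub>V\<^esub> x) = cmod c * vnorm V x"
    and vnorm_triangle: "x \<in> carrier V \<Longrightarrow> y \<in> carrier V \<Longrightarrow>
          vnorm V (x \<oplus>\<^bsub>V\<^esub> y) \<le> vnorm V x + vnorm V y"
    and vnorm_complete: "range s \<subseteq> carrier V \<Longrightarrow>
          (\<forall>e>0. \<exists>N. \<forall>i\<ge>N. \<forall>j\<ge>N. vnorm V (s i \<ominus>\<^bsub>V\<^esub> s j) < e) \<Longrightarrow>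
          \<exists>l\<in>carrier V. (\<lambda>k. vnorm V (s k \<ominus>\<^bsub>V\<^esub> l)) \<longlonglongrightarrow> 0"

definition linear_op :: "'a normed_module \<Rightarrow> 'b normed_module \<Rightarrow> ('a \<Rightarrow> 'b) \<Rightarrow> bool" where
  "linear_op V W T \<longleftrightarrow> T \<in> carrier V \<rightarrow> carrier W \<and>
     (\<forall>x\<in>carrier V. \<forall>y\<in>carrier V. T (x \<oplus>\<^bsub>V\<^esub> y) = T x \<oplus>\<^bsub>W\<^esub> T y) \<and>
     (\<forall>c. \<forall>x\<in>carrier V. T (c \<odot>\<^bsub>V\<^esub> x) = c \<odot>\<^bsub>W\<^esub> T x)"

definition bounded_op :: "'a normed_module \<Rightarrow> 'b normed_module \<Rightarrow> ('a \<Rightarrow> 'b) \<Rightarrow> bool" where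
  "bounded_op V W T \<longleftrightarrow> linear_op V W T \<and> (\<exists>C. \<forall>x\<in>carrier V. vnorm W (T x) \<le> C * vnorm V x)"

definition op_norm :: "'a normed_module \<Rightarrow> 'b normed_module \<Rightarrow> ('a \<Rightarrow> 'b) \<Rightarrow> real" where
  "op_norm V W T = (SUP x\<in>{x \<in> carrier V. vnorm V x \<le> 1}. vnorm W (T x))"

definition isometric_embedding :: "'a normed_module \<Rightarrow> 'b normed_module \<Rightarrow> ('a \<Rightarrow> 'b) \<Rightarrow> bool" where
  "isometric_embedding V W T \<longleftrightarrow> linear_op V W T \<and> (\<forall>x\<in>carrier V. vnorm W (T x) = vnorm V x)"


section \<open>Projection constants\<close>

definition relative_projection_constant :: "'b set \<Rightarrow> 'b normed_module \<Rightarrow> ereal" where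
  "relative_projection_constant X Y =
     (INF P\<in>{P. bounded_op Y (Y\<lparr>carrier := X\<rparr>) P \<and> (\<forall>x\<in>X. P x = x)}.
        ereal (op_norm Y (Y\<lparr>carrier := X\<rparr>) P))"

text \<open>
  A supremum over all Banach spaces, on whatever type, is not expressible by one term of HOL.  The
  following supremum is over the Banach spaces whose elements are taken from the type
  \<open>'u\<close>.  Taking \<open>'u\<close> to be a sum \<open>'b + 'c\<close> with a free type variable
  \<open>'b\<close> admits all Banach spaces on an arbitrary type \<open>'b\<close>, see the lemma
  \<open>relative_le_projection_constant\<close> below.  The summand \<open>'c\<close> is chosen
  large enough for the supremum over all Banach spaces to be reached within the universe: for
  \<open>X\<close> a space of functions on a set \<open>S\<close>, with the supremum norm, the bounded
  functions on \<open>S\<close> suffice.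
\<close>

definition projection_constant :: "'u itself \<Rightarrow> 'a normed_module \<Rightarrow> ereal" where
  "projection_constant U X =
     (SUP (Y, I)\<in>{(Y :: 'u normed_module, I). complex_banach_space Y \<and> isometric_embedding X Y I}.
        relative_projection_constant (I ` carrier X) Y)"

text \<open>The isometric copy of a space along an injection between types.\<close>

definition transport :: "('b \<Rightarrow> 'u) \<Rightarrow> 'b normed_module \<Rightarrow> 'u normed_module" where
  "transport h V = \<lparr>carrier = h ` carrier V, monoid.mult = undefined, one = undefined,
     ring.zero = h \<zero>\<^bsub>V\<^esub>, add = (\<lambda>a b. h (the_inv h a \<oplus>\<^bsub>V\<^esub> the_inv h b)),
     smult = (\<lambda>c a. h (c \<odot>\<^bsub>V\<^esub> the_inv h a)), vnorm = (\<lambda>a. vnorm V (the_inv h a))\<rparr>"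

context
  fixes h :: "'b \<Rightarrow> 'u" and V :: "'b normed_module"
  assumes h: "inj h"
begin

private lemma transport_simps [simp]:
  "carrier (transport h V) = h ` carrier V"
  "\<zero>\<^bsub>transport h V\<^esub> = h \<zero>\<^bsub>V\<^esub>"
  "h x \<oplus>\<^bsub>transport h V\<^esub> h y = h (x \<oplus>\<^bsub>V\<^esub> y)"
  "c \<odot>\<^bsub>transport h V\<^esub> h x = h (c \<odot>\<^bsub>V\<^esub> x)"
  "vnorm (transport h V) (h x) = vnorm V x"
  using h by (simp_all add: transport_def the_inv_f_f)

lemma complex_banach_space_transport:
  assumes "complex_banach_space V"
  shows "complex_banach_space (transport h V)"
proof -
  interpret V: complex_banach_space V by fact
  have K: "carrier complex_field = UNIV" by (simp add: complex_field_def)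
  have ag: "abelian_group (transport h V)"
  proof (rule abelian_groupI)
    fix x assume "x \<in> carrier (transport h V)"
    then obtain y where "x = h y" "y \<in> carrier V" by auto
    then show "\<exists>y\<in>carrier (transport h V). y \<oplus>\<^bsub>transport h V\<^esub> x = \<zero>\<^bsub>transport h V\<^esub>"
      by (intro bexI [of _ "h (\<ominus>\<^bsub>V\<^esub> y)"]) (auto simp: V.M.l_neg)
  qed (auto simp: V.M.a_assoc V.M.a_comm V.M.a_lcomm)
  have "module complex_field (transport h V)"
    by (rule moduleI)
      (use ag V.R.is_cring V.smult_closed V.smult_l_distr V.smult_r_distr V.smult_assoc1 V.smult_one K in auto)
  then interpret T: module complex_field "transport h V" .
  have neg: "\<ominus>\<^bsub>transport h V\<^esub> h x = h (\<ominus>\<^bsub>V\<^esub> x)" if "x \<in> carrier V" for x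
    using that by (intro T.M.minus_equality) (auto simp: V.M.l_neg)
  have minus: "h x \<ominus>\<^bsub>transport h V\<^esub> h y = h (x \<ominus>\<^bsub>V\<^esub> y)"
    if "x \<in> carrier V" "y \<in> carrier V" for x y
    using that by (simp add: a_minus_def neg)
  show ?thesis
  proof (intro complex_banach_space.intro complex_banach_space_axioms.intro)
    fix s :: "nat \<Rightarrow> 'u" assume s: "range s \<subseteq> carrier (transport h V)"
      and c: "\<forall>e>0. \<exists>N. \<forall>i\<ge>N. \<forall>j\<ge>N. vnorm (transport h V) (s i \<ominus>\<^bsub>transport h V\<^esub> s j) < e"
    have "\<forall>i. \<exists>x\<in>carrier V. s i = h x"
      using s by auto
    then obtain r where r': "\<And>i. r i \<in> carrier V" and sr: "\<And>i. s i = h (r i)"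
      by metis
    then have r: "range r \<subseteq> carrier V" by auto
    have "\<forall>e>0. \<exists>N. \<forall>i\<ge>N. \<forall>j\<ge>N. vnorm V (r i \<ominus>\<^bsub>V\<^esub> r j) < e"
      using c by (simp add: sr minus r')
    from V.vnorm_complete[OF r this] obtain l where
      l: "l \<in> carrier V" "(\<lambda>k. vnorm V (r k \<ominus>\<^bsub>V\<^esub> l)) \<longlonglongrightarrow> 0" by blast
    then show "\<exists>l\<in>carrier (transport h V).
        (\<lambda>k. vnorm (transport h V) (s k \<ominus>\<^bsub>transport h V\<^esub> l)) \<longlonglongrightarrow> 0"
      by (intro bexI [of _ "h l"]) (simp_all add: sr minus r')
  qed (use h T.module_axioms in
    \<open>auto simp: V.vnorm_nonneg V.vnorm_eq_0_iff V.vnorm_smult V.vnorm_triangle inj_eq\<close>)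
qed

lemma isometric_embedding_transport:
  assumes "isometric_embedding X V I"
  shows "isometric_embedding X (transport h V) (h \<circ> I)"
  using assms by (auto simp: isometric_embedding_def linear_op_def)

lemma relative_projection_constant_transport_le:
  assumes "complex_banach_space V" "X \<subseteq> carrier V"
  shows "relative_projection_constant X V \<le> relative_projection_constant (h ` X) (transport h V)"
  unfolding relative_projection_constant_def
proof (rule INF_mono, safe)
  fix Q assume b: "bounded_op (transport h V) (transport h V\<lparr>carrier := h ` X\<rparr>) Q"
    and i: "\<forall>x\<in>h ` X. Q x = x"
  define P where "P = the_inv h \<circ> Q \<circ> h"
  have Q: "Q (h x) = h (P x)" "P x \<in> X" if "x \<in> carrier V" for x
  proof -
    from b that have "Q (h x) \<in> h ` X" by (auto simp: bounded_op_def linear_op_def)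
    then show "Q (h x) = h (P x)" "P x \<in> X" using h by (auto simp: P_def the_inv_f_f)
  qed
  have cl: "x \<oplus>\<^bsub>V\<^esub> y \<in> carrier V" "c \<odot>\<^bsub>V\<^esub> x \<in> carrier V" if "x \<in> carrier V" "y \<in> carrier V" for c x y
  proof -
    interpret V: complex_banach_space V by fact
    show "x \<oplus>\<^bsub>V\<^esub> y \<in> carrier V" "c \<odot>\<^bsub>V\<^esub> x \<in> carrier V"
      using that by (auto intro!: V.smult_closed simp: complex_field_def)
  qed
  have "linear_op V (V\<lparr>carrier := X\<rparr>) P"
    unfolding linear_op_def
  proof (intro conjI ballI allI)
    fix x y c assume xy: "x \<in> carrier V" "y \<in> carrier V"
    from b xy have "Q (h (x \<oplus>\<^bsub>V\<^esub> y)) = Q (h x) \<oplus>\<^bsub>transport h V\<^esub> Q (h y)"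
      by (auto simp: bounded_op_def linear_op_def)
    with xy cl h show "P (x \<oplus>\<^bsub>V\<^esub> y) = P x \<oplus>\<^bsub>V\<lparr>carrier := X\<rparr>\<^esub> P y"
      by (simp add: Q inj_eq)
  next
    fix x c assume x: "x \<in> carrier V"
    from b x have "Q (h (c \<odot>\<^bsub>V\<^esub> x)) = c \<odot>\<^bsub>transport h V\<^esub> Q (h x)"
      by (auto simp: bounded_op_def linear_op_def)
    with x cl h show "P (c \<odot>\<^bsub>V\<^esub> x) = c \<odot>\<^bsub>V\<lparr>carrier := X\<rparr>\<^esub> P x"
      by (simp add: Q inj_eq)
  qed (use Q in auto)
  moreover have "\<exists>C. \<forall>x\<in>carrier V. vnorm (V\<lparr>carrier := X\<rparr>) (P x) \<le> C * vnorm V x"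
    using b by (auto simp: bounded_op_def Q)
  moreover have "P x = x" if "x \<in> X" for x
    using i that h by (simp add: P_def the_inv_f_f)
  moreover have "op_norm V (V\<lparr>carrier := X\<rparr>) P
      = op_norm (transport h V) (transport h V\<lparr>carrier := h ` X\<rparr>) Q"
  proof -
    have "{z \<in> carrier (transport h V). vnorm (transport h V) z \<le> 1}
        = h ` {x \<in> carrier V. vnorm V x \<le> 1}" by auto
    then show ?thesis by (simp add: op_norm_def image_image Q cong: image_cong_simp)
  qed
  ultimately show "\<exists>P\<in>{P. bounded_op V (V\<lparr>carrier := X\<rparr>) P \<and> (\<forall>x\<in>X. P x = x)}.
      ereal (op_norm V (V\<lparr>carrier := X\<rparr>) P)
        \<le> ereal (op_norm (transport h V) (transport h V\<lparr>carrier := h ` X\<rparr>) Q)"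
    by (intro bexI [of _ P]) (auto simp: bounded_op_def)
qed

end

lemma relative_le_projection_constant:
  fixes Y :: "'b normed_module"
  assumes "complex_banach_space Y" "isometric_embedding X Y I"
  shows "relative_projection_constant (I ` carrier X) Y \<le> projection_constant TYPE('b + 'c) X"
proof -
  let ?h = "Inl :: 'b \<Rightarrow> 'b + 'c"
  have "I ` carrier X \<subseteq> carrier Y"
    using assms(2) by (auto simp: isometric_embedding_def linear_op_def)
  then have "relative_projection_constant (I ` carrier X) Y
      \<le> relative_projection_constant ((?h \<circ> I) ` carrier X) (transport ?h Y)"
    using relative_projection_constant_transport_le [of ?h Y "I ` carrier X"] assms(1)
    by (simp add: image_comp)
  also have "\<dots> \<le> projection_constant TYPE('b + 'c) X"
    unfolding projection_constant_def
    by (rule SUP_upper2 [of "(transport ?h Y, ?h \<circ> I)"])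
      (use assms complex_banach_space_transport [of ?h Y]
        isometric_embedding_transport [of ?h X Y I] in auto)
  finally show ?thesis .
qed


section \<open>Polynomials on the sphere\<close>

definition polynomials_upto :: "nat \<Rightarrow> (real ^ 'n \<Rightarrow> complex) set" where
  "polynomials_upto d = {\<lambda>x. \<Sum>\<alpha> | (\<Sum>i\<in>UNIV. \<alpha> i) \<le> d. c \<alpha> * (\<Prod>i\<in>UNIV. complex_of_real (x $ i) ^ \<alpha> i)
     | c :: ('n \<Rightarrow> nat) \<Rightarrow> complex. True}"

text \<open>A function on the sphere is represented by its extension with value \<open>undefined\<close>
  elsewhere, so that polynomials agreeing on the sphere give the same element.\<close>

definition sphere_polynomials :: "nat \<Rightarrow> (real ^ 'n \<Rightarrow> complex) normed_module" where
  "sphere_polynomials d = \<lparr>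
     carrier = (\<lambda>p. restrict p (sphere 0 1)) ` polynomials_upto d,
     monoid.mult = undefined, one = undefined,
     ring.zero = (\<lambda>x\<in>sphere 0 1. 0),
     add = (\<lambda>f g. \<lambda>x\<in>sphere 0 1. f x + g x),
     smult = (\<lambda>c f. \<lambda>x\<in>sphere 0 1. c * f x),
     vnorm = (\<lambda>f. SUP x\<in>sphere 0 1. cmod (f x))\<rparr>"


section \<open>Jacobi polynomials\<close>

text \<open>Rodrigues' formula makes sense for \<open>-1 < t < 1\<close>; there it agrees with
  exactly one polynomial, which also gives the values at the end points.\<close>

definition rodrigues :: "nat \<Rightarrow> real \<Rightarrow> real \<Rightarrow> real \<Rightarrow> real" where
  "rodrigues d \<alpha> \<beta> t = (-1) ^ d / (2 ^ d * fact d) * (1 - t) powr (-\<alpha>) * (1 + t) powr (-\<beta>) *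
     (deriv ^^ d) (\<lambda>s. (1 - s) powr (\<alpha> + real d) * (1 + s) powr (\<beta> + real d)) t"

definition jacobi_poly :: "nat \<Rightarrow> real \<Rightarrow> real \<Rightarrow> real poly" where
  "jacobi_poly d \<alpha> \<beta> = (THE p. \<forall>t\<in>{-1<..<1}. poly p t = rodrigues d \<alpha> \<beta> t)"

lemma higher_deriv_rodrigues:
  "\<exists>q. \<forall>t\<in>{-1<..<1}. (deriv ^^ k) (\<lambda>s. (1 - s) powr a * (1 + s) powr b) t
      = poly q t * ((1 - t) powr (a - real k) * (1 + t) powr (b - real k))"
proof (induction k)
  case 0
  show ?case by (rule exI [of _ 1]) simp
next
  case (Suc k)
  then obtain q where q: "\<And>t. t \<in> {-1<..<1} \<Longrightarrow>
      (deriv ^^ k) (\<lambda>s. (1 - s) powr a * (1 + s) powr b) t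
      = poly q t * ((1 - t) powr (a - real k) * (1 + t) powr (b - real k))" by blast
  define q' where "q' = pderiv q * [:1, -1:] * [:1, 1:] - Polynomial.smult (a - real k) q * [:1, 1:]
      + Polynomial.smult (b - real k) q * [:1, -1:]"
  show ?case
  proof (rule exI [of _ q'], rule ballI)
    fix t :: real assume t: "t \<in> {-1<..<1}"
    let ?A = "(1 - t) powr (a - real (Suc k))" and ?B = "(1 + t) powr (b - real (Suc k))"
    have A: "(1 - t) powr (a - real k) = (1 - t) * ?A"
      using t powr_add [of "1 - t" 1 "a - real (Suc k)"] by (simp add: algebra_simps)
    have B: "(1 + t) powr (b - real k) = (1 + t) * ?B"
      using t powr_add [of "1 + t" 1 "b - real (Suc k)"] by (simp add: algebra_simps)
    have dA: "((\<lambda>t. (1 - t) powr (a - real k)) has_real_derivative - ((a - real k) * ?A)) (at t)"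
      using DERIV_fun_powr [of "\<lambda>t. 1 - t" "-1" t "a - real k"] t
      by (auto intro!: derivative_eq_intros simp: diff_diff_eq add.commute)
    have dB: "((\<lambda>t. (1 + t) powr (b - real k)) has_real_derivative (b - real k) * ?B) (at t)"
      using DERIV_fun_powr [of "\<lambda>t. 1 + t" "1" t "b - real k"] t
      by (auto intro!: derivative_eq_intros simp: diff_diff_eq add.commute)
    have "((\<lambda>t. poly q t * ((1 - t) powr (a - real k) * (1 + t) powr (b - real k)))
        has_real_derivative
          poly (pderiv q) t * ((1 - t) powr (a - real k) * (1 + t) powr (b - real k))
          + poly q t * (- ((a - real k) * ?A) * (1 + t) powr (b - real k)
             + (1 - t) powr (a - real k) * ((b - real k) * ?B))) (at t)"
      by (rule derivative_eq_intros poly_DERIV dA dB refl)+ (simp add: algebra_simps)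
    also have "poly (pderiv q) t * ((1 - t) powr (a - real k) * (1 + t) powr (b - real k))
          + poly q t * (- ((a - real k) * ?A) * (1 + t) powr (b - real k)
             + (1 - t) powr (a - real k) * ((b - real k) * ?B)) = poly q' t * (?A * ?B)"
      by (simp add: A B q'_def algebra_simps)
    finally have "((deriv ^^ k) (\<lambda>s. (1 - s) powr a * (1 + s) powr b)
        has_real_derivative poly q' t * (?A * ?B)) (at t)"
      by (rule has_field_derivative_transform_within_open [where S = "{-1<..<1}"]) (use t q in auto)
    then show "(deriv ^^ Suc k) (\<lambda>s. (1 - s) powr a * (1 + s) powr b) t = poly q' t * (?A * ?B)"
      by (simp add: DERIV_imp_deriv)
  qed
qed

lemma poly_jacobi_poly:
  assumes "t \<in> {-1<..<1}"
  shows "poly (jacobi_poly d \<alpha> \<beta>) t = rodrigues d \<alpha> \<beta> t"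
proof -
  obtain q where q: "\<And>t. t \<in> {-1<..<1} \<Longrightarrow>
      (deriv ^^ d) (\<lambda>s. (1 - s) powr (\<alpha> + real d) * (1 + s) powr (\<beta> + real d)) t
      = poly q t * ((1 - t) powr \<alpha> * (1 + t) powr \<beta>)"
    using higher_deriv_rodrigues [of d "\<alpha> + real d" "\<beta> + real d"] by auto
  let ?p = "Polynomial.smult ((-1) ^ d / (2 ^ d * fact d)) q"
  have p: "\<forall>t\<in>{-1<..<1}. poly ?p t = rodrigues d \<alpha> \<beta> t"
    by (simp add: rodrigues_def q powr_minus) (simp add: field_simps)
  have "\<forall>t\<in>{-1<..<1}. poly (jacobi_poly d \<alpha> \<beta>) t = rodrigues d \<alpha> \<beta> t"
    unfolding jacobi_poly_def
  proof (rule theI [of _ ?p])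
    fix r assume "\<forall>t\<in>{-1<..<1}. poly r t = rodrigues d \<alpha> \<beta> t"
    then have "{-1<..<1} \<subseteq> {t. poly (r - ?p) t = 0}" using p by auto
    then have "infinite {t. poly (r - ?p) t = 0}"
      by (rule infinite_super) (simp add: infinite_Ioo)
    then have "r - ?p = 0" using poly_roots_finite [of "r - ?p"] by blast
    then show "r = ?p" by simp
  qed (fact p)
  then show ?thesis using assms by blast
qed

end

theory Submission
  imports Defs "HOL-Probability.Probability_Measure"
begin

text \<open>
  Let \<open>k\<close> be the multiple of the Jacobi polynomial for which \<open>k (x \<bullet> y)\<close>
  is the reproducing kernel of the polynomials of degree at most \<open>d\<close> on the sphere with its
  normalized rotation invariant measure \<open>\<sigma>\<close>.  Both inequalities compare with
  \<open>L = \<integral> \<bar>k (x \<bullet> y)\<bar> d\<sigma>(y)\<close>, which does not depend on \<open>x\<close>.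

  Upper bound: extend the point evaluations to \<open>Y\<close> by Hahn--Banach, and \<open>\<sigma>\<close> to a
  positive functional \<open>m\<close> on all bounded functions on the sphere.  Then
  \<open>(P y)(x) = m (s \<mapsto> k (x \<bullet> s) \<phi>\<^sub>s(y))\<close> is a projection of norm at most \<open>L\<close>.

  Lower bound: take for \<open>Y\<close> the bounded functions on the sphere.  For a polynomial \<open>q\<close>, the
  kernel \<open>q (x \<bullet> y)\<close> defines an operator on functions that does not raise degrees, so for
  every projection \<open>P\<close> the average over \<open>x\<close> of \<open>P (y \<mapsto> q (x \<bullet> y))(x)\<close>
  equals \<open>\<integral> q (x \<bullet> y) k (x \<bullet> y) d\<sigma>(y)\<close>.  Letting \<open>q\<close> approximate the sign of
  \<open>k\<close> gives \<open>L \<le> \<parallel>P\<parallel>\<close> without averaging over the rotation group.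
\<close>

section \<open>The Hahn--Banach theorem\<close>

text \<open>The parameters of the Jacobi polynomial come from one evaluation property. The sphere
  average of a function of \<open>x \<bullet> y\<close> is its integral for the weight
  \<open>(1 - t^2) powr \<nu>\<close>, \<nu> = (n - 3)/2, divided by the total mass. Reproducing
  polynomials of degree at most d then requires that integrating k against s gives, up to the total
  mass, the value s(1) for all s of degree at most d. So k is orthogonal to lower degrees for the
  weight times 1 - t, which makes it a multiple of the Jacobi polynomial with parameters \<nu> + 1
  and \<nu>. Integrals over the sphere are obtained from orthogonal invariance alone, through
  recursions for moments; neither polar coordinates nor spherical harmonics enter. In the upper
  bound the extended evaluations are chosen separately for each point s, so their values at y need
  not be measurable in s. This is why \<sigma> is extended to all bounded functions. In the lower
  bound every kernel is a polynomial in \<open>x \<bullet> y\<close>, hence a finite sum of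
  products, so an arbitrary projection can be applied term by term.\<close>

locale real_linear_space =
  fixes V :: "'v set"
    and add :: "'v \<Rightarrow> 'v \<Rightarrow> 'v" (infixl "\<boxplus>" 65)
    and scale :: "real \<Rightarrow> 'v \<Rightarrow> 'v" (infixr "\<boxdot>" 75)
    and nil :: 'v
  assumes add_closed: "x \<in> V \<Longrightarrow> y \<in> V \<Longrightarrow> x \<boxplus> y \<in> V"
    and scale_closed: "x \<in> V \<Longrightarrow> c \<boxdot> x \<in> V"
    and nil_closed: "nil \<in> V"
    and add_assoc: "x \<in> V \<Longrightarrow> y \<in> V \<Longrightarrow> z \<in> V \<Longrightarrow> (x \<boxplus> y) \<boxplus> z = x \<boxplus> (y \<boxplus> z)"
    and add_comm: "x \<in> V \<Longrightarrow> y \<in> V \<Longrightarrow> x \<boxplus> y = y \<boxplus> x"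
    and add_nil: "x \<in> V \<Longrightarrow> nil \<boxplus> x = x"
    and add_neg: "x \<in> V \<Longrightarrow> (-1) \<boxdot> x \<boxplus> x = nil"
    and scale_add: "x \<in> V \<Longrightarrow> y \<in> V \<Longrightarrow> c \<boxdot> (x \<boxplus> y) = c \<boxdot> x \<boxplus> c \<boxdot> y"
    and add_scale: "x \<in> V \<Longrightarrow> (a + b) \<boxdot> x = a \<boxdot> x \<boxplus> b \<boxdot> x"
    and scale_scale: "x \<in> V \<Longrightarrow> a \<boxdot> b \<boxdot> x = (a * b) \<boxdot> x"
    and scale_one: "x \<in> V \<Longrightarrow> 1 \<boxdot> x = x"
begin

definition sublinear :: "('v \<Rightarrow> real) \<Rightarrow> bool" where
  "sublinear q \<longleftrightarrow> (\<forall>x\<in>V. \<forall>y\<in>V. q (x \<boxplus> y) \<le> q x + q y) \<and>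
     (\<forall>c>0. \<forall>x\<in>V. q (c \<boxdot> x) = c * q x)"

lemma sublinear_add: "sublinear q \<Longrightarrow> x \<in> V \<Longrightarrow> y \<in> V \<Longrightarrow> q (x \<boxplus> y) \<le> q x + q y"
  and sublinear_scale: "sublinear q \<Longrightarrow> x \<in> V \<Longrightarrow> c > 0 \<Longrightarrow> q (c \<boxdot> x) = c * q x"
  by (auto simp: sublinear_def)

lemma sublinear_nil:
  assumes "sublinear q" shows "q nil = 0"
proof -
  have "2 \<boxdot> nil = nil"
    using add_scale [of nil 1 1] by (simp add: nil_closed scale_one add_nil)
  then show ?thesis
    using sublinear_scale [OF assms nil_closed, of 2] by simp
qed

lemma sublinear_ge:
  assumes "sublinear q" "x \<in> V" shows "- q ((-1) \<boxdot> x) \<le> q x"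
  using sublinear_add [OF assms(1) scale_closed [OF assms(2), of "-1"] assms(2)]
    sublinear_nil [OF assms(1)] add_neg [OF assms(2)] by simp

lemma sublinear_scaleR:
  assumes q: "sublinear q" and add: "\<And>x y. x \<in> V \<Longrightarrow> y \<in> V \<Longrightarrow> q (x \<boxplus> y) = q x + q y"
    and x: "x \<in> V"
  shows "q (c \<boxdot> x) = c * q x"
proof -
  have neg: "q ((-1) \<boxdot> y) = - q y" if "y \<in> V" for y
    using add [OF scale_closed [OF that, of "-1"] that] add_neg [OF that] sublinear_nil [OF q]
    by simp
  consider "c > 0" | "c = 0" | "c < 0" by linarith
  then show ?thesis
  proof cases
    case 1 then show ?thesis using q x by (simp add: sublinear_scale)
  next
    case 2
    have "0 \<boxdot> x = (1 + (-1)) \<boxdot> x" by simp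
    also have "q \<dots> = 0"
      unfolding add_scale [OF x] using x by (simp add: add scale_closed neg scale_one)
    finally show ?thesis using 2 by simp
  next
    case 3
    have "c \<boxdot> x = (-1) \<boxdot> (-c) \<boxdot> x" using x by (simp add: scale_scale)
    then have "q (c \<boxdot> x) = - q ((-c) \<boxdot> x)" using neg [OF scale_closed [OF x, of "-c"]] by simp
    also have "q ((-c) \<boxdot> x) = -c * q x" using sublinear_scale [OF q x, of "-c"] 3 by simp
    finally show ?thesis by simp
  qed
qed

text \<open>Subadditivity survives the infimum because the family is a chain: in a bound
  \<open>q x + q' y\<close> with two different members, the smaller of the two can serve in both
  places.\<close>

lemma sublinear_INF:
  assumes C: "C \<noteq> {}" "\<And>q. q \<in> C \<Longrightarrow> sublinear q"
    and chain: "\<And>q q'. q \<in> C \<Longrightarrow> q' \<in> C \<Longrightarrow> (\<forall>x\<in>V. q x \<le> q' x) \<or> (\<forall>x\<in>V. q' x \<le> q x)"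
    and bdd: "\<And>x. x \<in> V \<Longrightarrow> bdd_below ((\<lambda>q. q x) ` C)"
  shows "sublinear (\<lambda>x. if x \<in> V then INF q\<in>C. q x else 0)"
proof -
  define u where "u x = (INF q\<in>C. q x)" for x
  have ub: "u x \<le> q x" if "q \<in> C" "x \<in> V" for q x
    unfolding u_def using bdd that by (intro cINF_lower)
  have "u (x \<boxplus> y) \<le> u x + u y" if xy: "x \<in> V" "y \<in> V" for x y
  proof -
    have "u (x \<boxplus> y) - q' y \<le> q x" if q: "q \<in> C" "q' \<in> C" for q q'
    proof (cases "\<forall>x\<in>V. q x \<le> q' x")
      case True
      have "u (x \<boxplus> y) \<le> q (x \<boxplus> y)" using ub q xy add_closed by blast
      also have "\<dots> \<le> q x + q y" using sublinear_add C q xy by blast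
      also have "\<dots> \<le> q x + q' y" using True xy by simp
      finally show ?thesis by simp
    next
      case False
      then have le: "\<forall>x\<in>V. q' x \<le> q x" using chain q by blast
      have "u (x \<boxplus> y) \<le> q' (x \<boxplus> y)" using ub q xy add_closed by blast
      also have "\<dots> \<le> q' x + q' y" using sublinear_add C q xy by blast
      also have "\<dots> \<le> q x + q' y" using le xy by simp
      finally show ?thesis by simp
    qed
    then have "u (x \<boxplus> y) - q' y \<le> u x" if "q' \<in> C" for q'
      unfolding u_def [of x] using C(1) that by (intro cINF_greatest)
    then have "u (x \<boxplus> y) - u x \<le> q' y" if "q' \<in> C" for q'
      using that by fastforce
    then have "u (x \<boxplus> y) - u x \<le> u y"
      unfolding u_def [of y] using C(1) by (intro cINF_greatest)
    then show ?thesis by simp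
  qed
  moreover have "u (c \<boxdot> x) = c * u x" if "c > 0" "x \<in> V" for c x
  proof (rule antisym)
    have "u (c \<boxdot> x) / c \<le> q x" if "q \<in> C" for q
      using ub [OF that scale_closed [OF \<open>x \<in> V\<close>, of c]] sublinear_scale [OF C(2) [OF that] \<open>x \<in> V\<close> \<open>c > 0\<close>]
        \<open>c > 0\<close> by (simp add: field_simps)
    then have "u (c \<boxdot> x) / c \<le> u x"
      unfolding u_def [of x] using C(1) by (intro cINF_greatest)
    then show "u (c \<boxdot> x) \<le> c * u x" using \<open>c > 0\<close> by (simp add: field_simps)
    have "c * u x \<le> q (c \<boxdot> x)" if "q \<in> C" for q
      using ub [OF that \<open>x \<in> V\<close>] sublinear_scale [OF C(2) [OF that] \<open>x \<in> V\<close> \<open>c > 0\<close>] \<open>c > 0\<close> by simp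
    then show "c * u x \<le> u (c \<boxdot> x)"
      unfolding u_def [of "c \<boxdot> x"] using C(1) by (intro cINF_greatest)
  qed
  ultimately show ?thesis
    unfolding sublinear_def u_def [symmetric] by (simp add: add_closed scale_closed)
qed

text \<open>What makes minimal functionals additive: \<open>r\<close> is a sublinear minorant of
  \<open>q\<close>, so minimality forces \<open>r = q\<close>, and the last claim becomes
  superadditivity at \<open>a\<close>. Taking the infimum over all \<open>t > 0\<close> instead of
  \<open>t = 1\<close> makes \<open>r\<close> positively homogeneous.\<close>

lemma sublinear_shift:
  assumes q: "sublinear q" and a: "a \<in> V"
  defines "r \<equiv> \<lambda>x. if x \<in> V then INF t\<in>{0<..}. q (x \<boxplus> t \<boxdot> a) - t * q a else 0"
  shows "sublinear r" and "x \<in> V \<Longrightarrow> r x \<le> q x" and "x \<in> V \<Longrightarrow> r x \<le> q (x \<boxplus> a) - q a"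
proof -
  define g where "g x t = q (x \<boxplus> t \<boxdot> a) - t * q a" for x t
  have r: "r x = (INF t\<in>{0<..}. g x t)" if "x \<in> V" for x
    using that by (simp add: r_def g_def)
  have bdd: "bdd_below (g x ` {0<..})" if x: "x \<in> V" for x
  proof (rule bdd_belowI2)
    fix t :: real assume t: "t \<in> {0<..}"
    have ta: "t \<boxdot> a \<in> V" using a by (rule scale_closed)
    have nx: "(-1) \<boxdot> x \<in> V" using x by (rule scale_closed)
    have "t \<boxdot> a = (-1) \<boxdot> x \<boxplus> (x \<boxplus> t \<boxdot> a)"
      using add_assoc [OF nx x ta] add_neg [OF x] add_nil [OF ta] by simp
    then have "q (t \<boxdot> a) \<le> q ((-1) \<boxdot> x) + q (x \<boxplus> t \<boxdot> a)"
      using sublinear_add [OF q nx add_closed [OF x ta]] by simp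
    then show "- q ((-1) \<boxdot> x) \<le> g x t"
      using sublinear_scale [OF q a] t by (simp add: g_def)
  qed
  have le: "r x \<le> g x t" if "x \<in> V" "t > 0" for x t
    unfolding r [OF that(1)] by (rule cINF_lower [OF bdd]) (use that in auto)
  have gi: "b \<le> r x" if "x \<in> V" "\<And>t. t > 0 \<Longrightarrow> b \<le> g x t" for b x
    unfolding r [OF that(1)] by (rule cINF_greatest) (use that in auto)
  have g1: "g (x \<boxplus> y) (s + t) \<le> g x s + g y t" if "x \<in> V" "y \<in> V" for x y s t
  proof -
    have v: "s \<boxdot> a \<in> V" "t \<boxdot> a \<in> V" using a by (auto intro: scale_closed)
    have "(x \<boxplus> y) \<boxplus> (s + t) \<boxdot> a = (x \<boxplus> s \<boxdot> a) \<boxplus> (y \<boxplus> t \<boxdot> a)"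
      using that v a
      by (metis add_assoc add_closed add_comm add_scale)
    then show ?thesis
      using sublinear_add [OF q add_closed [OF that(1) v(1)] add_closed [OF that(2) v(2)]]
      by (simp add: g_def algebra_simps)
  qed
  have g2: "g (c \<boxdot> x) (c * t) = c * g x t" if "x \<in> V" "c > 0" for x c t
  proof -
    have v: "t \<boxdot> a \<in> V" using a by (rule scale_closed)
    have "c \<boxdot> x \<boxplus> (c * t) \<boxdot> a = c \<boxdot> (x \<boxplus> t \<boxdot> a)"
      using that v a by (simp add: scale_add scale_scale)
    then show ?thesis
      using sublinear_scale [OF q add_closed [OF that(1) v] that(2)]
      by (simp add: g_def algebra_simps)
  qed
  show "sublinear r"
    unfolding sublinear_def
  proof (intro conjI ballI allI impI)
    fix x y assume xy: "x \<in> V" "y \<in> V"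
    have "r (x \<boxplus> y) - g y t \<le> r x" if "t > 0" for t
    proof (rule gi [OF xy(1)])
      fix s :: real assume "s > 0"
      then show "r (x \<boxplus> y) - g y t \<le> g x s"
        using le [OF add_closed [OF xy], of "s + t"] g1 [OF xy, of s t] that by simp
    qed
    then have "r (x \<boxplus> y) - r x \<le> r y"
      by (intro gi [OF xy(2)]) (simp add: diff_le_eq add.commute)
    then show "r (x \<boxplus> y) \<le> r x + r y" by simp
  next
    fix c :: real and x assume c: "0 < c" and x: "x \<in> V"
    show "r (c \<boxdot> x) = c * r x"
    proof (rule antisym)
      have "r (c \<boxdot> x) / c \<le> r x"
      proof (rule gi [OF x])
        fix t :: real assume "t > 0"
        then show "r (c \<boxdot> x) / c \<le> g x t"
          using le [OF scale_closed [OF x, of c], of "c * t"] g2 [OF x c, of t] c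
          by (simp add: field_simps)
      qed
      then show "r (c \<boxdot> x) \<le> c * r x" using c by (simp add: field_simps)
    next
      show "c * r x \<le> r (c \<boxdot> x)"
      proof (rule gi [OF scale_closed [OF x]])
        fix t :: real assume t: "t > 0"
        then show "c * r x \<le> g (c \<boxdot> x) t"
          using le [OF x, of "t / c"] g2 [OF x c, of "t / c"] c by (simp add: field_simps)
      qed
    qed
  qed
  show "r x \<le> q x" if x: "x \<in> V"
  proof -
    have "g x 1 \<le> q x"
      using sublinear_add [OF q x a] a by (simp add: g_def scale_one)
    with le [OF x, of 1] show ?thesis by simp
  qed
  show "r x \<le> q (x \<boxplus> a) - q a" if x: "x \<in> V"
    using le [OF x, of 1] a by (simp add: g_def scale_one)
qed

text \<open>The minimal sublinear functionals are linear.\<close>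

theorem sublinear_dominates_linear:
  assumes p: "sublinear p"
  obtains f where "\<And>x y. x \<in> V \<Longrightarrow> y \<in> V \<Longrightarrow> f (x \<boxplus> y) = f x + f y"
    and "\<And>c x. x \<in> V \<Longrightarrow> f (c \<boxdot> x) = c * f x" and "\<And>x. x \<in> V \<Longrightarrow> f x \<le> p x"
proof -
  \<comment> \<open>Zorn is applied to the reversed pointwise order, in which a chain is bounded by
    its infimum. Values off \<open>V\<close> are fixed to 0, so that comparison on \<open>V\<close>
    is comparison of functions and minimality yields an equality.\<close>
  define S where "S = {q. sublinear q \<and> (\<forall>x\<in>V. q x \<le> p x) \<and> (\<forall>x. x \<notin> V \<longrightarrow> q x = 0)}"
  have "\<exists>m\<in>S. \<forall>q\<in>S. q \<le> m \<longrightarrow> q = m"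
  proof (rule predicate_Zorn)
    show "partial_order_on S (relation_of (\<lambda>a b. b \<le> a) S)"
      by (rule partial_order_on_relation_ofI) auto
  next
    fix C assume "C \<in> Chains (relation_of (\<lambda>a b. b \<le> a) S)"
    then have CS: "C \<subseteq> S" and ch: "\<And>q q'. q \<in> C \<Longrightarrow> q' \<in> C \<Longrightarrow> q \<le> q' \<or> q' \<le> q"
      by (auto simp: Chains_def relation_of_def)
    show "\<exists>u\<in>S. \<forall>a\<in>C. u \<le> a"
    proof (cases "C = {}")
      case True
      have "(\<lambda>x. if x \<in> V then p x else 0) \<in> S"
        using p by (simp add: S_def sublinear_def add_closed scale_closed)
      then show ?thesis using True by blast
    next
      case False
      define u where "u = (\<lambda>x. if x \<in> V then INF q\<in>C. q x else 0)"
      have bdd: "bdd_below ((\<lambda>q. q x) ` C)" if x: "x \<in> V" for x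
      proof (rule bdd_belowI2)
        fix q assume "q \<in> C"
        then have "q \<in> S" using CS by blast
        then have "q ((-1) \<boxdot> x) \<le> p ((-1) \<boxdot> x)" "sublinear q"
          using scale_closed [OF x] by (auto simp: S_def)
        then show "- p ((-1) \<boxdot> x) \<le> q x" using sublinear_ge [of q x] x by simp
      qed
      have sub: "sublinear u"
        unfolding u_def
      proof (rule sublinear_INF [OF False _ _ bdd])
        show "(\<forall>x\<in>V. q x \<le> q' x) \<or> (\<forall>x\<in>V. q' x \<le> q x)" if "q \<in> C" "q' \<in> C" for q q'
          using ch [OF that] by (auto simp: le_fun_def)
      qed (use CS in \<open>auto simp: S_def\<close>)
      have ul: "u \<le> q" if "q \<in> C" for q
      proof (rule le_funI)
        fix x show "u x \<le> q x"
        proof (cases "x \<in> V")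
          case True
          then show ?thesis using cINF_lower [OF bdd that] by (simp add: u_def)
        next
          case False
          then show ?thesis using CS that by (auto simp: u_def S_def)
        qed
      qed
      have "u x \<le> p x" if "x \<in> V" for x
      proof -
        obtain q where "q \<in> C" using False by blast
        then have "u x \<le> q x" "q \<in> S" using ul CS by (auto dest: le_funD)
        then show ?thesis using that by (force simp: S_def)
      qed
      then have "u \<in> S" using sub by (simp add: S_def) (simp add: u_def)
      then show ?thesis using ul by blast
    qed
  qed
  then obtain m where m: "m \<in> S" and min: "\<And>q. q \<in> S \<Longrightarrow> q \<le> m \<Longrightarrow> q = m" by blast
  have sm: "sublinear m" using m by (simp add: S_def)
  have add: "m (x \<boxplus> a) = m x + m a" if x: "x \<in> V" and a: "a \<in> V" for x a
  proof -
    define r where "r = (\<lambda>x. if x \<in> V then INF t\<in>{0<..}. m (x \<boxplus> t \<boxdot> a) - t * m a else 0)"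
    note r = sublinear_shift [OF sm a, folded r_def]
    have "r \<le> m"
      using r(2) m by (auto simp: le_fun_def S_def r_def)
    moreover have "r \<in> S"
      using m r(1) \<open>r \<le> m\<close> by (auto simp: S_def le_fun_def intro: order_trans) (simp add: r_def)
    ultimately have rm: "r = m" using min by blast
    have "r x \<le> m (x \<boxplus> a) - m a"
      using sublinear_shift(3) [OF sm a x] by (simp add: r_def)
    then have "m x \<le> m (x \<boxplus> a) - m a" by (simp only: rm)
    then show ?thesis using sublinear_add [OF sm x a] by simp
  qed
  show ?thesis
  proof (rule that [of m])
    show "m (c \<boxdot> x) = c * m x" if "x \<in> V" for c x
      using sublinear_scaleR [OF sm add that] .
  qed (use add m in \<open>auto simp: S_def\<close>)
qed

end

section \<open>Jacobi polynomials\<close>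

definition jacobi_weight :: "real \<Rightarrow> real \<Rightarrow> real \<Rightarrow> real" where
  "jacobi_weight a b t = (1 - t) powr a * (1 + t) powr b"

lemma jacobi_weight_eq: "t \<in> {-1..1} \<Longrightarrow> jacobi_weight a a t = (1 - t\<^sup>2) powr a"
proof -
  assume "t \<in> {-1..1}"
  then have "((1 - t) * (1 + t)) powr a = jacobi_weight a a t"
    by (simp add: jacobi_weight_def powr_mult)
  moreover have "(1 - t) * (1 + t) = 1 - t\<^sup>2" by (simp add: power2_eq_square algebra_simps)
  ultimately show ?thesis by simp
qed

lemma jacobi_weight_mult:
  assumes "t \<in> {-1..1}"
  shows "(1 - t) * jacobi_weight a b t = jacobi_weight (a + 1) b t"
    and "(1 + t) * jacobi_weight a b t = jacobi_weight a (b + 1) t"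
  using assms by (auto simp: jacobi_weight_def powr_add)

lemma integrable_jacobi_weight:
  fixes f :: "real \<Rightarrow> real"
  assumes a: "a \<ge> 0" and b: "b \<ge> 0" and f: "continuous_on {-1..1} f"
  shows "(\<lambda>t. f t * jacobi_weight a b t) integrable_on {-1..1}"
proof -
  \<comment> \<open>\<open>0 powr 0\<close> is 0, so for exponent 0 the weight jumps at an end
    point. \<open>g\<close> is the continuous version; the two integrands differ at most at the two
    end points.\<close>
  define g where "g e x = (if e = 0 then 1 else x powr e)" for e x :: real
  have g: "continuous_on {-1..1} (\<lambda>t. g e (h t))"
    if "e \<ge> 0" "continuous_on {-1..1} h" "\<And>t. t \<in> {-1..1} \<Longrightarrow> 0 \<le> h t" for e h
    using that by (cases "e = 0") (auto simp: g_def intro!: continuous_on_powr')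
  have "continuous_on {-1..1} (\<lambda>t. f t * (g a (1 - t) * g b (1 + t)))"
    by (intro continuous_intros f g a b) auto
  then have "(\<lambda>t. f t * (g a (1 - t) * g b (1 + t))) integrable_on {-1..1}"
    by (rule integrable_continuous_real)
  then show ?thesis
  proof (rule integrable_spike_finite [of "{-1, 1}", rotated 2])
    show "f t * jacobi_weight a b t = f t * (g a (1 - t) * g b (1 + t))"
      if "t \<in> {-1..1} - {-1, 1}" for t
      using that by (auto simp: g_def jacobi_weight_def)
  qed simp
qed

text \<open>The polynomial left over when \<open>p\<close> times a Jacobi weight is differentiated:
  the product rule lowers both exponents by one, and the remaining factors are collected
  here.\<close>

definition weight_deriv :: "real \<Rightarrow> real \<Rightarrow> real poly \<Rightarrow> real poly" where
  "weight_deriv a b p = pderiv p * [:1, -1:] * [:1, 1:] - Polynomial.smult a p * [:1, 1:]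
     + Polynomial.smult b p * [:1, -1:]"

text \<open>Lets the exponent of \<open>1 - t\<close> in the integrated weight differ from the one
  in Rodrigues' formula. The correction carries a factor \<open>1 + t\<close>, which the weight
  absorbs.\<close>

lemma weight_deriv_add:
  "weight_deriv (a + s) b p = weight_deriv a b p - Polynomial.smult s p * [:1, 1:]"
proof -
  have "X - (Y + Z) * U + V = X - Y * U + V - Z * U" for X Y Z U V :: "real poly"
    by (simp add: algebra_simps)
  then show ?thesis unfolding weight_deriv_def smult_add_left .
qed

lemma DERIV_jacobi_weight:
  assumes t: "t \<in> {-1<..<1}"
  shows "((\<lambda>t. poly p t * jacobi_weight a b t) has_real_derivative
     poly (weight_deriv a b p) t * jacobi_weight (a - 1) (b - 1) t) (at t)"
proof -
  have A: "(1 - t) powr a = (1 - t) * (1 - t) powr (a - 1)"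
    and B: "(1 + t) powr b = (1 + t) * (1 + t) powr (b - 1)"
    using t by (auto simp: powr_diff)
  have dA: "((\<lambda>t. (1 - t) powr a) has_real_derivative - (a * (1 - t) powr (a - 1))) (at t)"
    using t by (auto intro!: derivative_eq_intros)
  have dB: "((\<lambda>t. (1 + t) powr b) has_real_derivative b * (1 + t) powr (b - 1)) (at t)"
    using t by (auto intro!: derivative_eq_intros)
  have "((\<lambda>t. poly p t * ((1 - t) powr a * (1 + t) powr b)) has_real_derivative
      poly (pderiv p) t * ((1 - t) powr a * (1 + t) powr b)
      + poly p t * (- (a * (1 - t) powr (a - 1)) * (1 + t) powr b
         + (1 - t) powr a * (b * (1 + t) powr (b - 1)))) (at t)"
    by (rule derivative_eq_intros poly_DERIV dA dB refl)+ (simp add: algebra_simps)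
  then show ?thesis
    by (simp add: jacobi_weight_def A B weight_deriv_def algebra_simps)
qed

lemma has_integral_weight_deriv:
  assumes a: "a > 0" and b: "b > 0"
  shows "((\<lambda>t. poly (weight_deriv a b p) t * jacobi_weight (a - 1) (b - 1) t) has_integral 0) {-1..1}"
proof -
  have "((\<lambda>t. poly (weight_deriv a b p) t * jacobi_weight (a - 1) (b - 1) t) has_integral
      (poly p 1 * jacobi_weight a b 1 - poly p (-1) * jacobi_weight a b (-1))) {-1..1}"
  proof (rule fundamental_theorem_of_calculus_interior)
    show "continuous_on {-1..1} (\<lambda>t. poly p t * jacobi_weight a b t)"
      unfolding jacobi_weight_def using a b by (auto intro!: continuous_intros continuous_on_powr')
  qed (use DERIV_jacobi_weight in \<open>auto simp: has_real_derivative_iff_has_vector_derivative [symmetric]\<close>)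
  then show ?thesis using a b by (simp add: jacobi_weight_def)
qed

section \<open>Moments of the Gegenbauer weight\<close>

definition gegenbauer_moment :: "real \<Rightarrow> nat \<Rightarrow> real" where
  "gegenbauer_moment \<nu> k = integral {-1..1} (\<lambda>t. t ^ k * (1 - t\<^sup>2) powr \<nu>)"

lemma integrable_gegenbauer:
  fixes f :: "real \<Rightarrow> real"
  assumes "\<nu> \<ge> 0" "continuous_on {-1..1} f"
  shows "(\<lambda>t. f t * (1 - t\<^sup>2) powr \<nu>) integrable_on {-1..1}"
  using integrable_jacobi_weight [OF assms(1,1,2)]
  by (rule integrable_eq) (simp add: jacobi_weight_eq)

lemma has_integral_gegenbauer_moment:
  "\<nu> \<ge> 0 \<Longrightarrow> ((\<lambda>t. t ^ k * (1 - t\<^sup>2) powr \<nu>) has_integral gegenbauer_moment \<nu> k) {-1..1}"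
  unfolding gegenbauer_moment_def
  by (intro integrable_integral integrable_gegenbauer continuous_intros)

lemma gegenbauer_moment_Suc:
  assumes "\<nu> \<ge> 0"
  shows "gegenbauer_moment (\<nu> + 1) k = gegenbauer_moment \<nu> k - gegenbauer_moment \<nu> (k + 2)"
proof -
  have "((\<lambda>t. t ^ k * (1 - t\<^sup>2) powr \<nu> - t ^ (k + 2) * (1 - t\<^sup>2) powr \<nu>) has_integral
      gegenbauer_moment \<nu> k - gegenbauer_moment \<nu> (k + 2)) {-1..1}"
    by (intro has_integral_diff has_integral_gegenbauer_moment assms)
  then have "((\<lambda>t. t ^ k * (1 - t\<^sup>2) powr (\<nu> + 1)) has_integral
      gegenbauer_moment \<nu> k - gegenbauer_moment \<nu> (k + 2)) {-1..1}"
  proof (rule has_integral_eq [rotated])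
    fix t :: real assume "t \<in> {-1..1}"
    then have "0 \<le> 1 - t\<^sup>2" by (simp add: abs_square_le_1 abs_le_iff)
    then have *: "(1 - t\<^sup>2) powr (\<nu> + 1) = (1 - t\<^sup>2) powr \<nu> * (1 - t\<^sup>2)"
      by (simp add: powr_add)
    show "t ^ k * (1 - t\<^sup>2) powr \<nu> - t ^ (k + 2) * (1 - t\<^sup>2) powr \<nu>
        = t ^ k * (1 - t\<^sup>2) powr (\<nu> + 1)"
      unfolding * by (simp add: algebra_simps power2_eq_square)
  qed
  then show ?thesis by (simp add: gegenbauer_moment_def integral_unique)
qed

text \<open>Integration by parts: the derivative of
  \<open>t ^ k * (1 - t^2) powr (\<nu> + 1)\<close> integrates to 0. For \<open>k = 0\<close> the
  truncated \<open>k - 1\<close> is multiplied by 0, and the identity says that the first moment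
  vanishes.\<close>

lemma gegenbauer_moment_rec:
  assumes \<nu>: "\<nu> \<ge> 0"
  shows "real k * gegenbauer_moment (\<nu> + 1) (k - 1) = 2 * (\<nu> + 1) * gegenbauer_moment \<nu> (k + 1)"
proof -
  have *: "poly (weight_deriv (\<nu> + 1) (\<nu> + 1) (monom 1 k)) t
      = real k * t ^ (k - 1) - real k * t ^ (k - 1 + 2) - 2 * (\<nu> + 1) * t ^ (k + 1)" for t
    by (simp add: weight_deriv_def pderiv_monom poly_monom algebra_simps power2_eq_square)
  have "((\<lambda>t. poly (weight_deriv (\<nu> + 1) (\<nu> + 1) (monom 1 k)) t * jacobi_weight \<nu> \<nu> t) has_integral 0) {-1..1}"
    using has_integral_weight_deriv [of "\<nu> + 1" "\<nu> + 1" "monom 1 k"] \<nu> by simp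
  then have "((\<lambda>t. real k * (t ^ (k - 1) * (1 - t\<^sup>2) powr \<nu>) - real k * (t ^ (k - 1 + 2) * (1 - t\<^sup>2) powr \<nu>)
      - 2 * (\<nu> + 1) * (t ^ (k + 1) * (1 - t\<^sup>2) powr \<nu>)) has_integral 0) {-1..1}"
    by (rule has_integral_eq [rotated]) (simp only: * jacobi_weight_eq left_diff_distrib mult.assoc)
  moreover have "((\<lambda>t. real k * (t ^ (k - 1) * (1 - t\<^sup>2) powr \<nu>) - real k * (t ^ (k - 1 + 2) * (1 - t\<^sup>2) powr \<nu>)
      - 2 * (\<nu> + 1) * (t ^ (k + 1) * (1 - t\<^sup>2) powr \<nu>)) has_integral
      (real k * gegenbauer_moment \<nu> (k - 1) - real k * gegenbauer_moment \<nu> (k - 1 + 2)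
      - 2 * (\<nu> + 1) * gegenbauer_moment \<nu> (k + 1))) {-1..1}"
    by (intro has_integral_diff has_integral_mult_right has_integral_gegenbauer_moment \<nu>)
  ultimately have "real k * gegenbauer_moment \<nu> (k - 1) - real k * gegenbauer_moment \<nu> (k - 1 + 2)
      - 2 * (\<nu> + 1) * gegenbauer_moment \<nu> (k + 1) = 0"
    by (rule has_integral_unique [symmetric])
  then show ?thesis unfolding gegenbauer_moment_Suc [OF \<nu>] by (simp add: algebra_simps)
qed

lemma gegenbauer_moment_0_pos:
  assumes "\<nu> \<ge> 0" shows "gegenbauer_moment \<nu> 0 > 0"
proof -
  have i: "(\<lambda>t::real. 1 * (1 - t\<^sup>2) powr \<nu>) integrable_on {-1..1}"
    by (intro integrable_gegenbauer assms continuous_intros)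
  have i': "(\<lambda>t::real. 1 * (1 - t\<^sup>2) powr \<nu>) integrable_on {0..1/2}"
    using i by (rule integrable_on_subinterval) auto
  have "(1/2::real) * (3/4) powr \<nu> = integral {0..1/2} (\<lambda>t::real. (3/4) powr \<nu>)" by simp
  also have "\<dots> \<le> integral {0..1/2} (\<lambda>t. 1 * (1 - t\<^sup>2) powr \<nu>)"
  proof (rule integral_le [OF _ i'])
    fix t :: real assume t: "t \<in> {0..1/2}"
    then have "t\<^sup>2 \<le> (1/2)\<^sup>2" by (intro power_mono) auto
    then show "(3/4) powr \<nu> \<le> 1 * (1 - t\<^sup>2) powr \<nu>"
      using assms by (simp add: power2_eq_square powr_mono2)
  qed (rule integrable_const_ivl)
  also have "\<dots> \<le> integral {-1..1} (\<lambda>t. 1 * (1 - t\<^sup>2) powr \<nu>)"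
    by (rule integral_subset_le [OF _ i' i]) auto
  finally have "(1/2::real) * (3/4) powr \<nu> \<le> gegenbauer_moment \<nu> 0"
    by (simp add: gegenbauer_moment_def)
  moreover have "0 < (1/2::real) * (3/4) powr \<nu>" by simp
  ultimately show ?thesis by (rule order_less_le_trans [rotated])
qed

section \<open>Rodrigues polynomials and evaluation at 1 by integration\<close>

fun rodrigues_poly :: "real \<Rightarrow> real \<Rightarrow> nat \<Rightarrow> real poly" where
  "rodrigues_poly A B 0 = 1"
| "rodrigues_poly A B (Suc k) = weight_deriv (A - real k) (B - real k) (rodrigues_poly A B k)"

lemma degree_rodrigues_poly: "degree (rodrigues_poly A B k) \<le> k"
proof (induction k)
  case (Suc k)
  define p where "p = rodrigues_poly A B k"
  have p: "degree p \<le> k" using Suc by (simp add: p_def)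
  \<comment> \<open>Counting degrees gives \<open>degree (pderiv p) + 2\<close>, which is one too
    many for \<open>k = 0\<close>; there \<open>p\<close> is constant and its derivative
    vanishes.\<close>
  have "degree (pderiv p * [:1, -1:] * [:1, 1:]) \<le> Suc k"
  proof (cases k)
    case 0
    then have "pderiv p = 0" using p by (simp add: pderiv_eq_0_iff)
    then show ?thesis by simp
  next
    case (Suc m)
    have "degree (pderiv p * [:1, -1:] * [:1, 1:]) \<le> degree (pderiv p) + 1 + 1"
      by (intro order_trans [OF degree_mult_le] add_mono) auto
    also have "\<dots> \<le> Suc k" using p Suc by (simp add: degree_pderiv)
    finally show ?thesis .
  qed
  moreover have "degree (Polynomial.smult c p * [:1, e:]) \<le> Suc k" for c e
  proof -
    have "degree (Polynomial.smult c p * [:1, e:]) \<le> degree (Polynomial.smult c p) + degree [:1, e:]"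
      by (rule degree_mult_le)
    also have "\<dots> \<le> k + 1" using p by (intro add_mono) (auto intro: order_trans [OF degree_smult_le])
    finally show ?thesis by simp
  qed
  ultimately show ?case
    unfolding rodrigues_poly.simps p_def [symmetric] weight_deriv_def
    by (intro degree_add_le degree_diff_le)
qed simp

text \<open>Identifies the recursion with repeated differentiation. The polynomial factor is
  explicit, not merely existing, so that the degree bound and the integration by parts can follow it
  step by step.\<close>

lemma higher_deriv_rodrigues_poly:
  assumes "t \<in> {-1<..<1}"
  shows "(deriv ^^ k) (\<lambda>s. (1 - s) powr A * (1 + s) powr B) t
     = poly (rodrigues_poly A B k) t * jacobi_weight (A - real k) (B - real k) t"
  using assms
proof (induction k arbitrary: t)
  case 0
  then show ?case by (simp add: jacobi_weight_def)
next
  case (Suc k)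
  have "((deriv ^^ k) (\<lambda>s. (1 - s) powr A * (1 + s) powr B) has_real_derivative
      poly (rodrigues_poly A B (Suc k)) t * jacobi_weight (A - real k - 1) (B - real k - 1) t) (at t)"
    unfolding rodrigues_poly.simps
    by (rule has_field_derivative_transform_within_open [OF DERIV_jacobi_weight, where S = "{-1<..<1}"])
      (use Suc in auto)
  then show ?case by (simp add: DERIV_imp_deriv diff_diff_eq add.commute)
qed

lemma jacobi_poly_eq:
  "jacobi_poly d \<alpha> \<beta> = Polynomial.smult ((-1) ^ d / (2 ^ d * fact d))
     (rodrigues_poly (\<alpha> + real d) (\<beta> + real d) d)" (is "?J = ?R")
proof -
  have "poly ?J t = poly ?R t" if t: "t \<in> {-1<..<1}" for t
  proof -
    have cancel: "(1 - t) powr - \<alpha> * (1 - t) powr \<alpha> = 1" "(1 + t) powr - \<beta> * (1 + t) powr \<beta> = 1"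
      using t by (simp_all flip: powr_add)
    have "poly ?J t = poly ?R t * (((1 - t) powr - \<alpha> * (1 - t) powr \<alpha>) * ((1 + t) powr - \<beta> * (1 + t) powr \<beta>))"
      using t by (simp add: poly_jacobi_poly rodrigues_def higher_deriv_rodrigues_poly
        jacobi_weight_def mult_ac)
    then show ?thesis unfolding cancel by simp
  qed
  then have "{-1<..<1} \<subseteq> {t. poly (?J - ?R) t = 0}" by auto
  then have "infinite {t. poly (?J - ?R) t = 0}"
    by (rule infinite_super) (simp add: infinite_Ioo)
  then have "?J - ?R = 0" using poly_roots_finite by blast
  then show ?thesis by simp
qed

lemma degree_jacobi_poly: "degree (jacobi_poly d \<alpha> \<beta>) \<le> d"
  unfolding jacobi_poly_eq by (rule order_trans [OF degree_smult_le degree_rodrigues_poly])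

text \<open>One integration by parts. With \<open>a + 1\<close> in place of
  \<open>A - real k\<close> the integrand would be a full derivative and integrate to 0; the
  difference \<open>s\<close> of the two exponents survives as a factor.\<close>

lemma integral_rodrigues_poly_Suc:
  fixes a s B :: real and k :: nat
  assumes a: "a \<ge> 0" and B: "B - real k > 0" "B - real k - 1 \<ge> 0"
    and A: "A - real k + s = a + 1"
  shows "integral {-1..1} (\<lambda>t. poly (rodrigues_poly A B (Suc k)) t * jacobi_weight a (B - real (Suc k)) t)
     = s * integral {-1..1} (\<lambda>t. poly (rodrigues_poly A B k) t * jacobi_weight a (B - real k) t)"
proof -
  define p where "p = rodrigues_poly A B k"
  have 1: "((\<lambda>t. poly (weight_deriv (a + 1) (B - real k) p) t * jacobi_weight a (B - real k - 1) t) has_integral 0) {-1..1}"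
    using has_integral_weight_deriv [of "a + 1" "B - real k" p] a B by simp
  have 2: "weight_deriv (a + 1) (B - real k) p
      = weight_deriv (A - real k) (B - real k) p - Polynomial.smult s p * [:1, 1:]"
    unfolding A [symmetric] by (rule weight_deriv_add)
  have 3: "((\<lambda>t. s * (poly p t * jacobi_weight a (B - real k) t)) has_integral
      s * integral {-1..1} (\<lambda>t. poly p t * jacobi_weight a (B - real k) t)) {-1..1}"
    by (intro has_integral_mult_right integrable_integral integrable_jacobi_weight continuous_intros) (use a B in auto)
  have "((\<lambda>t. poly (weight_deriv (A - real k) (B - real k) p) t * jacobi_weight a (B - real (Suc k)) t) has_integral
      0 + s * integral {-1..1} (\<lambda>t. poly p t * jacobi_weight a (B - real k) t)) {-1..1}"
  proof (rule has_integral_eq [OF _ has_integral_add [OF 1 3]])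
    fix t :: real assume "t \<in> {-1..1}"
    then have w: "jacobi_weight a (B - real k) t = (1 + t) * jacobi_weight a (B - real k - 1) t"
      using jacobi_weight_mult(2) [of t a "B - real k - 1"] by simp
    have w': "jacobi_weight a (B - real (Suc k)) t = jacobi_weight a (B - real k - 1) t"
      by (simp add: diff_diff_eq add.commute)
    have "poly (Q - Polynomial.smult s p * [:1, 1:]) t * w + s * (poly p t * ((1 + t) * w))
        = poly Q t * w" for Q w
      by (simp add: algebra_simps)
    then show "poly (weight_deriv (a + 1) (B - real k) p) t * jacobi_weight a (B - real k - 1) t
          + s * (poly p t * jacobi_weight a (B - real k) t)
        = poly (weight_deriv (A - real k) (B - real k) p) t * jacobi_weight a (B - real (Suc k)) t"
      unfolding 2 w w' .
  qed
  from integral_unique [OF this] show ?thesis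
    unfolding rodrigues_poly.simps p_def by (simp only: add_0)
qed

text \<open>The exponent of \<open>1 - t\<close> in the integral stays \<open>\<alpha> + s\<close>
  while the one in Rodrigues' formula drops with \<open>k\<close>. Their difference therefore
  changes by one at each step, and for \<open>k = d\<close> the product is a falling factorial of
  \<open>s\<close>.\<close>

lemma integral_rodrigues_poly:
  assumes "\<alpha> + s \<ge> 0" "\<beta> \<ge> 0" "k \<le> d"
  shows "integral {-1..1} (\<lambda>t. poly (rodrigues_poly (\<alpha> + real d) (\<beta> + real d) k) t
         * jacobi_weight (\<alpha> + s) (\<beta> + real d - real k) t)
     = (\<Prod>j<k. s - real (d - Suc j)) * integral {-1..1} (jacobi_weight (\<alpha> + s) (\<beta> + real d))" (is "_ = _ * ?W")
  using assms(3)
proof (induction k)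
  case 0
  show ?case
    by (simp only: rodrigues_poly.simps poly_1 mult_1 of_nat_0 diff_zero lessThan_0 prod.empty)
next
  case (Suc k)
  have "integral {-1..1} (\<lambda>t. poly (rodrigues_poly (\<alpha> + real d) (\<beta> + real d) (Suc k)) t
         * jacobi_weight (\<alpha> + s) (\<beta> + real d - real (Suc k)) t)
     = (s - real (d - Suc k)) * integral {-1..1} (\<lambda>t. poly (rodrigues_poly (\<alpha> + real d) (\<beta> + real d) k) t
         * jacobi_weight (\<alpha> + s) (\<beta> + real d - real k) t)"
  proof (rule integral_rodrigues_poly_Suc)
    have d: "real d = real (d - Suc k) + real k + 1" using Suc.prems by linarith
    show "\<beta> + real d - real k > 0" "\<beta> + real d - real k - 1 \<ge> 0" "0 \<le> \<alpha> + s"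
      "\<alpha> + real d - real k + (s - real (d - Suc k)) = \<alpha> + s + 1"
      unfolding d using assms by simp_all
  qed
  also have "\<dots> = (s - real (d - Suc k)) * ((\<Prod>j<k. s - real (d - Suc j)) * ?W)"
    using Suc.IH [OF Suc_leD [OF Suc.prems]] by (rule arg_cong)
  also have "\<dots> = (\<Prod>j<Suc k. s - real (d - Suc j)) * ?W"
    unfolding prod.lessThan_Suc by (simp only: mult_ac)
  finally show ?case .
qed

lemma integral_jacobi_weight:
  assumes "a > 0" "b > 0"
  shows "integral {-1..1} (jacobi_weight (a - 1) (b - 1)) = 2 powr (a + b - 1) * Beta a b"
proof -
  have "((\<lambda>t. t powr (b - 1) * (1 - t) powr (a - 1)) has_integral Beta b a) {0..1}"
    by (rule has_integral_Beta_real) (use assms in auto)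
  then have "((\<lambda>t. t powr (b - 1) * (1 - t) powr (a - 1)) has_integral Beta b a) (cbox 0 1)" by simp
  from has_integral_affinity [OF this, of "1/2" "1/2"]
  have "((\<lambda>x. (x / 2 + 1/2) powr (b - 1) * (1 - (x / 2 + 1/2)) powr (a - 1)) has_integral 2 * Beta b a)
      ((\<lambda>x. 2 * x - 1) ` {0..1})"
    by simp
  moreover have "(\<lambda>x::real. 2 * x - 1) ` {0..1} = {-1..1}"
    using image_affinity_atLeastAtMost [of 2 "-1" 0 "1::real"] by simp
  ultimately have "((\<lambda>x. (x / 2 + 1/2) powr (b - 1) * (1 - (x / 2 + 1/2)) powr (a - 1)) has_integral 2 * Beta b a) {-1..1}"
    by simp
  from has_integral_mult_right [OF this, of "2 powr (a + b - 2)"]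
  have "(jacobi_weight (a - 1) (b - 1) has_integral 2 powr (a + b - 2) * (2 * Beta b a)) {-1..1}"
  proof (rule has_integral_eq [rotated])
    fix x :: real assume x: "x \<in> {-1..1}"
    have 1: "2 powr (a + b - 2) = 2 powr (b - 1) * 2 powr (a - 1)" for a b :: real
      by (simp flip: powr_add add: add.commute)
    have "2 powr (a + b - 2) * ((x / 2 + 1/2) powr (b - 1) * (1 - (x / 2 + 1/2)) powr (a - 1))
      = (2 powr (b - 1) * (x / 2 + 1/2) powr (b - 1)) * (2 powr (a - 1) * (1 - (x / 2 + 1/2)) powr (a - 1))"
      by (simp only: 1 mult_ac)
    also have "\<dots> = (2 * (x / 2 + 1/2)) powr (b - 1) * (2 * (1 - (x / 2 + 1/2))) powr (a - 1)"
      using x by (subst (1 2) powr_mult) (simp_all only: powr_mult)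
    also have "2 * (x / 2 + 1/2) = 1 + x" by simp
    also have "2 * (1 - (x / 2 + 1/2)) = 1 - x" by simp
    also have "(1 + x) powr (b - 1) * (1 - x) powr (a - 1) = jacobi_weight (a - 1) (b - 1) x"
      unfolding jacobi_weight_def by (rule mult.commute)
    finally show "2 powr (a + b - 2) * ((x / 2 + 1/2) powr (b - 1) * (1 - (x / 2 + 1/2)) powr (a - 1))
      = jacobi_weight (a - 1) (b - 1) x" .
  qed
  moreover have "2 powr (a + b - 2) * 2 = 2 powr (a + b - 1)"
    using powr_add [of 2 "a + b - 2" 1] by simp
  ultimately show ?thesis
    by (simp add: integral_unique Beta_commute)
qed

text \<open>With \<open>s = m - 1\<close> the factors from integration by parts are (m - 1)(m -
  2)...(m - d). One of them is 0 if m lies between 1 and d. For m = 0 the product is (-1)^d d!,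
  which cancels the sign and the factorial in Rodrigues' formula; its \<open>2 ^ d\<close> cancels
  against the integral of the weight.\<close>

lemma integral_jacobi_poly_power:
  assumes \<alpha>: "\<alpha> \<ge> 1" and \<beta>: "\<beta> \<ge> 0" and m: "m \<le> d"
  shows "integral {-1..1} (\<lambda>t. poly (jacobi_poly d \<alpha> \<beta>) t * (1 - t) ^ m * jacobi_weight (\<alpha> - 1) \<beta> t)
     = (if m = 0 then 2 powr (\<alpha> + \<beta>) * Beta \<alpha> (\<beta> + real d + 1) else 0)" (is "?L = _")
proof -
  define s where "s = real m - 1"
  define c :: real where "c = (-1) ^ d / (2 ^ d * fact d)"
  have w: "(1 - t) ^ m * jacobi_weight (\<alpha> - 1) \<beta> t = jacobi_weight (\<alpha> + s) \<beta> t" if "t \<in> {-1..1}" for t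
    unfolding s_def
  proof (induction m)
    case (Suc m)
    have "(1 - t) ^ Suc m * jacobi_weight (\<alpha> - 1) \<beta> t = (1 - t) * jacobi_weight (\<alpha> + (real m - 1)) \<beta> t"
      using Suc by (simp add: mult.assoc)
    also have "\<dots> = jacobi_weight (\<alpha> + (real m - 1) + 1) \<beta> t"
      by (rule jacobi_weight_mult(1) [OF that])
    finally show ?case by (simp add: add_ac)
  qed simp
  have "?L
      = integral {-1..1} (\<lambda>t. c * (poly (rodrigues_poly (\<alpha> + real d) (\<beta> + real d) d) t * jacobi_weight (\<alpha> + s) \<beta> t))"
    by (intro integral_cong) (simp add: jacobi_poly_eq c_def mult.assoc w)
  also have "\<dots> = c * integral {-1..1} (\<lambda>t. poly (rodrigues_poly (\<alpha> + real d) (\<beta> + real d) d) t * jacobi_weight (\<alpha> + s) \<beta> t)"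
    by (rule integral_mult_right)
  also have "\<dots> = c * ((\<Prod>j<d. s - real (d - Suc j)) * integral {-1..1} (jacobi_weight (\<alpha> + s) (\<beta> + real d)))"
    using integral_rodrigues_poly [of \<alpha> s \<beta> d d] \<alpha> \<beta> by (simp add: s_def)
  also have "(\<Prod>j<d. s - real (d - Suc j)) = (\<Prod>j<d. s - real j)"
    by (rule prod.nat_diff_reindex)
  finally have *: "?L
      = c * ((\<Prod>j<d. s - real j) * integral {-1..1} (jacobi_weight (\<alpha> + s) (\<beta> + real d)))" .
  show ?thesis
  proof (cases "m = 0")
    case True
    have "(\<Prod>j<d. s - real j) = (\<Prod>j<d. (-1) * real (Suc j))"
      using True by (intro prod.cong) (auto simp: s_def)
    also have "\<dots> = (-1) ^ d * fact d"
      unfolding prod.distrib by (simp add: fact_prod_Suc atLeast0LessThan)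
    finally have P: "(\<Prod>j<d. s - real j) = (-1) ^ d * fact d" .
    have "integral {-1..1} (jacobi_weight (\<alpha> + s) (\<beta> + real d)) = 2 powr (\<alpha> + \<beta> + real d) * Beta \<alpha> (\<beta> + real d + 1)"
      using integral_jacobi_weight [of \<alpha> "\<beta> + real d + 1"] \<alpha> \<beta> True by (simp add: s_def add_ac)
    also have "2 powr (\<alpha> + \<beta> + real d) = 2 powr (\<alpha> + \<beta>) * 2 ^ d"
      by (simp add: powr_add powr_realpow)
    finally show ?thesis using True unfolding * P by (simp add: c_def flip: power_mult_distrib)
  next
    case False
    then have "(\<Prod>j<d. s - real j) = 0"
      using m by (intro prod_zero) (auto simp: s_def intro!: bexI [of _ "m - 1"])
    then show ?thesis using False * by simp
  qed
qed

text \<open>Lowering \<alpha> by one in the weight makes the polynomial orthogonal to all multiples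
  of \<open>1 - t\<close> of degree at most \<open>d\<close>. After expansion in powers of
  \<open>1 - t\<close> only the value at 1 is left, and this is the property on which the
  reproducing kernel rests.\<close>

lemma integral_jacobi_poly:
  assumes \<alpha>: "\<alpha> \<ge> 1" and \<beta>: "\<beta> \<ge> 0" and q: "degree q \<le> d"
  shows "integral {-1..1} (\<lambda>t. poly (jacobi_poly d \<alpha> \<beta>) t * poly q t * jacobi_weight (\<alpha> - 1) \<beta> t)
     = 2 powr (\<alpha> + \<beta>) * Beta \<alpha> (\<beta> + real d + 1) * poly q 1"
proof -
  define r where "r = q \<circ>\<^sub>p [:1, -1:]"
  have "degree r \<le> d" using q by (simp add: r_def degree_pcompose)
  then have r: "poly q t = (\<Sum>m\<le>d. coeff r m * (1 - t) ^ m)" for t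
  proof -
    have "poly q t = poly r (1 - t)" by (simp add: r_def poly_pcompose)
    also have "r = (\<Sum>m\<le>d. monom (coeff r m) m)"
      using \<open>degree r \<le> d\<close> by (rule poly_as_sum_of_monoms' [symmetric])
    finally show ?thesis by (simp add: poly_sum poly_monom)
  qed
  have "((\<lambda>t. \<Sum>m\<le>d. coeff r m * (poly (jacobi_poly d \<alpha> \<beta>) t * (1 - t) ^ m * jacobi_weight (\<alpha> - 1) \<beta> t)) has_integral
     (\<Sum>m\<le>d. coeff r m * (if m = 0 then 2 powr (\<alpha> + \<beta>) * Beta \<alpha> (\<beta> + real d + 1) else 0))) {-1..1}"
    (is "(?f has_integral ?I) _")
  proof (intro has_integral_sum has_integral_mult_right finite_atMost)
    fix m assume "m \<in> {..d}"
    then show "((\<lambda>t. poly (jacobi_poly d \<alpha> \<beta>) t * (1 - t) ^ m * jacobi_weight (\<alpha> - 1) \<beta> t) has_integral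
        (if m = 0 then 2 powr (\<alpha> + \<beta>) * Beta \<alpha> (\<beta> + real d + 1) else 0)) {-1..1}"
      using integral_jacobi_poly_power [OF \<alpha> \<beta>, of m d] \<alpha> \<beta>
      by (subst has_integral_iff) (auto intro!: integrable_jacobi_weight continuous_intros)
  qed
  moreover have "?f t = poly (jacobi_poly d \<alpha> \<beta>) t * poly q t * jacobi_weight (\<alpha> - 1) \<beta> t" for t
    by (simp add: r sum_distrib_left sum_distrib_right mult_ac)
  moreover have "?I = coeff r 0 * (2 powr (\<alpha> + \<beta>) * Beta \<alpha> (\<beta> + real d + 1))"
    by (simp add: if_distrib sum.delta cong: if_cong)
  moreover have "coeff r 0 = poly q 1"
    by (simp add: r_def poly_0_coeff_0 [symmetric] poly_pcompose)
  ultimately show ?thesis by (simp add: integral_unique mult.commute)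
qed

section \<open>The rotation invariant measure on the sphere\<close>

text \<open>By Vitali, \<open>U\<close> is up to a null set a disjoint union of balls.\<close>

lemma emeasure_lborel_orthogonal_le:
  fixes T :: "'a::euclidean_space \<Rightarrow> 'a"
  assumes T: "orthogonal_transformation T" and U: "open U"
  shows "emeasure lborel U \<le> emeasure lborel (T ` U)"
proof -
  define K where "K = {(x, r). r > 0 \<and> ball x r \<subseteq> U}"
  define B where "B = (\<lambda>(x, r). ball x r :: 'a set)"
  have cover: "\<exists>i. i \<in> K \<and> x \<in> ball (fst i) (snd i) \<and> snd i < e" if x: "x \<in> U" "e > 0" for x e
  proof -
    obtain r where r: "r > 0" "ball x r \<subseteq> U" using U x open_contains_ball by blast
    then have "(x, min r (e / 2)) \<in> K" using x by (auto simp: K_def)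
    then show ?thesis using r x by (intro exI [of _ "(x, min r (e / 2))"]) auto
  qed
  obtain C where C: "countable C" "C \<subseteq> K"
     "pairwise (\<lambda>i j. disjnt (ball (fst i) (snd i)) (ball (fst j) (snd j))) C"
     "negligible (U - (\<Union>i\<in>C. ball (fst i) (snd i)))"
    by (rule Vitali_covering_theorem_balls [OF cover])
  have B: "ball (fst i) (snd i) = B i" for i by (simp add: B_def split_beta)
  have disj: "disjoint_family_on B C"
    using C(3) by (auto simp: disjoint_family_on_def pairwise_def disjnt_def B)
  \<comment> \<open>\<open>T\<close> maps a ball to a ball of the same radius, and the volume of a
    ball depends on its radius alone.\<close>
  have TB: "T ` B i = ball (T (fst i)) (snd i)" for i
    using image_orthogonal_transformation_ball [OF T] by (simp add: B_def split_beta)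
  have opB: "open (\<Union>i\<in>C. B i)" by (auto simp: B_def split_beta)
  then have m: "U - (\<Union>i\<in>C. B i) \<in> sets lborel"
    using U by (auto intro!: sets.Diff borel_open)
  have Udiff: "U - (\<Union>i\<in>C. B i) \<in> null_sets lborel"
    using C(4) m unfolding B negligible_iff_null_sets
    by (subst null_sets_completion_iff [symmetric]) auto
  have "emeasure lborel U \<le> emeasure lborel ((\<Union>i\<in>C. B i) \<union> (U - (\<Union>i\<in>C. B i)))"
    using U opB by (intro emeasure_mono) (auto intro!: borel_open open_Un)
  also have "\<dots> = emeasure lborel (\<Union>i\<in>C. B i)"
    using Udiff opB by (intro emeasure_Un_null_set) (auto intro!: borel_open)
  also have "\<dots> = (\<integral>\<^sup>+ i. emeasure lborel (B i) \<partial>count_space C)"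
    using C(1) disj by (rule emeasure_UN_countable [rotated]) (simp add: B_def split_beta)
  also have "\<dots> = (\<integral>\<^sup>+ i. emeasure lborel (T ` B i) \<partial>count_space C)"
  proof (rule nn_integral_cong)
    fix i assume "i \<in> space (count_space C)"
    then have "snd i > 0" using C(2) by (auto simp: K_def)
    then show "emeasure lborel (B i) = emeasure lborel (T ` B i)"
      unfolding TB by (simp add: B [symmetric] emeasure_ball)
  qed
  also have "\<dots> = emeasure lborel (\<Union>i\<in>C. T ` B i)"
  proof (rule emeasure_UN_countable [symmetric])
    show "disjoint_family_on (\<lambda>i. T ` B i) C"
      using disj orthogonal_transformation_inj [OF T]
      by (force simp: disjoint_family_on_def inj_def)
  qed (use C(1) in \<open>auto simp: TB\<close>)
  also have "\<dots> \<le> emeasure lborel (T ` U)"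
  proof (rule emeasure_mono)
    show "(\<Union>i\<in>C. T ` B i) \<subseteq> T ` U" using C(2) by (fastforce simp: K_def B_def)
    show "T ` U \<in> sets lborel"
      using open_surjective_linear_image [OF U orthogonal_transformation_linear [OF T]
          orthogonal_transformation_surj [OF T]] by (simp add: borel_open)
  qed
  finally show ?thesis .
qed

lemma borel_measurable_orthogonal:
  fixes T :: "'a::euclidean_space \<Rightarrow> 'a"
  shows "orthogonal_transformation T \<Longrightarrow> T \<in> borel_measurable borel"
  by (intro borel_measurable_continuous_onI linear_continuous_on)
    (simp add: orthogonal_transformation_linear linear_linear)

text \<open>The inequality for \<open>T\<close> together with the one for its inverse gives equality
  on boxes, and boxes determine Lebesgue measure.\<close>

lemma lborel_distr_orthogonal:
  fixes T :: "'a::euclidean_space \<Rightarrow> 'a"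
  assumes T: "orthogonal_transformation T"
  shows "distr lborel borel T = lborel"
proof (rule lborel_eqI [symmetric])
  fix l u :: 'a assume lu: "\<And>b. b \<in> Basis \<Longrightarrow> l \<bullet> b \<le> u \<bullet> b"
  have T': "orthogonal_transformation (inv_into UNIV T)" by (rule orthogonal_transformation_inv [OF T])
  have Tm: "T \<in> borel_measurable borel"
    by (rule borel_measurable_orthogonal [OF T])
  have bij: "bij T" using orthogonal_transformation_bij [OF T] .
  have v: "T -` box l u = inv_into UNIV T ` box l u" by (rule bij_vimage_eq_inv_image [OF bij])
  have "emeasure lborel (inv_into UNIV T ` box l u) \<le> emeasure lborel (T ` inv_into UNIV T ` box l u)"
    by (intro emeasure_lborel_orthogonal_le T open_surjective_linear_image open_box
        orthogonal_transformation_linear T' orthogonal_transformation_surj)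
  moreover have "T ` inv_into UNIV T ` box l u = box l u"
    using bij by (simp add: image_comp o_def bij_is_surj surj_f_inv_f)
  ultimately have "emeasure lborel (inv_into UNIV T ` box l u) = emeasure lborel (box l u)"
    using emeasure_lborel_orthogonal_le [OF T' open_box, of l u] by simp
  then show "emeasure (distr lborel borel T) (box l u) = (\<Prod>b\<in>Basis. (u - l) \<bullet> b)"
    using lu Tm by (simp add: emeasure_distr v emeasure_lborel_box)
qed simp

text \<open>The radial projection of the uniform distribution on the unit ball;
  \<open>sgn 0 = 0\<close> concerns a null set. It is a measure on the whole space carried by the
  sphere, so integrands remain total Borel functions and facts about unit vectors become
  almost-everywhere facts.\<close>

definition sphere_measure :: "'a::euclidean_space measure" where
  "sphere_measure = distr (uniform_measure lborel (ball 0 1)) borel sgn"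

lemma borel_measurable_sgn_vec [measurable]: "(sgn :: 'a::euclidean_space \<Rightarrow> 'a) \<in> borel_measurable borel"
proof -
  have "(\<lambda>x::'a. inverse (norm x) *\<^sub>R x) \<in> borel_measurable borel" by measurable
  then show ?thesis by (simp add: sgn_div_norm [abs_def])
qed

lemma sets_sphere_measure [simp, measurable_cong]: "sets sphere_measure = sets borel"
  by (simp add: sphere_measure_def)

lemma space_sphere_measure [simp]: "space sphere_measure = UNIV"
  by (simp add: sphere_measure_def)

lemma emeasure_unit_ball: "emeasure lborel (ball 0 1 :: 'a::euclidean_space set) \<noteq> 0"
    "emeasure lborel (ball 0 1 :: 'a::euclidean_space set) \<noteq> \<infinity>"
  by (simp_all add: emeasure_ball less_imp_neq [OF unit_ball_vol_pos, symmetric])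

lemma measurable_uniform_lborel:
  "f \<in> borel_measurable borel \<Longrightarrow> f \<in> borel_measurable (uniform_measure lborel A)"
  by (subst measurable_cong_sets [OF sets_uniform_measure refl]) simp

lemma prob_space_sphere_measure: "prob_space (sphere_measure :: 'a::euclidean_space measure)"
  unfolding sphere_measure_def
  by (intro prob_space.prob_space_distr prob_space_uniform_measure emeasure_unit_ball)
    (simp add: measurable_uniform_lborel)

interpretation sphere: prob_space "sphere_measure :: 'a::euclidean_space measure"
  by (rule prob_space_sphere_measure)

lemma AE_sphere_measure: "AE x in sphere_measure. norm (x::'a::euclidean_space) = 1"
proof -
  have "AE x in lborel. x \<noteq> (0::'a)" by (rule AE_lborel_singleton)
  then have "AE x in uniform_measure lborel (ball 0 1). norm (sgn x::'a) = 1"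
    by (intro AE_uniform_measureI) (auto simp: norm_sgn)
  then show ?thesis
    unfolding sphere_measure_def by (subst AE_distr_iff) auto
qed

text \<open>\<open>T\<close> preserves Lebesgue measure and the unit ball, and it commutes with the
  radial projection \<open>sgn\<close>.\<close>

lemma sphere_measure_orthogonal:
  fixes T :: "'a::euclidean_space \<Rightarrow> 'a"
  assumes T: "orthogonal_transformation T"
  shows "distr sphere_measure borel T = sphere_measure"
proof -
  have Tm [measurable]: "T \<in> borel_measurable borel"
    by (rule borel_measurable_orthogonal [OF T])
  let ?U = "uniform_measure lborel (ball 0 1 :: 'a set)"
  have U: "distr ?U borel T = ?U"
  proof (rule measure_eqI)
    fix A assume "A \<in> sets (distr ?U borel T)"
    then have A [measurable]: "A \<in> sets borel" by simp
    have "ball 0 1 \<inter> T -` A = T -` (ball 0 1 \<inter> A)"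
      using orthogonal_transformation_norm [OF T] by auto
    moreover have "emeasure lborel (T -` (ball 0 1 \<inter> A)) = emeasure (distr lborel borel T) (ball 0 1 \<inter> A)"
      by (subst emeasure_distr) auto
    ultimately have "emeasure lborel (ball 0 1 \<inter> T -` A) = emeasure lborel (ball 0 1 \<inter> A)"
      using lborel_distr_orthogonal [OF T] by simp
    moreover have "T -` A \<in> sets borel"
      using measurable_sets [OF Tm A] by simp
    ultimately show "emeasure (distr ?U borel T) A = emeasure ?U A"
      by (simp add: emeasure_distr emeasure_uniform_measure)
  qed simp
  have "distr sphere_measure borel T = distr ?U borel (T \<circ> sgn)"
    unfolding sphere_measure_def by (rule distr_distr) (auto simp: measurable_uniform_lborel)
  also have "T \<circ> sgn = sgn \<circ> T"
    using T by (auto simp: sgn_div_norm orthogonal_transformation_scaleR orthogonal_transformation_norm)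
  also have "distr ?U borel (sgn \<circ> T) = distr (distr ?U borel T) borel sgn"
    by (rule distr_distr [symmetric]) auto
  also have "\<dots> = sphere_measure" by (simp add: U sphere_measure_def)
  finally show ?thesis .
qed

abbreviation sphere_average :: "('a::euclidean_space \<Rightarrow> 'b::{banach, second_countable_topology}) \<Rightarrow> 'b"
  (binder "AVG " 10)
  where "sphere_average f \<equiv> integral\<^sup>L sphere_measure f"

lemma integrable_sphere_measure:
  fixes f :: "'a::euclidean_space \<Rightarrow> 'b::{banach, second_countable_topology}"
  assumes "f \<in> borel_measurable borel" "\<And>x. norm x = 1 \<Longrightarrow> norm (f x) \<le> B"
  shows "integrable sphere_measure f"
  using AE_sphere_measure assms by (intro sphere.integrable_const_bound [where B = B]) auto

lemma integrable_sphere_continuous: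
  fixes f :: "'a::euclidean_space \<Rightarrow> 'b::{banach, second_countable_topology}"
  assumes f: "continuous_on UNIV f"
  shows "integrable sphere_measure f"
proof -
  have "bounded (f ` sphere 0 1)"
    by (intro compact_imp_bounded compact_continuous_image continuous_on_subset [OF f]) auto
  then obtain B where "\<And>x. norm x = 1 \<Longrightarrow> norm (f x) \<le> B"
    by (force simp: bounded_iff)
  then show ?thesis using f by (intro integrable_sphere_measure borel_measurable_continuous_onI)
qed

lemma integral_sphere_cong:
  fixes f g :: "'a::euclidean_space \<Rightarrow> 'b::{banach, second_countable_topology}"
  assumes "f \<in> borel_measurable borel" "g \<in> borel_measurable borel"
    and "\<And>x. norm x = 1 \<Longrightarrow> f x = g x"
  shows "integral\<^sup>L sphere_measure f = integral\<^sup>L sphere_measure g"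
  by (intro integral_cong_AE) (use assms AE_sphere_measure in auto)

lemma integral_sphere_orthogonal:
  fixes f :: "'a::euclidean_space \<Rightarrow> 'b::{banach, second_countable_topology}" and T :: "'a \<Rightarrow> 'a"
  assumes T: "orthogonal_transformation T" and f: "f \<in> borel_measurable borel"
  shows "(AVG x. f (T x)) = (AVG x. f x)"
proof -
  have "T \<in> borel_measurable borel"
    by (rule borel_measurable_orthogonal [OF T])
  then have "(AVG x. f (T x)) = (\<integral>x. f x \<partial>distr sphere_measure borel T)"
    using f by (subst integral_distr) auto
  then show ?thesis by (simp add: sphere_measure_orthogonal [OF T])
qed

section \<open>Moments of linear forms on the sphere\<close>

definition sphere_moment :: "'n::finite itself \<Rightarrow> nat \<Rightarrow> real" where
  "sphere_moment _ N = (AVG y. (axis (SOME i. True) 1 \<bullet> (y :: real ^ 'n)) ^ N)"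

text \<open>An orthogonal map takes \<open>norm x\<close> times the chosen axis vector to
  \<open>x\<close>. In particular the moment is the same whichever coordinate \<open>SOME\<close>
  picks.\<close>

lemma sphere_moment:
  fixes x :: "real ^ 'n"
  shows "(AVG y. (x \<bullet> y) ^ N) = norm x ^ N * sphere_moment TYPE('n) N"
proof -
  let ?e = "axis (SOME i. True) 1 :: real ^ 'n"
  have "norm (norm x *\<^sub>R ?e) = norm x" by (simp add: norm_axis_1)
  then obtain T where T: "orthogonal_transformation T" "T (norm x *\<^sub>R ?e) = x"
    using orthogonal_transformation_exists by metis
  have "(AVG y. (x \<bullet> y) ^ N) = (AVG y. (x \<bullet> T y) ^ N)"
    by (rule integral_sphere_orthogonal [OF T(1), symmetric]) measurable
  also have "\<dots> = (AVG y. norm x ^ N * (?e \<bullet> y) ^ N)"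
  proof (rule Bochner_Integration.integral_cong)
    fix y
    have "x \<bullet> T y = T (norm x *\<^sub>R ?e) \<bullet> T y" by (simp add: T(2))
    also have "\<dots> = norm x *\<^sub>R ?e \<bullet> y" using T(1) by (simp only: orthogonal_transformation_def)
    finally show "(x \<bullet> T y) ^ N = norm x ^ N * (?e \<bullet> y) ^ N" by (simp add: power_mult_distrib)
  qed simp
  also have "\<dots> = norm x ^ N * sphere_moment TYPE('n) N"
    by (simp add: sphere_moment_def)
  finally show ?thesis .
qed

context
  fixes x v :: "real ^ 'n"
  assumes x: "norm x = 1" and v: "x \<bullet> v = 0"
begin

definition joint_moment :: "nat \<Rightarrow> nat \<Rightarrow> real" where
  "joint_moment p q = (AVG y. (x \<bullet> y) ^ p * (v \<bullet> y) ^ q)"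

text \<open>Generating polynomial of the joint moments of total degree \<open>N\<close>: the average
  of \<open>((x + e *\<^sub>R v) \<bullet> y) ^ N\<close>, expanded in powers of
  \<open>e\<close>.\<close>

definition joint_poly :: "nat \<Rightarrow> real poly" where
  "joint_poly N = (\<Sum>i\<le>N. monom (real (N choose i) * joint_moment (N - i) i) i)"

lemma coeff_joint_poly:
  "coeff (joint_poly N) i = (if i \<le> N then real (N choose i) * joint_moment (N - i) i else 0)"
  by (simp add: joint_poly_def coeff_sum)

lemma poly_joint_poly: "poly (joint_poly N) e = sqrt (1 + (norm v)\<^sup>2 * e\<^sup>2) ^ N * sphere_moment TYPE('n) N"
proof -
  have "(norm (x + e *\<^sub>R v))\<^sup>2 = 1 + (norm v)\<^sup>2 * e\<^sup>2"
    using x v by (simp add: norm_add_Pythagorean orthogonal_def power_mult_distrib mult.commute)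
  then have nrm: "norm (x + e *\<^sub>R v) = sqrt (1 + (norm v)\<^sup>2 * e\<^sup>2)"
    by (metis norm_ge_zero real_sqrt_unique)
  have "((x + e *\<^sub>R v) \<bullet> y) ^ N = (\<Sum>i\<le>N. (real (N choose i) * e ^ i) * ((x \<bullet> y) ^ (N - i) * (v \<bullet> y) ^ i))" for y
    using binomial_ring [of "e * (v \<bullet> y)" "x \<bullet> y" N]
    by (simp add: inner_add_left power_mult_distrib algebra_simps)
  then have "(AVG y. ((x + e *\<^sub>R v) \<bullet> y) ^ N) = poly (joint_poly N) e"
    by (simp add: joint_poly_def poly_sum poly_monom joint_moment_def mult_ac
        Bochner_Integration.integral_sum integrable_sphere_continuous continuous_intros)
  then show ?thesis by (simp add: sphere_moment nrm)
qed

text \<open>By rotation invariance the polynomial is a multiple of \<open>(1 + b e\<^sup>2)\<^bsup>N/2\<^esup>\<close>.\<close>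

lemma joint_poly_ode:
  "[:1, 0, (norm v)\<^sup>2:] * pderiv (joint_poly N) = Polynomial.smult (real N * (norm v)\<^sup>2) [:0, 1:] * joint_poly N"
proof (rule poly_ext)
  fix e
  define b where "b = (norm v)\<^sup>2"
  have pos: "1 + b * e\<^sup>2 > 0" unfolding b_def
    by (intro add_pos_nonneg mult_nonneg_nonneg) auto
  define S where "S = sqrt (1 + b * e\<^sup>2)"
  have S: "S > 0" "S * S = 1 + b * e\<^sup>2" using pos by (auto simp: S_def)
  have "((\<lambda>e. sqrt (1 + b * e\<^sup>2) ^ N * sphere_moment TYPE('n) N) has_real_derivative
      real N * S ^ (N - 1) * (b * e / S) * sphere_moment TYPE('n) N) (at e)"
    using pos unfolding S_def
    by (auto intro!: derivative_eq_intros simp: field_simps)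
  moreover have "(\<lambda>e. sqrt (1 + b * e\<^sup>2) ^ N * sphere_moment TYPE('n) N) = poly (joint_poly N)"
    by (simp add: poly_joint_poly b_def fun_eq_iff)
  ultimately have "poly (pderiv (joint_poly N)) e = real N * S ^ (N - 1) * (b * e / S) * sphere_moment TYPE('n) N"
    using DERIV_unique poly_DERIV by metis
  then have "(1 + b * e\<^sup>2) * poly (pderiv (joint_poly N)) e
      = real N * b * e * (S * S ^ (N - 1)) * sphere_moment TYPE('n) N"
    using S by (simp add: S(2) [symmetric] field_simps)
  also have "\<dots> = real N * b * e * poly (joint_poly N) e"
    by (cases N) (simp_all add: poly_joint_poly b_def [symmetric] S_def [symmetric])
  finally show "poly ([:1, 0, (norm v)\<^sup>2:] * pderiv (joint_poly N)) e
      = poly (Polynomial.smult (real N * (norm v)\<^sup>2) [:0, 1:] * joint_poly N) e"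
    by (simp add: b_def power2_eq_square algebra_simps)
qed

text \<open>The right-hand side of the differential equation has no constant term, so neither has
  the derivative of the generating polynomial.\<close>

lemma joint_moment_1: "joint_moment p 1 = 0"
proof -
  have "coeff ([:1, 0, (norm v)\<^sup>2:] * pderiv (joint_poly (Suc p))) 0 = 0"
    unfolding joint_poly_ode by (simp add: coeff_mult_0)
  then show ?thesis by (simp add: coeff_mult_0 coeff_pderiv coeff_joint_poly)
qed

text \<open>Comparison of the coefficients of \<open>e ^ (q + 1)\<close> in the differential
  equation, for total degree \<open>N = p + 1 + q\<close>; the binomial coefficients cancel by
  absorption. The effect is to trade two factors \<open>v \<bullet> y\<close> for two factors
  \<open>x \<bullet> y\<close>.\<close>

lemma joint_moment_rec:
  "real p * joint_moment (p - 1) (q + 2) = (norm v)\<^sup>2 * real (q + 1) * joint_moment (p + 1) q"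
proof -
  define N where "N = p + 1 + q"
  define b where "b = (norm v)\<^sup>2"
  define H where "H = joint_poly N"
  have "coeff (pCons 0 (pCons 0 (Polynomial.smult b (pderiv H)))) (q + 1) = b * real q * coeff H q"
    by (cases q) (auto simp: coeff_pderiv)
  moreover have "[:1, 0, b:] * pderiv H = pderiv H + pCons 0 (pCons 0 (Polynomial.smult b (pderiv H)))"
    by simp
  ultimately have l: "coeff ([:1, 0, b:] * pderiv H) (q + 1) = real (q + 2) * coeff H (q + 2) + b * real q * coeff H q"
    by (simp add: coeff_pderiv)
  have r: "coeff (Polynomial.smult (real N * b) [:0, 1:] * H) (q + 1) = real N * b * coeff H q"
    by simp
  have "real (q + 2) * coeff H (q + 2) + b * real q * coeff H q = real N * b * coeff H q"
    unfolding l [symmetric] r [symmetric] unfolding b_def H_def joint_poly_ode ..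
  then have *: "real (q + 2) * coeff H (q + 2) = b * real (p + 1) * coeff H q"
    by (simp add: N_def algebra_simps)
  have Hq: "coeff H q = real (N choose q) * joint_moment (p + 1) q"
    by (simp add: H_def coeff_joint_poly N_def)
  have c0: "real (N choose q) \<noteq> 0" by (simp add: N_def)
  show ?thesis
  proof (cases p)
    case 0
    then have "coeff H (q + 2) = 0" by (simp add: H_def coeff_joint_poly N_def)
    then show ?thesis using * 0 c0 by (simp add: Hq b_def)
  next
    case (Suc m)
    have Hq2: "coeff H (q + 2) = real (N choose (q + 2)) * joint_moment (p - 1) (q + 2)"
      by (simp add: H_def coeff_joint_poly N_def Suc)
    have absorb: "Suc k * (N choose Suc k) = (N - k) * (N choose k)" for k
      by (simp only: binomial_absorption binomial_absorb_comp)
    have "N - (q + 1) = p" "N - q = p + 1" by (simp_all add: N_def)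
    then have "(q + 2) * (N choose (q + 2)) = p * (N choose (q + 1))"
      "(q + 1) * (N choose (q + 1)) = (p + 1) * (N choose q)"
      using absorb [of "q + 1"] absorb [of q] by (simp_all del: mult_Suc binomial_Suc_Suc)
    then have "(q + 1) * ((q + 2) * (N choose (q + 2))) = p * ((p + 1) * (N choose q))"
      by (metis mult.left_commute)
    then have ch: "real (q + 1) * (real (q + 2) * real (N choose (q + 2))) = real p * (real (p + 1) * real (N choose q))"
      by (metis of_nat_mult)
    have "real p * real (p + 1) * real (N choose q) * joint_moment (p - 1) (q + 2)
        = real (q + 1) * (real (q + 2) * coeff H (q + 2))"
      unfolding Hq2 using ch by (simp add: mult_ac)
    also have "\<dots> = b * real (q + 1) * real (p + 1) * real (N choose q) * joint_moment (p + 1) q"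
      unfolding * Hq by (simp add: mult_ac)
    finally show ?thesis using c0 by (simp add: b_def mult_ac)
  qed
qed

lemma joint_moment_odd: "odd q \<Longrightarrow> joint_moment p q = 0"
proof (induction q arbitrary: p rule: less_induct)
  case (less q)
  show ?case
  proof (cases "q = 1")
    case True then show ?thesis by (simp add: joint_moment_1 [simplified])
  next
    case False
    with less.prems have "q \<ge> 2" by (cases q) auto
    then obtain r where q: "q = r + 2" by (metis le_add_diff_inverse2)
    with less.prems have r: "q = r + 2" "odd r" by auto
    then have "real (p + 1) * joint_moment p q = 0"
      using joint_moment_rec [of "p + 1" r] less.IH [of r] by simp
    then show ?thesis by simp
  qed
qed

end

text \<open>On the sphere, 1 minus the square of one coordinate is the sum of the squares of the
  other n - 1. Each resulting mixed moment comes from \<open>joint_moment_rec\<close> with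
  \<open>q = 0\<close>, applied to two axis vectors.\<close>

lemma sphere_moment_rec:
  "real (k + 1) * (sphere_moment TYPE('n::finite) k - sphere_moment TYPE('n) (k + 2))
     = (real CARD('n) - 1) * sphere_moment TYPE('n) (k + 2)"
proof -
  define i :: 'n where "i = (SOME i. True)"
  have m: "sphere_moment TYPE('n) k = (AVG y. ((y::real ^ 'n) $ i) ^ k)" for k
    by (simp add: sphere_moment_def i_def inner_axis')
  have j: "(AVG y. ((y::real ^ 'n) $ i) ^ k * (y $ j)\<^sup>2)
      = sphere_moment TYPE('n) (k + 2) / real (k + 1)" if "j \<noteq> i" for j
  proof -
    have "axis i 1 \<bullet> (axis j 1 :: real ^ 'n) = 0" "norm (axis i 1 :: real ^ 'n) = 1"
      "norm (axis j 1 :: real ^ 'n) = 1"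
      using that by (auto simp: inner_axis_axis norm_axis_1)
    from joint_moment_rec [OF this(2,1), of "k + 1" 0] this(3)
    have "real (k + 1) * (AVG y. ((y::real ^ 'n) $ i) ^ k * (y $ j)\<^sup>2) = sphere_moment TYPE('n) (k + 2)"
      by (simp add: power2_eq_square joint_moment_def [OF \<open>norm (axis i 1 :: real ^ 'n) = 1\<close> \<open>axis i 1 \<bullet> axis j 1 = 0\<close>]
          inner_axis' m)
    then show ?thesis by (subst nonzero_eq_divide_eq) (simp_all add: mult.commute)
  qed
  have "sphere_moment TYPE('n) k - sphere_moment TYPE('n) (k + 2)
      = (AVG y. ((y::real ^ 'n) $ i) ^ k - (y $ i) ^ (k + 2))"
    unfolding m by (subst Bochner_Integration.integral_diff)
      (auto intro!: integrable_sphere_continuous continuous_intros)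
  also have "\<dots> = (AVG y. (\<Sum>j\<in>UNIV - {i}. ((y::real ^ 'n) $ i) ^ k * (y $ j)\<^sup>2))"
  proof (rule integral_sphere_cong)
    fix y :: "real ^ 'n" assume "norm y = 1"
    then have "(\<Sum>j\<in>UNIV. (y $ j)\<^sup>2) = 1"
      by (simp add: norm_vec_def L2_set_def)
    then have "(y $ i)\<^sup>2 + (\<Sum>j\<in>UNIV - {i}. (y $ j)\<^sup>2) = 1"
      by (simp add: sum.remove [of UNIV i])
    then have *: "(\<Sum>j\<in>UNIV - {i}. (y $ j)\<^sup>2) = 1 - (y $ i)\<^sup>2" by simp
    show "(y $ i) ^ k - (y $ i) ^ (k + 2) = (\<Sum>j\<in>UNIV - {i}. (y $ i) ^ k * (y $ j)\<^sup>2)"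
      unfolding sum_distrib_left [symmetric] * by (simp add: power2_eq_square algebra_simps)
  qed measurable
  also have "\<dots> = (\<Sum>j\<in>UNIV - {i}. sphere_moment TYPE('n) (k + 2) / real (k + 1))"
    by (subst Bochner_Integration.integral_sum)
      (auto intro!: integrable_sphere_continuous continuous_intros simp: j)
  also have "\<dots> = (real CARD('n) - 1) * sphere_moment TYPE('n) (k + 2) / real (k + 1)"
    by (simp add: card_Diff_singleton of_nat_diff)
  finally show ?thesis by (simp add: field_simps)
qed

lemma sphere_moment_1:
  assumes "CARD('n::finite) > 1" shows "sphere_moment TYPE('n) 1 = 0"
proof -
  define i :: 'n where "i = (SOME i. True)"
  have "UNIV \<noteq> {i}"
  proof
    assume "UNIV = {i}"
    then have "CARD('n) = card {i}" by (rule arg_cong)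
    then show False using assms by simp
  qed
  then obtain j where "j \<noteq> i" by auto
  then have a: "axis j 1 \<bullet> (axis i 1 :: real ^ 'n) = 0" "norm (axis j 1 :: real ^ 'n) = 1"
    by (auto simp: inner_axis_axis norm_axis_1)
  have "sphere_moment TYPE('n) 1 = joint_moment (axis j 1) (axis i 1 :: real ^ 'n) 0 1"
    by (simp add: joint_moment_def [OF a(2,1)] sphere_moment_def i_def [symmetric])
  then show ?thesis using joint_moment_1 [OF a(2,1), of 0] by simp
qed

lemma sphere_moment_0: "sphere_moment TYPE('n::finite) 0 = 1"
  using sphere.prob_space [where 'a = "real ^ 'n"] by (simp add: sphere_moment_def)

text \<open>Both sequences begin with 1, 0 and satisfy the same two-step recursion, because
  \<open>2 * (\<nu> + 1)\<close> is n - 1. This identifies the distribution of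
  \<open>x \<bullet> y\<close> for a unit vector \<open>x\<close>, so far on the level of
  moments.\<close>

lemma sphere_moment_eq:
  assumes n: "CARD('n::finite) > 2"
  defines "\<nu> \<equiv> (real CARD('n) - 3) / 2"
  shows "sphere_moment TYPE('n) k = gegenbauer_moment \<nu> k / gegenbauer_moment \<nu> 0"
proof -
  have \<nu>: "\<nu> \<ge> 0" using n by (simp add: \<nu>_def)
  note pos = gegenbauer_moment_0_pos [OF \<nu>]
  show ?thesis
  proof (induction k rule: induct_nat_012 [case_names 0 1 ge2])
    case 0
    then show ?case using pos by (simp add: sphere_moment_0)
  next
    case 1
    have "sphere_moment TYPE('n) 1 = 0" using n by (intro sphere_moment_1) simp_all
    moreover have "gegenbauer_moment \<nu> 1 = 0" using gegenbauer_moment_rec [OF \<nu>, of 0] \<nu> by simp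
    ultimately show ?case by simp
  next
    case (ge2 k)
    let ?S = "sphere_moment TYPE('n)" and ?G = "gegenbauer_moment \<nu>"
    have "real (k + 1) * (?G k - ?G (k + 2)) = (real CARD('n) - 1) * ?G (k + 2)"
    proof -
      have "2 * (\<nu> + 1) = real CARD('n) - 1" by (simp add: \<nu>_def field_simps)
      then show ?thesis
        using gegenbauer_moment_rec [OF \<nu>, of "k + 1"] unfolding gegenbauer_moment_Suc [OF \<nu>] by simp
    qed
    then have G: "real (k + 1) * ?G k = (real (k + 1) + (real CARD('n) - 1)) * ?G (k + 2)"
      by (simp add: algebra_simps)
    have S: "real (k + 1) * ?S k = (real (k + 1) + (real CARD('n) - 1)) * ?S (k + 2)"
      using sphere_moment_rec [where 'n = 'n, of k] by (simp add: algebra_simps)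
    have "(real (k + 1) + (real CARD('n) - 1)) * ?S (k + 2) = real (k + 1) * ?G k / ?G 0"
      using S ge2 by simp
    also have "\<dots> = (real (k + 1) + (real CARD('n) - 1)) * (?G (k + 2) / ?G 0)"
      unfolding G by simp
    finally have "?S (k + 2) = ?G (k + 2) / ?G 0"
      by (subst (asm) mult_left_cancel) (use n in simp_all)
    then show ?case by simp
  qed
qed

text \<open>For \<nu> = (n - 3)/2, \<open>joint_const \<nu> j * gegenbauer_moment \<nu> 0\<close> is
  the moment of order \<open>2 * j\<close> of one coordinate on the unit sphere of n - 1 dimensional
  space: the part of \<open>y\<close> orthogonal to \<open>x\<close>, rescaled to length 1, is
  uniformly distributed there.\<close>

fun joint_const :: "real \<Rightarrow> nat \<Rightarrow> real" where
  "joint_const \<nu> 0 = 1 / gegenbauer_moment \<nu> 0"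
| "joint_const \<nu> (Suc j) = real (2 * j + 1) / (2 * (\<nu> + real j + 1)) * joint_const \<nu> j"

text \<open>Two factors \<open>v \<bullet> y\<close> are exchanged for two factors
  \<open>x \<bullet> y\<close>, and \<open>gegenbauer_moment_rec\<close> turns these into a weight
  exponent larger by one. Both recursions carry the same factor \<open>p + 1\<close>, which
  cancels.\<close>

lemma joint_moment_even:
  fixes x v :: "real ^ 'n"
  assumes x: "norm x = 1" and v: "x \<bullet> v = 0" and n: "CARD('n) > 2"
  defines "\<nu> \<equiv> (real CARD('n) - 3) / 2"
  shows "joint_moment x v p (2 * j) = (norm v)\<^sup>2 ^ j * joint_const \<nu> j * gegenbauer_moment (\<nu> + real j) p"
proof (induction j arbitrary: p)
  case 0
  show ?case
    using sphere_moment_eq [OF n, of p] sphere_moment [of x p] x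
    by (simp add: joint_moment_def [OF x v] \<nu>_def)
next
  case (Suc j)
  have \<nu>: "\<nu> + real j \<ge> 0" using n by (simp add: \<nu>_def)
  have "real (p + 1) * joint_moment x v p (2 * Suc j)
      = (norm v)\<^sup>2 * real (2 * j + 1) * joint_moment x v (p + 2) (2 * j)"
    using joint_moment_rec [OF x v, of "p + 1" "2 * j"] by simp
  also have "\<dots> = (norm v)\<^sup>2 * real (2 * j + 1) * ((norm v)\<^sup>2 ^ j * joint_const \<nu> j) * gegenbauer_moment (\<nu> + real j) (p + 2)"
    by (simp add: Suc.IH)
  also have "gegenbauer_moment (\<nu> + real j) (p + 2)
      = real (p + 1) * gegenbauer_moment (\<nu> + real j + 1) p / (2 * (\<nu> + real j + 1))"
    using gegenbauer_moment_rec [OF \<nu>, of "p + 1"] \<nu> by (simp add: field_simps)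
  finally have "real (p + 1) * joint_moment x v p (2 * Suc j)
      = real (p + 1) * ((norm v)\<^sup>2 ^ Suc j * joint_const \<nu> (Suc j) * gegenbauer_moment (\<nu> + real j + 1) p)"
    by (simp add: mult_ac)
  then have "joint_moment x v p (2 * Suc j)
      = (norm v)\<^sup>2 ^ Suc j * joint_const \<nu> (Suc j) * gegenbauer_moment (\<nu> + real j + 1) p"
    by (subst (asm) mult_left_cancel) simp_all
  then show ?case by (simp add: add_ac)
qed

section \<open>The reproducing kernel\<close>

lemma norm_diff_projection:
  fixes x z :: "'a::real_inner"
  assumes "norm x = 1" "norm z = 1"
  shows "x \<bullet> (z - (x \<bullet> z) *\<^sub>R x) = 0" and "(norm (z - (x \<bullet> z) *\<^sub>R x))\<^sup>2 = 1 - (x \<bullet> z)\<^sup>2"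
proof -
  have "x \<bullet> x = 1" "z \<bullet> z = 1" using assms by (simp_all add: norm_eq_sqrt_inner)
  then show "x \<bullet> (z - (x \<bullet> z) *\<^sub>R x) = 0" "(norm (z - (x \<bullet> z) *\<^sub>R x))\<^sup>2 = 1 - (x \<bullet> z)\<^sup>2"
    unfolding power2_norm_eq_inner
    by (simp_all add: inner_diff_left inner_diff_right inner_commute power2_eq_square)
qed

lemma has_integral_gegenbauer_poly:
  assumes "\<nu> \<ge> 0"
  shows "((\<lambda>t. poly q t * t ^ p * (1 - t\<^sup>2) powr \<nu>) has_integral
    (\<Sum>m\<le>degree q. coeff q m * gegenbauer_moment \<nu> (m + p))) {-1..1}"
proof (rule has_integral_eq [rotated])
  show "((\<lambda>t. \<Sum>m\<le>degree q. coeff q m * (t ^ (m + p) * (1 - t\<^sup>2) powr \<nu>)) has_integral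
    (\<Sum>m\<le>degree q. coeff q m * gegenbauer_moment \<nu> (m + p))) {-1..1}"
    by (intro has_integral_sum has_integral_mult_right has_integral_gegenbauer_moment assms finite_atMost)
qed (simp add: poly_altdef sum_distrib_left sum_distrib_right power_add mult_ac)

lemma gegenbauer_weight_add:
  assumes "t \<in> {-1..1}"
  shows "(1 - t\<^sup>2) powr (\<nu> + real j) = (1 - t\<^sup>2) ^ j * (1 - t\<^sup>2) powr \<nu>"
proof -
  have "0 \<le> 1 - t\<^sup>2" using assms by (simp add: abs_square_le_1 abs_le_iff)
  then show ?thesis by (cases "1 - t\<^sup>2 = 0") (auto simp: powr_add powr_realpow)
qed

text \<open>In z = t x + v with v orthogonal to x, the index \<open>i\<close> counts the factors
  \<open>v \<bullet> y\<close>. Odd powers average to 0. An even power contributes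
  \<open>norm v ^ i = (1 - t^2) ^ (i div 2)\<close>, a factor supplied by
  \<open>zonal_poly\<close>.\<close>

definition zonal_coeff :: "real \<Rightarrow> real poly \<Rightarrow> nat \<Rightarrow> nat \<Rightarrow> real" where
  "zonal_coeff \<nu> q l i = (if even i then real (l choose i) * joint_const \<nu> (i div 2) *
     (\<Sum>m\<le>degree q. coeff q m * gegenbauer_moment (\<nu> + real (i div 2)) (m + (l - i))) else 0)"

definition zonal_poly :: "real \<Rightarrow> real poly \<Rightarrow> nat \<Rightarrow> real poly" where
  "zonal_poly \<nu> q l = (\<Sum>i\<le>l. Polynomial.smult (zonal_coeff \<nu> q l i) ([:1, 0, -1:] ^ (i div 2) * monom 1 (l - i)))"

lemma degree_zonal_poly: "degree (zonal_poly \<nu> q l) \<le> l"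
  unfolding zonal_poly_def
proof (intro degree_sum_le)
  fix i assume "i \<in> {..l}"
  have "degree ([:1, 0, -1 :: real:] ^ (i div 2) * monom 1 (l - i)) \<le> 2 * (i div 2) + (l - i)"
    by (intro order_trans [OF degree_mult_le] add_mono order_trans [OF degree_power_le] order_trans [OF degree_monom_le])
      auto
  also have "\<dots> \<le> l" using \<open>i \<in> {..l}\<close> by auto
  finally show "degree (Polynomial.smult (zonal_coeff \<nu> q l i) ([:1, 0, -1:] ^ (i div 2) * monom 1 (l - i))) \<le> l"
    using degree_smult_le order_trans by blast
qed simp

text \<open>A substitute for the Funk-Hecke formula: averaging against a zonal kernel sends a power
  of \<open>z \<bullet> y\<close> to a polynomial in \<open>x \<bullet> z\<close> of no higher
  degree. The result is a polynomial because only even powers of \<open>norm v\<close>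
  survive.\<close>

lemma integral_zonal:
  fixes x z :: "real ^ 'n"
  assumes n: "CARD('n) > 2" and x: "norm x = 1" and z: "norm z = 1"
  shows "(AVG y. poly q (x \<bullet> y) * (z \<bullet> y) ^ l)
    = poly (zonal_poly ((real CARD('n) - 3) / 2) q l) (x \<bullet> z)"
proof -
  define \<tau> where "\<tau> = x \<bullet> z"
  define v where "v = z - \<tau> *\<^sub>R x"
  define \<nu> where "\<nu> = (real CARD('n) - 3) / 2"
  have v: "x \<bullet> v = 0" "(norm v)\<^sup>2 = 1 - \<tau>\<^sup>2"
    using norm_diff_projection [OF x z] by (simp_all add: v_def \<tau>_def)
  note jd = joint_moment_def [OF x v(1)]
  have zy: "z \<bullet> y = v \<bullet> y + \<tau> * (x \<bullet> y)" for y
    by (simp add: v_def inner_diff_left)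
  have "poly q (x \<bullet> y) * (z \<bullet> y) ^ l = (\<Sum>i\<le>l. \<Sum>m\<le>degree q. real (l choose i) * \<tau> ^ (l - i) * coeff q m *
      ((x \<bullet> y) ^ (m + (l - i)) * (v \<bullet> y) ^ i))" for y
    unfolding zy binomial_ring poly_altdef sum_distrib_left sum_distrib_right power_mult_distrib power_add
    by (simp only: mult_ac)
  then have "(AVG y. poly q (x \<bullet> y) * (z \<bullet> y) ^ l)
    = (\<Sum>i\<le>l. \<Sum>m\<le>degree q. real (l choose i) * \<tau> ^ (l - i) * coeff q m * joint_moment x v (m + (l - i)) i)"
    by (simp add: jd Bochner_Integration.integral_sum integrable_sphere_continuous continuous_intros)
  also have "\<dots> = (\<Sum>i\<le>l. zonal_coeff \<nu> q l i * ((1 - \<tau>\<^sup>2) ^ (i div 2) * \<tau> ^ (l - i)))"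
  proof (rule sum.cong)
    fix i assume "i \<in> {..l}"
    show "(\<Sum>m\<le>degree q. real (l choose i) * \<tau> ^ (l - i) * coeff q m * joint_moment x v (m + (l - i)) i)
        = zonal_coeff \<nu> q l i * ((1 - \<tau>\<^sup>2) ^ (i div 2) * \<tau> ^ (l - i))"
    proof (cases "even i")
      case False
      then show ?thesis using joint_moment_odd [OF x v(1) False] by (simp add: zonal_coeff_def)
    next
      case True
      then have "joint_moment x v p i = (1 - \<tau>\<^sup>2) ^ (i div 2) * joint_const \<nu> (i div 2) * gegenbauer_moment (\<nu> + real (i div 2)) p" for p
        using joint_moment_even [OF x v(1) n, of p "i div 2"] v(2) by (simp add: \<nu>_def)
      then show ?thesis using True
        by (simp add: zonal_coeff_def sum_distrib_left sum_distrib_right mult_ac)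
    qed
  qed simp
  also have "\<dots> = poly (zonal_poly \<nu> q l) \<tau>"
    by (simp add: zonal_poly_def poly_sum poly_monom power2_eq_square)
  finally show ?thesis by (simp add: \<tau>_def \<nu>_def)
qed

text \<open>The constant from \<open>integral_jacobi_poly\<close> at \<alpha> = \<nu> + 1 and
  \<beta> = \<nu>.\<close>

definition kernel_norm :: "real \<Rightarrow> nat \<Rightarrow> real" where
  "kernel_norm \<nu> d = 2 powr (2 * \<nu> + 1) * Beta (\<nu> + 1) (\<nu> + real d + 1)"

lemma kernel_norm_pos: "\<nu> \<ge> 0 \<Longrightarrow> kernel_norm \<nu> d > 0"
  by (simp add: kernel_norm_def Beta_def)

text \<open>Scaled so that integrating against it, relative to the total mass
  \<open>gegenbauer_moment \<nu> 0\<close>, is evaluation at 1 in degrees up to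
  \<open>d\<close>.\<close>

definition kernel_poly :: "real \<Rightarrow> nat \<Rightarrow> real poly" where
  "kernel_poly \<nu> d = Polynomial.smult (gegenbauer_moment \<nu> 0 / kernel_norm \<nu> d) (jacobi_poly d (\<nu> + 1) \<nu>)"

lemma degree_kernel_poly: "degree (kernel_poly \<nu> d) \<le> d"
  unfolding kernel_poly_def by (rule order_trans [OF degree_smult_le degree_jacobi_poly])

lemma integral_kernel_poly:
  assumes \<nu>: "\<nu> \<ge> 0" and s: "degree s \<le> d"
  shows "integral {-1..1} (\<lambda>t. poly (kernel_poly \<nu> d) t * poly s t * (1 - t\<^sup>2) powr \<nu>)
    = gegenbauer_moment \<nu> 0 * poly s 1"
proof -
  have e: "\<nu> + 1 + \<nu> = 2 * \<nu> + 1" "\<nu> + 1 - 1 = \<nu>" by simp_all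
  have J: "integral {-1..1} (\<lambda>t. poly (jacobi_poly d (\<nu> + 1) \<nu>) t * poly s t * jacobi_weight \<nu> \<nu> t)
      = kernel_norm \<nu> d * poly s 1"
    using integral_jacobi_poly [OF _ \<nu> s, of "\<nu> + 1"] \<nu> unfolding e kernel_norm_def by linarith
  have "integral {-1..1} (\<lambda>t. poly (kernel_poly \<nu> d) t * poly s t * (1 - t\<^sup>2) powr \<nu>)
      = integral {-1..1} (\<lambda>t. gegenbauer_moment \<nu> 0 / kernel_norm \<nu> d *
          (poly (jacobi_poly d (\<nu> + 1) \<nu>) t * poly s t * jacobi_weight \<nu> \<nu> t))"
    by (rule integral_cong) (simp add: kernel_poly_def jacobi_weight_eq)
  also have "\<dots> = gegenbauer_moment \<nu> 0 / kernel_norm \<nu> d * (kernel_norm \<nu> d * poly s 1)"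
    by (simp only: integral_mult_right J)
  also have "\<dots> = gegenbauer_moment \<nu> 0 * poly s 1"
    using kernel_norm_pos [OF \<nu>, of d] by simp
  finally show ?thesis .
qed

text \<open>For even \<open>i\<close> the coefficient is, up to a factor, the integral of the kernel
  against \<open>(1 - t^2) ^ (i div 2) * t ^ (l - i)\<close>. This has degree at most
  \<open>d\<close>, so the integral is a multiple of its value at 1, which is 0 unless
  \<open>i = 0\<close>.\<close>

lemma zonal_poly_kernel:
  assumes \<nu>: "\<nu> \<ge> 0" and l: "l \<le> d"
  shows "zonal_poly \<nu> (kernel_poly \<nu> d) l = monom 1 l"
proof -
  define k where "k = kernel_poly \<nu> d"
  have coeff: "zonal_coeff \<nu> k l i = (if i = 0 then 1 else 0)" if i: "i \<le> l" for i
  proof (cases "even i")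
    case True
    define j where "j = i div 2"
    have ij: "i = 2 * j" using True by (simp add: j_def)
    define s where "s = [:1, 0, -1 :: real:] ^ j * monom 1 (l - i)"
    have "degree s \<le> 2 * j + (l - i)" unfolding s_def
      by (intro order_trans [OF degree_mult_le] add_mono order_trans [OF degree_power_le] order_trans [OF degree_monom_le])
        auto
    then have "degree s \<le> d" using i l ij by simp
    have s: "poly s t = (1 - t\<^sup>2) ^ j * t ^ (l - i)" for t
      by (simp add: s_def poly_monom power2_eq_square)
    have "(\<Sum>m\<le>degree k. coeff k m * gegenbauer_moment (\<nu> + real j) (m + (l - i)))
        = integral {-1..1} (\<lambda>t. poly k t * t ^ (l - i) * (1 - t\<^sup>2) powr (\<nu> + real j))"
      using \<nu> by (intro integral_unique [symmetric] has_integral_gegenbauer_poly) simp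
    also have "\<dots> = integral {-1..1} (\<lambda>t. poly k t * poly s t * (1 - t\<^sup>2) powr \<nu>)"
      by (rule integral_cong) (simp add: s gegenbauer_weight_add)
    also have "\<dots> = gegenbauer_moment \<nu> 0 * poly s 1"
      unfolding k_def by (rule integral_kernel_poly [OF \<nu> \<open>degree s \<le> d\<close>])
    finally show ?thesis
      using True gegenbauer_moment_0_pos [OF \<nu>] ij
      by (cases "j = 0") (simp_all add: zonal_coeff_def j_def [symmetric] s)
  qed (auto simp: zonal_coeff_def intro: odd_pos)
  have "zonal_poly \<nu> k l = (\<Sum>i\<le>l. if i = 0 then monom 1 l else 0)"
    unfolding zonal_poly_def by (rule sum.cong) (auto simp: coeff)
  then show ?thesis by (simp add: k_def)
qed

context
  fixes d :: nat and \<nu> :: real and x :: "real ^ 'n"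
  assumes n: "CARD('n) > 2" and \<nu>: "\<nu> = (real CARD('n) - 3) / 2" and x: "norm x = 1"
begin

text \<open>Homogeneity in \<open>z\<close> reduces the claim to unit vectors. \<open>z = 0\<close>
  is a case of its own, since for \<open>l = 0\<close> it still says that the kernel has average
  1.\<close>

lemma kernel_ridge:
  assumes l: "l \<le> d"
  shows "(AVG y. poly (kernel_poly \<nu> d) (x \<bullet> y) * (z \<bullet> y) ^ l) = (z \<bullet> x) ^ l"
proof -
  have \<nu>0: "\<nu> \<ge> 0" using n by (simp add: \<nu>)
  have unit: "(AVG y. poly (kernel_poly \<nu> d) (x \<bullet> y) * (u \<bullet> y) ^ l) = (u \<bullet> x) ^ l"
    if "norm u = 1" for u
    using integral_zonal [OF n x that, of "kernel_poly \<nu> d" l]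
    by (simp add: \<nu> [symmetric] zonal_poly_kernel [OF \<nu>0 l] poly_monom inner_commute)
  show ?thesis
  proof (cases "z = 0")
    case True
    then show ?thesis using unit [OF x] by (cases "l = 0") auto
  next
    case False
    define u where "u = z /\<^sub>R norm z"
    have z: "z = norm z *\<^sub>R u" and u: "norm u = 1" using False by (simp_all add: u_def)
    have zi: "z \<bullet> y = norm z * (u \<bullet> y)" for y
      using arg_cong [OF z, of "\<lambda>w. w \<bullet> y"] by simp
    have "(AVG y. poly (kernel_poly \<nu> d) (x \<bullet> y) * (z \<bullet> y) ^ l)
        = (AVG y. norm z ^ l * (poly (kernel_poly \<nu> d) (x \<bullet> y) * (u \<bullet> y) ^ l))"
      by (simp add: zi power_mult_distrib mult_ac)
    also have "\<dots> = norm z ^ l * (u \<bullet> x) ^ l" by (simp add: unit [OF u])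
    also have "\<dots> = (z \<bullet> x) ^ l" by (simp add: zi power_mult_distrib)
    finally show ?thesis .
  qed
qed

text \<open>Polarization: replacing \<open>z\<close> by \<open>z + e u\<close> and comparing the coefficients of
  \<open>e\<close> turns a factor \<open>z \<bullet> y\<close> into \<open>u \<bullet> y\<close>.\<close>

lemma kernel_product:
  assumes "length us + l \<le> d"
  shows "(AVG y. poly (kernel_poly \<nu> d) (x \<bullet> y) * ((\<Prod>u\<leftarrow>us. u \<bullet> y) * (z \<bullet> y) ^ l))
    = (\<Prod>u\<leftarrow>us. u \<bullet> x) * (z \<bullet> x) ^ l"
  using assms
proof (induction us arbitrary: l z)
  case Nil
  then show ?case using kernel_ridge [of l z] by simp
next
  case (Cons u us)
  define P where "P y = (\<Prod>u\<leftarrow>us. u \<bullet> y)" for y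
  have contP: "continuous_on UNIV P"
  proof -
    have "continuous_on UNIV (\<lambda>y. \<Prod>u\<leftarrow>us. u \<bullet> y)"
      by (induction us) (auto intro!: continuous_intros)
    then show ?thesis by (simp add: P_def [abs_def])
  qed
  define k where "k y = poly (kernel_poly \<nu> d) (x \<bullet> y)" for y
  have contk: "continuous_on UNIV k" unfolding k_def by (intro continuous_intros)
  define a where "a i = (AVG y. k y * (P y * (z \<bullet> y) ^ (Suc l - i) * (u \<bullet> y) ^ i))" for i
  define b where "b i = P x * (z \<bullet> x) ^ (Suc l - i) * (u \<bullet> x) ^ i" for i
  define A where "A f = (\<Sum>i\<le>Suc l. monom (real (Suc l choose i) * f i) i)" for f :: "nat \<Rightarrow> real"
  have expand: "((z + e *\<^sub>R u) \<bullet> y) ^ Suc l = (\<Sum>i\<le>Suc l. real (Suc l choose i) * e ^ i * ((z \<bullet> y) ^ (Suc l - i) * (u \<bullet> y) ^ i))"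
    for e y
    using binomial_ring [of "e * (u \<bullet> y)" "z \<bullet> y" "Suc l"]
    by (simp only: inner_add_left inner_scaleR_left power_mult_distrib) (simp only: ac_simps)
  have "A a = A b"
  proof (rule poly_ext)
    fix e
    have "poly (A a) e = (AVG y. k y * (P y * ((z + e *\<^sub>R u) \<bullet> y) ^ Suc l))"
    proof -
      have "(AVG y. k y * (P y * ((z + e *\<^sub>R u) \<bullet> y) ^ Suc l))
        = (AVG y. (\<Sum>i\<le>Suc l. (real (Suc l choose i) * e ^ i) * (k y * (P y * (z \<bullet> y) ^ (Suc l - i) * (u \<bullet> y) ^ i))))"
        unfolding expand sum_distrib_left by (simp only: mult_ac)
      also have "\<dots> = (\<Sum>i\<le>Suc l. (real (Suc l choose i) * e ^ i) * a i)"
        unfolding a_def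
        by (subst Bochner_Integration.integral_sum)
          (intro integrable_sphere_continuous continuous_intros contP contk, simp)
      finally show ?thesis by (simp only: A_def poly_sum poly_monom mult_ac)
    qed
    also have "\<dots> = P x * ((z + e *\<^sub>R u) \<bullet> x) ^ Suc l"
      using Cons.IH [of "Suc l" "z + e *\<^sub>R u"] Cons.prems unfolding k_def P_def by simp
    also have "\<dots> = poly (A b) e"
      unfolding expand A_def poly_sum poly_monom b_def sum_distrib_left by (simp only: mult_ac)
    finally show "poly (A a) e = poly (A b) e" .
  qed
  then have "coeff (A a) 1 = coeff (A b) 1" by simp
  \<comment> \<open>Both coefficients carry the binomial factor \<open>Suc l\<close>, which is not 0
    and cancels.\<close>
  then have "a 1 = b 1"
    by (simp add: A_def coeff_sum del: sum.atMost_Suc binomial_Suc_Suc)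
  then show ?case by (simp add: a_def b_def k_def P_def mult_ac)
qed

text \<open>Passes from linear forms to monomials: a coordinate is the inner product with an axis
  vector, repeated in the list as often as its exponent says.\<close>

lemma monomial_as_product:
  fixes \<alpha> :: "'n \<Rightarrow> nat"
  shows "\<exists>us. length us = (\<Sum>i\<in>UNIV. \<alpha> i) \<and> (\<forall>y :: real ^ 'n. (\<Prod>u\<leftarrow>us. u \<bullet> y) = (\<Prod>i\<in>UNIV. (y $ i) ^ \<alpha> i))"
proof -
  have "\<exists>us. length us = (\<Sum>i\<in>A. \<alpha> i) \<and> (\<forall>y :: real ^ 'n. (\<Prod>u\<leftarrow>us. u \<bullet> y) = (\<Prod>i\<in>A. (y $ i) ^ \<alpha> i))"
    if "finite A" for A
    using that
  proof (induction A rule: finite_induct)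
    case (insert i A)
    then obtain us where us: "length us = (\<Sum>i\<in>A. \<alpha> i)"
      "\<And>y :: real ^ 'n. (\<Prod>u\<leftarrow>us. u \<bullet> y) = (\<Prod>i\<in>A. (y $ i) ^ \<alpha> i)" by blast
    show ?case
      by (rule exI [of _ "replicate (\<alpha> i) (axis i 1) @ us"])
        (use insert us in \<open>simp add: map_replicate_const prod_list_replicate inner_axis'\<close>)
  qed simp
  then show ?thesis by simp
qed

end

section \<open>Complex polynomials in several variables\<close>

definition monomial :: "('n::finite \<Rightarrow> nat) \<Rightarrow> real ^ 'n \<Rightarrow> complex" where
  "monomial \<alpha> x = (\<Prod>i\<in>UNIV. complex_of_real (x $ i) ^ \<alpha> i)"

lemma finite_multidegree: "finite {\<alpha> :: 'n::finite \<Rightarrow> nat. (\<Sum>i\<in>UNIV. \<alpha> i) \<le> d}"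
proof (rule finite_subset)
  show "{\<alpha> :: 'n \<Rightarrow> nat. (\<Sum>i\<in>UNIV. \<alpha> i) \<le> d} \<subseteq> (\<Pi>\<^sub>E i\<in>UNIV. {..d})"
  proof
    fix \<alpha> :: "'n \<Rightarrow> nat" assume \<alpha>: "\<alpha> \<in> {\<alpha>. (\<Sum>i\<in>UNIV. \<alpha> i) \<le> d}"
    have "\<alpha> i \<le> (\<Sum>i\<in>UNIV. \<alpha> i)" for i by (rule member_le_sum) auto
    then have "\<alpha> i \<le> d" for i using \<alpha> order_trans by blast
    then show "\<alpha> \<in> (\<Pi>\<^sub>E i\<in>UNIV. {..d})" by (simp add: PiE_UNIV_domain)
  qed
qed (simp add: finite_PiE)

lemma polynomials_upto_eq:
  "polynomials_upto d = {\<lambda>x. \<Sum>\<alpha> | (\<Sum>i\<in>UNIV. \<alpha> i) \<le> d. c \<alpha> * monomial \<alpha> x | c. True}"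
  by (simp add: polynomials_upto_def monomial_def)

lemma polynomials_uptoI:
  assumes "\<And>x. p x = (\<Sum>\<alpha> | (\<Sum>i\<in>UNIV. \<alpha> i) \<le> d. c \<alpha> * monomial \<alpha> x)"
  shows "p \<in> polynomials_upto d"
  unfolding polynomials_upto_eq mem_Collect_eq by (intro exI [of _ c] conjI ext assms TrueI)

lemma continuous_on_monomial [continuous_intros]: "continuous_on A (monomial \<alpha>)"
  unfolding monomial_def by (intro continuous_intros)

lemma polynomials_upto_add:
  assumes "p \<in> polynomials_upto d" "q \<in> polynomials_upto d"
  shows "(\<lambda>x. p x + q x) \<in> polynomials_upto d"
proof -
  obtain a b where "p = (\<lambda>x. \<Sum>\<alpha> | (\<Sum>i\<in>UNIV. \<alpha> i) \<le> d. a \<alpha> * monomial \<alpha> x)"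
    "q = (\<lambda>x. \<Sum>\<alpha> | (\<Sum>i\<in>UNIV. \<alpha> i) \<le> d. b \<alpha> * monomial \<alpha> x)"
    using assms by (auto simp: polynomials_upto_eq)
  then have "(\<lambda>x. p x + q x) = (\<lambda>x. \<Sum>\<alpha> | (\<Sum>i\<in>UNIV. \<alpha> i) \<le> d. (a \<alpha> + b \<alpha>) * monomial \<alpha> x)"
    by (simp add: distrib_right sum.distrib)
  then show ?thesis by (intro polynomials_uptoI) (rule fun_cong)
qed

lemma polynomials_upto_scale:
  assumes "p \<in> polynomials_upto d"
  shows "(\<lambda>x. c * p x) \<in> polynomials_upto d"
proof -
  obtain a where "p = (\<lambda>x. \<Sum>\<alpha> | (\<Sum>i\<in>UNIV. \<alpha> i) \<le> d. a \<alpha> * monomial \<alpha> x)"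
    using assms by (auto simp: polynomials_upto_eq)
  then have "(\<lambda>x. c * p x) = (\<lambda>x. \<Sum>\<alpha> | (\<Sum>i\<in>UNIV. \<alpha> i) \<le> d. (c * a \<alpha>) * monomial \<alpha> x)"
    by (simp add: sum_distrib_left mult.assoc)
  then show ?thesis by (intro polynomials_uptoI) (rule fun_cong)
qed

lemma polynomials_upto_0: "(\<lambda>x. 0) \<in> polynomials_upto d"
  by (rule polynomials_uptoI [where c = "\<lambda>_. 0"]) simp

lemma polynomials_upto_sum:
  "(\<And>i. i \<in> A \<Longrightarrow> p i \<in> polynomials_upto d) \<Longrightarrow> (\<lambda>x. \<Sum>i\<in>A. p i x) \<in> polynomials_upto d"
  by (induction A rule: infinite_finite_induct) (auto simp: polynomials_upto_0 polynomials_upto_add)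

lemma monomial_in_polynomials_upto:
  assumes "(\<Sum>i\<in>UNIV. \<alpha> i) \<le> d" shows "monomial \<alpha> \<in> polynomials_upto d"
proof -
  have "monomial \<alpha> x = (\<Sum>\<beta> | (\<Sum>i\<in>UNIV. \<beta> i) \<le> d. (if \<beta> = \<alpha> then 1 else 0) * monomial \<beta> x)" for x
    using assms by (simp add: if_distrib [of "\<lambda>z. z * _"] finite_multidegree cong: if_cong)
  then show ?thesis by (rule polynomials_uptoI)
qed

lemma polynomials_upto_mono:
  assumes "p \<in> polynomials_upto d" "d \<le> e" shows "p \<in> polynomials_upto e"
proof -
  obtain a where p: "p = (\<lambda>x. \<Sum>\<alpha> | (\<Sum>i\<in>UNIV. \<alpha> i) \<le> d. a \<alpha> * monomial \<alpha> x)"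
    using assms by (auto simp: polynomials_upto_eq)
  show ?thesis unfolding p
    by (intro polynomials_upto_sum polynomials_upto_scale monomial_in_polynomials_upto) (use assms in auto)
qed

lemma polynomials_upto_const: "(\<lambda>x. c) \<in> polynomials_upto d"
  using polynomials_upto_scale [OF monomial_in_polynomials_upto [of "\<lambda>_. 0" d], of c]
  by (simp add: monomial_def)

lemma monomial_Suc: "monomial (\<alpha>(i := Suc (\<alpha> i))) x = of_real (x $ i) * monomial \<alpha> x"
  by (simp add: monomial_def prod.remove [of UNIV i])

lemma polynomials_upto_coordinate:
  assumes "p \<in> polynomials_upto d"
  shows "(\<lambda>x. of_real (x $ i) * p x) \<in> polynomials_upto (Suc d)"
proof -
  obtain a where "p = (\<lambda>x. \<Sum>\<alpha> | (\<Sum>i\<in>UNIV. \<alpha> i) \<le> d. a \<alpha> * monomial \<alpha> x)"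
    using assms by (auto simp: polynomials_upto_eq)
  then have p: "(\<lambda>x. of_real (x $ i) * p x)
      = (\<lambda>x. \<Sum>\<alpha> | (\<Sum>i\<in>UNIV. \<alpha> i) \<le> d. a \<alpha> * monomial (\<alpha>(i := Suc (\<alpha> i))) x)"
    by (simp add: monomial_Suc sum_distrib_left mult_ac)
  have "(\<Sum>j\<in>UNIV. (\<alpha>(i := Suc (\<alpha> i))) j) \<le> Suc d" if "(\<Sum>j\<in>UNIV. \<alpha> j) \<le> d" for \<alpha> :: "_ \<Rightarrow> nat"
    using that by (simp add: sum.remove [of UNIV i])
  then show ?thesis unfolding p
    by (intro polynomials_upto_sum polynomials_upto_scale monomial_in_polynomials_upto) auto
qed

lemma polynomials_upto_linear:
  assumes "p \<in> polynomials_upto d"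
  shows "(\<lambda>x. of_real (u \<bullet> x) * p x) \<in> polynomials_upto (Suc d)"
proof -
  have "(\<lambda>x. of_real (u \<bullet> x) * p x)
      = (\<lambda>x. \<Sum>i\<in>UNIV. complex_of_real (u $ i) * (of_real (x $ i) * p x))"
    by (simp add: inner_vec_def sum_distrib_left sum_distrib_right mult_ac)
  also have "\<dots> \<in> polynomials_upto (Suc d)"
    by (intro polynomials_upto_sum polynomials_upto_scale polynomials_upto_coordinate assms)
  finally show ?thesis .
qed

lemma polynomials_upto_zonal:
  assumes "degree r \<le> d"
  shows "(\<lambda>x. complex_of_real (poly r (u \<bullet> x))) \<in> polynomials_upto d"
proof -
  have pow: "(\<lambda>x. complex_of_real (u \<bullet> x) ^ l) \<in> polynomials_upto l" for l
    by (induction l) (simp_all add: polynomials_upto_const polynomials_upto_linear)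
  have "(\<lambda>x. complex_of_real (poly r (u \<bullet> x)))
      = (\<lambda>x. \<Sum>l\<le>degree r. complex_of_real (coeff r l) * complex_of_real (u \<bullet> x) ^ l)"
    by (simp add: poly_altdef)
  also have "\<dots> \<in> polynomials_upto d"
    by (intro polynomials_upto_sum polynomials_upto_scale polynomials_upto_mono [OF pow])
      (use assms in auto)
  finally show ?thesis .
qed

lemma continuous_on_polynomials_upto:
  assumes "p \<in> polynomials_upto d" shows "continuous_on A p"
proof -
  obtain a where "p = (\<lambda>x. \<Sum>\<alpha> | (\<Sum>i\<in>UNIV. \<alpha> i) \<le> d. a \<alpha> * monomial \<alpha> x)"
    using assms by (auto simp: polynomials_upto_eq)
  then show ?thesis by (auto intro!: continuous_intros)
qed

lemma kernel_reproducing: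
  fixes x :: "real ^ 'n"
  assumes n: "CARD('n) > 2" and \<nu>: "\<nu> = (real CARD('n) - 3) / 2" and x: "norm x = 1"
    and p: "p \<in> polynomials_upto d"
  shows "(AVG y. of_real (poly (kernel_poly \<nu> d) (x \<bullet> y)) * p y) = p x"
proof -
  have m: "(AVG y. of_real (poly (kernel_poly \<nu> d) (x \<bullet> y)) * monomial \<alpha> y) = monomial \<alpha> x"
    if \<alpha>: "(\<Sum>i\<in>UNIV. \<alpha> i) \<le> d" for \<alpha> :: "'n \<Rightarrow> nat"
  proof -
    obtain us where us: "length us = (\<Sum>i\<in>UNIV. \<alpha> i)"
      "\<And>y :: real ^ 'n. (\<Prod>u\<leftarrow>us. u \<bullet> y) = (\<Prod>i\<in>UNIV. (y $ i) ^ \<alpha> i)"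
      using monomial_as_product [OF n \<nu> x, of \<alpha>] by blast
    have mono: "monomial \<alpha> y = complex_of_real (\<Prod>u\<leftarrow>us. u \<bullet> y)" for y
      by (simp add: monomial_def us(2))
    show ?thesis
      using kernel_product [OF n \<nu> x, of us 0 d] us(1) \<alpha>
      unfolding mono of_real_mult [symmetric] integral_complex_of_real by simp
  qed
  obtain a where p: "p = (\<lambda>x. \<Sum>\<alpha> | (\<Sum>i\<in>UNIV. \<alpha> i) \<le> d. a \<alpha> * monomial \<alpha> x)"
    using p by (auto simp: polynomials_upto_eq)
  have "(AVG y. of_real (poly (kernel_poly \<nu> d) (x \<bullet> y)) * p y)
    = (AVG y. (\<Sum>\<alpha> | (\<Sum>i\<in>UNIV. \<alpha> i) \<le> d. a \<alpha> * (of_real (poly (kernel_poly \<nu> d) (x \<bullet> y)) * monomial \<alpha> y)))"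
    unfolding p sum_distrib_left by (simp only: mult_ac)
  also have "\<dots> = (\<Sum>\<alpha> | (\<Sum>i\<in>UNIV. \<alpha> i) \<le> d. a \<alpha> * monomial \<alpha> x)"
    by (subst Bochner_Integration.integral_sum)
      (auto simp: m intro!: integrable_sphere_continuous continuous_intros)
  finally show ?thesis by (simp add: p)
qed

section \<open>Sphere averages of ridge functions\<close>

lemma Weierstrass_poly:
  fixes g :: "real \<Rightarrow> real"
  assumes "continuous_on {-1..1} g" "e > 0"
  obtains p where "\<And>t. t \<in> {-1..1} \<Longrightarrow> \<bar>g t - poly p t\<bar> < e"
proof -
  obtain f where f: "polynomial_function f" "\<And>t. t \<in> {-1..1} \<Longrightarrow> norm (g t - f t) < e"
    using Stone_Weierstrass_polynomial_function [OF compact_Icc assms] by blast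
  then obtain a m where "f = (\<lambda>x. \<Sum>i\<le>m. a i * x ^ i)"
    using real_polynomial_function_iff_sum real_polynomial_function_eq by blast
  then have "f t = poly (\<Sum>i\<le>m. monom (a i) i) t" for t
    by (simp add: poly_sum poly_monom)
  then show ?thesis using f(2) by (intro that [of "\<Sum>i\<le>m. monom (a i) i"]) simp
qed

lemma norm_inner_unit: "norm x = 1 \<Longrightarrow> norm y = 1 \<Longrightarrow> x \<bullet> y \<in> {-1..1}"
  using Cauchy_Schwarz_ineq2 [of x y] by (auto simp: abs_le_iff)

text \<open>For polynomials this is \<open>integral_zonal\<close> with exponent 0, and Weierstrass
  approximation carries it to continuous \<open>g\<close>. Polynomials alone would not do, because
  the formula is wanted for the absolute value of the kernel.\<close>

lemma integral_sphere_ridge: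
  fixes x :: "real ^ 'n" and g :: "real \<Rightarrow> real"
  assumes n: "CARD('n) > 2" and \<nu>: "\<nu> = (real CARD('n) - 3) / 2" and x: "norm x = 1"
    and g: "continuous_on UNIV g"
  shows "(AVG y. g (x \<bullet> y))
    = integral {-1..1} (\<lambda>t. g t * (1 - t\<^sup>2) powr \<nu>) / gegenbauer_moment \<nu> 0"
proof -
  have \<nu>0: "\<nu> \<ge> 0" using n by (simp add: \<nu>)
  define I0 where "I0 = gegenbauer_moment \<nu> 0"
  have I0: "I0 > 0" using gegenbauer_moment_0_pos [OF \<nu>0] by (simp add: I0_def)
  have I0': "((\<lambda>t. (1 - t\<^sup>2) powr \<nu>) has_integral I0) {-1..1}"
    using has_integral_gegenbauer_moment [OF \<nu>0, of 0] by (simp add: I0_def)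
  have pol: "(AVG y. poly q (x \<bullet> y))
      = integral {-1..1} (\<lambda>t. poly q t * (1 - t\<^sup>2) powr \<nu>) / I0" for q
  proof -
    have "(AVG y. poly q (x \<bullet> y)) = zonal_coeff \<nu> q 0 0"
      using integral_zonal [OF n x x, of q 0] by (simp add: \<nu> zonal_poly_def)
    also have "\<dots> = (\<Sum>m\<le>degree q. coeff q m * gegenbauer_moment \<nu> (m + 0)) / I0"
      by (simp add: zonal_coeff_def I0_def)
    also have "(\<Sum>m\<le>degree q. coeff q m * gegenbauer_moment \<nu> (m + 0))
        = integral {-1..1} (\<lambda>t. poly q t * t ^ 0 * (1 - t\<^sup>2) powr \<nu>)"
      by (rule integral_unique [OF has_integral_gegenbauer_poly [OF \<nu>0], symmetric])
    finally show ?thesis by simp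
  qed
  have "\<bar>(AVG y. g (x \<bullet> y)) - integral {-1..1} (\<lambda>t. g t * (1 - t\<^sup>2) powr \<nu>) / I0\<bar> \<le> e"
    if e: "e > 0" for e
  proof -
    obtain p where p: "\<And>t. t \<in> {-1..1} \<Longrightarrow> \<bar>g t - poly p t\<bar> < e / 2"
      by (rule Weierstrass_poly [OF continuous_on_subset [OF g subset_UNIV] half_gt_zero [OF e]]) blast
    have gx: "continuous_on UNIV (\<lambda>y. g (x \<bullet> y))"
      by (rule continuous_on_compose2 [OF g]) (auto intro!: continuous_intros)
    have int: "integrable sphere_measure (\<lambda>y. g (x \<bullet> y) - poly p (x \<bullet> y))"
      by (intro integrable_sphere_continuous continuous_intros gx)
    have "\<bar>(AVG y. g (x \<bullet> y)) - (AVG y. poly p (x \<bullet> y))\<bar>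
        = \<bar>AVG y. g (x \<bullet> y) - poly p (x \<bullet> y)\<bar>"
      by (subst Bochner_Integration.integral_diff)
        (auto intro!: integrable_sphere_continuous continuous_intros gx)
    also have "\<dots> \<le> (AVG y. \<bar>g (x \<bullet> y) - poly p (x \<bullet> y)\<bar>)"
      using integral_norm_bound [of sphere_measure "\<lambda>y. g (x \<bullet> y) - poly p (x \<bullet> y)"] by simp
    also have "\<dots> \<le> (\<integral>y. e / 2 \<partial>(sphere_measure :: (real ^ 'n) measure))"
    proof (rule integral_mono_AE)
      show "AE y in sphere_measure. \<bar>g (x \<bullet> y) - poly p (x \<bullet> y)\<bar> \<le> e / 2"
        using AE_sphere_measure by eventually_elim (use p norm_inner_unit [OF x] less_imp_le in blast)
    qed (use int in auto)
    also have "\<dots> = e / 2" using sphere.prob_space [where 'a = "real ^ 'n"] by simp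
    finally have 1: "\<bar>(AVG y. g (x \<bullet> y)) - (AVG y. poly p (x \<bullet> y))\<bar> \<le> e / 2" .
    have gi: "(\<lambda>t. g t * (1 - t\<^sup>2) powr \<nu>) integrable_on {-1..1}"
      "(\<lambda>t. poly p t * (1 - t\<^sup>2) powr \<nu>) integrable_on {-1..1}"
      by (intro integrable_gegenbauer \<nu>0 continuous_on_subset [OF g] continuous_intros; simp)+
    have "\<bar>integral {-1..1} (\<lambda>t. g t * (1 - t\<^sup>2) powr \<nu>) - integral {-1..1} (\<lambda>t. poly p t * (1 - t\<^sup>2) powr \<nu>)\<bar>
        = norm (integral {-1..1} (\<lambda>t. g t * (1 - t\<^sup>2) powr \<nu> - poly p t * (1 - t\<^sup>2) powr \<nu>))"
      by (subst Henstock_Kurzweil_Integration.integral_diff [OF gi]) (rule real_norm_def [symmetric])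
    also have "\<dots> \<le> integral {-1..1} (\<lambda>t. e / 2 * (1 - t\<^sup>2) powr \<nu>)"
    proof (rule integral_norm_bound_integral)
      show "(\<lambda>t. e / 2 * (1 - t\<^sup>2) powr \<nu>) integrable_on {-1..1}"
        by (intro integrable_gegenbauer \<nu>0 continuous_intros)
      show "(\<lambda>t. g t * (1 - t\<^sup>2) powr \<nu> - poly p t * (1 - t\<^sup>2) powr \<nu>) integrable_on {-1..1}"
        by (intro Henstock_Kurzweil_Integration.integrable_diff gi)
      fix t :: real assume "t \<in> {-1..1}"
      then have "\<bar>g t - poly p t\<bar> * (1 - t\<^sup>2) powr \<nu> \<le> e / 2 * (1 - t\<^sup>2) powr \<nu>"
        by (intro mult_right_mono less_imp_le [OF p]) auto
      then show "norm (g t * (1 - t\<^sup>2) powr \<nu> - poly p t * (1 - t\<^sup>2) powr \<nu>) \<le> e / 2 * (1 - t\<^sup>2) powr \<nu>"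
        by (simp add: left_diff_distrib [symmetric] abs_mult)
    qed
    also have "\<dots> = e / 2 * I0"
      using has_integral_mult_right [OF I0', of "e / 2"] by (rule integral_unique)
    finally have "\<bar>integral {-1..1} (\<lambda>t. g t * (1 - t\<^sup>2) powr \<nu>) / I0 - integral {-1..1} (\<lambda>t. poly p t * (1 - t\<^sup>2) powr \<nu>) / I0\<bar> \<le> e / 2"
      using I0 by (simp add: diff_divide_distrib [symmetric] abs_divide pos_divide_le_eq)
    with 1 show ?thesis unfolding pol by linarith
  qed
  note close = this
  have "\<bar>(AVG y. g (x \<bullet> y)) - integral {-1..1} (\<lambda>t. g t * (1 - t\<^sup>2) powr \<nu>) / I0\<bar> \<le> 0"
    by (rule field_le_epsilon) (simp only: add_0 close)
  then show ?thesis by (simp add: I0_def)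
qed

section \<open>Extension of functionals\<close>

definition bounded_funs :: "('a \<Rightarrow> 'b::real_normed_vector) set" where
  "bounded_funs = {f. \<exists>B. \<forall>x. norm (f x) \<le> B}"

lemma bounded_funsI: "(\<And>x. norm (f x) \<le> B) \<Longrightarrow> f \<in> bounded_funs"
  by (auto simp: bounded_funs_def)

lemma bounded_funsE:
  assumes "f \<in> bounded_funs" obtains B where "B \<ge> 0" "\<And>x. norm (f x) \<le> B"
proof -
  obtain B where B: "\<And>x. norm (f x) \<le> B" using assms by (auto simp: bounded_funs_def)
  show ?thesis by (rule that [OF _ B]) (use norm_ge_zero B order_trans in blast)
qed

lemma bounded_funs_add:
  assumes "f \<in> bounded_funs" "g \<in> bounded_funs"
  shows "(\<lambda>x. f x + g x) \<in> bounded_funs"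
proof -
  obtain A B where "\<And>x. norm (f x) \<le> A" "\<And>x. norm (g x) \<le> B"
    using assms by (auto elim!: bounded_funsE)
  then show ?thesis by (intro bounded_funsI [of _ "A + B"] norm_triangle_le add_mono)
qed

lemma bounded_funs_mult:
  fixes f g :: "'a \<Rightarrow> 'b::real_normed_algebra"
  assumes "f \<in> bounded_funs" "g \<in> bounded_funs"
  shows "(\<lambda>x. f x * g x) \<in> bounded_funs"
proof -
  obtain A B where "A \<ge> 0" "\<And>x. norm (f x) \<le> A" "\<And>x. norm (g x) \<le> B"
    using assms by (auto elim!: bounded_funsE)
  then show ?thesis
    by (intro bounded_funsI [of _ "A * B"] order_trans [OF norm_mult_ineq] mult_mono) auto
qed

lemma bounded_funs_const: "(\<lambda>x. c) \<in> bounded_funs"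
  by (rule bounded_funsI [of _ "norm c"]) simp

lemma bounded_funs_sum:
  "(\<And>i. i \<in> A \<Longrightarrow> f i \<in> bounded_funs) \<Longrightarrow> (\<lambda>x. \<Sum>i\<in>A. f i x) \<in> bounded_funs"
  by (induction A rule: infinite_finite_induct) (auto simp: bounded_funs_const bounded_funs_add)

lemma real_linear_space_bounded_funs:
  "real_linear_space (bounded_funs :: ('a \<Rightarrow> real) set) (\<lambda>f g x. f x + g x) (\<lambda>c f x. c * f x) (\<lambda>x. 0)"
  by unfold_locales
    (auto simp: bounded_funs_add bounded_funs_mult bounded_funs_const fun_eq_iff algebra_simps)

text \<open>Hahn-Banach for the upper integral \<open>p\<close>, the infimum of the integrals of
  bounded measurable majorants. For measurable \<open>f\<close> the functional is at most the
  integral both at \<open>f\<close> and at \<open>- f\<close>, hence equal to it. It is monotone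
  because 0 is a majorant of \<open>f - g\<close> when \<open>f \<le> g\<close>.\<close>

lemma positive_extension_real:
  fixes M :: "'a measure"
  assumes "prob_space M"
  obtains m :: "('a \<Rightarrow> real) \<Rightarrow> real"
  where "\<And>f g. f \<in> bounded_funs \<Longrightarrow> g \<in> bounded_funs \<Longrightarrow> m (\<lambda>x. f x + g x) = m f + m g"
    and "\<And>c f. f \<in> bounded_funs \<Longrightarrow> m (\<lambda>x. c * f x) = c * m f"
    and "\<And>f. f \<in> bounded_funs \<Longrightarrow> f \<in> borel_measurable M \<Longrightarrow> m f = integral\<^sup>L M f"
    and "\<And>f g. f \<in> bounded_funs \<Longrightarrow> g \<in> bounded_funs \<Longrightarrow> (\<And>x. f x \<le> g x) \<Longrightarrow> m f \<le> m g"
proof -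
  interpret prob_space M by fact
  interpret V: real_linear_space "bounded_funs :: ('a \<Rightarrow> real) set" "\<lambda>f g x. f x + g x" "\<lambda>c f x. c * f x" "\<lambda>x. 0"
    by (rule real_linear_space_bounded_funs)
  define U where "U f = {g \<in> bounded_funs. g \<in> borel_measurable M \<and> (\<forall>x. f x \<le> g x)}" for f :: "'a \<Rightarrow> real"
  define p where "p f = (INF g\<in>U f. integral\<^sup>L M g)" for f
  have int: "integrable M g" if "g \<in> U f" for f g
    using that by (auto simp: U_def elim!: bounded_funsE intro!: integrable_const_bound)
  have ne: "U f \<noteq> {}" if f: "f \<in> bounded_funs" for f
  proof -
    obtain B where "\<And>x. norm (f x) \<le> B" by (rule bounded_funsE [OF f]) blast
    then have "(\<lambda>x. B) \<in> U f" by (auto simp: U_def bounded_funs_const abs_le_iff)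
    then show ?thesis by blast
  qed
  have bdd: "bdd_below (integral\<^sup>L M ` U f)" if f: "f \<in> bounded_funs" for f
  proof -
    obtain B where B: "\<And>x. norm (f x) \<le> B" by (rule bounded_funsE [OF f]) blast
    show ?thesis
    proof (rule bdd_belowI2)
      fix g assume g: "g \<in> U f"
      have "(\<integral>x. - B \<partial>M) \<le> integral\<^sup>L M g"
      proof (rule integral_mono [OF integrable_const int [OF g]])
        fix x
        have "- B \<le> f x" using B [of x] by (simp add: abs_le_iff)
        then show "- B \<le> g x" using g by (auto simp: U_def intro: order_trans)
      qed
      then show "- B \<le> integral\<^sup>L M g" by (simp add: prob_space)
    qed
  qed
  have ple: "p f \<le> integral\<^sup>L M g" if "f \<in> bounded_funs" "g \<in> U f" for f g
    unfolding p_def using that by (intro cINF_lower bdd)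
  have pge: "b \<le> p f" if "f \<in> bounded_funs" "\<And>g. g \<in> U f \<Longrightarrow> b \<le> integral\<^sup>L M g" for f b
    unfolding p_def using that by (intro cINF_greatest ne)
  have scaleU: "(\<lambda>x. c * g x) \<in> U (\<lambda>x. c * f x)" if "g \<in> U f" "c > 0" for c g f
    using that bounded_funs_mult [OF bounded_funs_const [of c], of g] by (auto simp: U_def)
  have sub: "V.sublinear p"
    unfolding V.sublinear_def
  proof (intro conjI ballI allI impI)
    fix f g :: "'a \<Rightarrow> real" assume f: "f \<in> bounded_funs" and g: "g \<in> bounded_funs"
    have "p (\<lambda>x. f x + g x) - integral\<^sup>L M b \<le> integral\<^sup>L M a" if a: "a \<in> U f" and b: "b \<in> U g" for a b
    proof -
      have "(\<lambda>x. a x + b x) \<in> U (\<lambda>x. f x + g x)"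
        using a b by (auto simp: U_def bounded_funs_add add_mono)
      then have "p (\<lambda>x. f x + g x) \<le> (\<integral>x. a x + b x \<partial>M)"
        by (intro ple bounded_funs_add f g)
      then show ?thesis using int [OF a] int [OF b] by simp
    qed
    then have "p (\<lambda>x. f x + g x) - integral\<^sup>L M b \<le> p f" if "b \<in> U g" for b
      using that by (intro pge [OF f])
    then have "p (\<lambda>x. f x + g x) - p f \<le> p g"
      by (intro pge [OF g]) (simp add: diff_le_eq add.commute)
    then show "p (\<lambda>x. f x + g x) \<le> p f + p g" by simp
  next
    fix c :: real and f :: "'a \<Rightarrow> real" assume c: "0 < c" and f: "f \<in> bounded_funs"
    have cf: "(\<lambda>x. c * f x) \<in> bounded_funs"
      by (intro bounded_funs_mult bounded_funs_const f)
    show "p (\<lambda>x. c * f x) = c * p f"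
    proof (rule antisym)
      have "p (\<lambda>x. c * f x) / c \<le> p f"
      proof (rule pge [OF f])
        fix g assume "g \<in> U f"
        then have "p (\<lambda>x. c * f x) \<le> c * integral\<^sup>L M g"
          using ple [OF cf scaleU [OF _ c]] by simp
        then show "p (\<lambda>x. c * f x) / c \<le> integral\<^sup>L M g" using c by (simp add: field_simps)
      qed
      then show "p (\<lambda>x. c * f x) \<le> c * p f" using c by (simp add: field_simps)
      show "c * p f \<le> p (\<lambda>x. c * f x)"
      proof (rule pge [OF cf])
        fix g assume "g \<in> U (\<lambda>x. c * f x)"
        then have "(\<lambda>x. inverse c * g x) \<in> U f"
          using scaleU [of g "\<lambda>x. c * f x" "inverse c"] c by (simp add: mult.assoc [symmetric])
        from ple [OF f this] have "p f \<le> inverse c * integral\<^sup>L M g" by simp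
        then show "c * p f \<le> integral\<^sup>L M g" using c by (simp add: field_simps)
      qed
    qed
  qed
  obtain m where m: "\<And>f g. f \<in> bounded_funs \<Longrightarrow> g \<in> bounded_funs \<Longrightarrow> m (\<lambda>x. f x + g x) = m f + m g"
    "\<And>c f. f \<in> bounded_funs \<Longrightarrow> m (\<lambda>x. c * f x) = c * m f"
    "\<And>f. f \<in> bounded_funs \<Longrightarrow> m f \<le> p f"
    by (rule V.sublinear_dominates_linear [OF sub]) blast
  show ?thesis
  proof (rule that [OF m(1,2)])
    fix f :: "'a \<Rightarrow> real" assume f: "f \<in> bounded_funs" "f \<in> borel_measurable M"
    have le: "m g \<le> integral\<^sup>L M g" if "g \<in> bounded_funs" "g \<in> borel_measurable M" for g
      using m(3) [OF that(1)] ple [OF that(1), of g] that by (simp add: U_def)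
    have "(\<lambda>x. -1 * f x) \<in> bounded_funs"
      by (intro bounded_funs_mult bounded_funs_const f)
    then have "m (\<lambda>x. -1 * f x) \<le> integral\<^sup>L M (\<lambda>x. -1 * f x)" using f by (intro le) auto
    then have "integral\<^sup>L M f \<le> m f" using m(2) [OF f(1), of "-1"] by simp
    with le [OF f] show "m f = integral\<^sup>L M f" by simp
  next
    fix f g :: "'a \<Rightarrow> real"
    assume f: "f \<in> bounded_funs" and g: "g \<in> bounded_funs" and le: "\<And>x. f x \<le> g x"
    have ng: "(\<lambda>x. -1 * g x) \<in> bounded_funs"
      by (intro bounded_funs_mult bounded_funs_const g)
    have "(\<lambda>x. 0) \<in> U (\<lambda>x. f x + -1 * g x)"
      using le by (auto simp: U_def bounded_funs_const)
    from ple [OF bounded_funs_add [OF f ng] this] have "p (\<lambda>x. f x + -1 * g x) \<le> 0"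
      by simp
    then have "m (\<lambda>x. f x + -1 * g x) \<le> 0"
      using m(3) [OF bounded_funs_add [OF f ng]] by linarith
    then show "m f \<le> m g" using m(1) [OF f ng] m(2) [OF g, of "-1"] by simp
  qed simp_all
qed

lemma exists_unit_rotation: "\<exists>u. cmod u = 1 \<and> complex_of_real (cmod z) = u * z"
proof (cases "z = 0")
  case False
  then show ?thesis
    by (intro exI [of _ "complex_of_real (cmod z) / z"]) (simp add: norm_divide)
qed (auto intro: exI [of _ 1])

text \<open>Real and imaginary parts are extended separately. For the bound, the value is first
  rotated onto the positive axis; it is then the real functional at \<open>Re (u * f)\<close>, and
  monotonicity gives the constant 1 instead of a sum of two estimates.\<close>

lemma positive_extension_complex:
  fixes M :: "'a measure"
  assumes "prob_space M"
  obtains m :: "('a \<Rightarrow> complex) \<Rightarrow> complex"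
  where "\<And>f g. f \<in> bounded_funs \<Longrightarrow> g \<in> bounded_funs \<Longrightarrow> m (\<lambda>x. f x + g x) = m f + m g"
    and "\<And>c f. f \<in> bounded_funs \<Longrightarrow> m (\<lambda>x. c * f x) = c * m f"
    and "\<And>f. f \<in> bounded_funs \<Longrightarrow> f \<in> borel_measurable M \<Longrightarrow> m f = integral\<^sup>L M f"
    and "\<And>f g. f \<in> bounded_funs \<Longrightarrow> g \<in> bounded_funs \<Longrightarrow> g \<in> borel_measurable M \<Longrightarrow>
           (\<And>x. cmod (f x) \<le> g x) \<Longrightarrow> cmod (m f) \<le> integral\<^sup>L M g"
proof -
  interpret prob_space M by fact
  obtain m :: "('a \<Rightarrow> real) \<Rightarrow> real"
    where m: "\<And>f g. f \<in> bounded_funs \<Longrightarrow> g \<in> bounded_funs \<Longrightarrow> m (\<lambda>x. f x + g x) = m f + m g"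
    "\<And>c f. f \<in> bounded_funs \<Longrightarrow> m (\<lambda>x. c * f x) = c * m f"
    "\<And>f. f \<in> bounded_funs \<Longrightarrow> f \<in> borel_measurable M \<Longrightarrow> m f = integral\<^sup>L M f"
    "\<And>f g. f \<in> bounded_funs \<Longrightarrow> g \<in> bounded_funs \<Longrightarrow> (\<And>x. f x \<le> g x) \<Longrightarrow> m f \<le> m g"
    by (rule positive_extension_real [OF assms]) blast
  define n where "n f = Complex (m (\<lambda>x. Re (f x))) (m (\<lambda>x. Im (f x)))" for f
  have ri: "(\<lambda>x. Re (f x)) \<in> bounded_funs" "(\<lambda>x. Im (f x)) \<in> bounded_funs"
    if f: "f \<in> bounded_funs" for f :: "'a \<Rightarrow> complex"
  proof -
    obtain B where "\<And>x. norm (f x) \<le> B" by (rule bounded_funsE [OF f]) blast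
    then show "(\<lambda>x. Re (f x)) \<in> bounded_funs" "(\<lambda>x. Im (f x)) \<in> bounded_funs"
      using abs_Re_le_cmod abs_Im_le_cmod order_trans
      by (auto intro!: bounded_funsI [of _ B]) blast+
  qed
  have mlin: "m (\<lambda>x. a * f x + b * g x) = a * m f + b * m g"
    if "f \<in> bounded_funs" "g \<in> bounded_funs" for a b f g
    using that m(1) [of "\<lambda>x. a * f x" "\<lambda>x. b * g x"] m(2)
    by (simp add: bounded_funs_mult bounded_funs_const)
  have add: "n (\<lambda>x. f x + g x) = n f + n g" if "f \<in> bounded_funs" "g \<in> bounded_funs" for f g
    using that by (simp add: n_def m(1) ri complex_eq_iff)
  have scale: "n (\<lambda>x. c * f x) = c * n f" if f: "f \<in> bounded_funs" for c f
    using mlin [OF ri [OF f], of "Re c" "- Im c"] mlin [OF ri [OF f], of "Im c" "Re c"]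
    by (simp add: n_def complex_eq_iff algebra_simps)
  show ?thesis
  proof (rule that [OF add scale])
    fix f :: "'a \<Rightarrow> complex" assume f: "f \<in> bounded_funs" "f \<in> borel_measurable M"
    then have "integrable M f" by (auto elim!: bounded_funsE intro!: integrable_const_bound)
    then show "n f = integral\<^sup>L M f"
      using f by (simp add: n_def m(3) ri complex_eq_iff)
  next
    fix f and g :: "'a \<Rightarrow> real"
    assume f: "f \<in> bounded_funs" and g: "g \<in> bounded_funs" "g \<in> borel_measurable M"
      and le: "\<And>x. cmod (f x) \<le> g x"
    obtain u where u: "cmod u = 1" "complex_of_real (cmod (n f)) = u * n f"
      using exists_unit_rotation by blast
    have uf: "(\<lambda>x. u * f x) \<in> bounded_funs"
      by (intro bounded_funs_mult bounded_funs_const f)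
    have "cmod (n f) = Re (n (\<lambda>x. u * f x))" unfolding scale [OF f] u(2) [symmetric] by simp
    also have "\<dots> = m (\<lambda>x. Re (u * f x))" by (simp add: n_def)
    also have "\<dots> \<le> m g"
    proof (rule m(4) [OF ri(1) [OF uf] g(1)])
      fix x
      have "Re (u * f x) \<le> cmod (u * f x)" by (rule complex_Re_le_cmod)
      then show "Re (u * f x) \<le> g x" using le [of x] u(1) by (simp add: norm_mult)
    qed
    also have "\<dots> = integral\<^sup>L M g" by (rule m(3) [OF g])
    finally show "cmod (n f) \<le> integral\<^sup>L M g" .
  qed simp_all
qed

section \<open>The complex Hahn-Banach theorem\<close>

context complex_banach_space
begin

lemma carrier_complex_field [simp]: "carrier complex_field = UNIV"
  and add_complex_field [simp]: "a \<oplus>\<^bsub>complex_field\<^esub> b = a + b"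
  and mult_complex_field [simp]: "a \<otimes>\<^bsub>complex_field\<^esub> b = a * b"
  and one_complex_field [simp]: "\<one>\<^bsub>complex_field\<^esub> = 1"
  by (simp_all add: complex_field_def)

lemma neg_eq_smult: "x \<in> carrier V \<Longrightarrow> (-1) \<odot> x \<oplus> x = \<zero>"
  using smult_l_distr [of "-1" 1 x] smult_l_null [of x] smult_one [of x]
  by (simp add: complex_field_def)

lemma real_linear_space:
  "real_linear_space (carrier V) (\<oplus>) (\<lambda>c x. complex_of_real c \<odot> x) \<zero>"
  by unfold_locales
    (use smult_l_distr smult_r_distr smult_assoc1 smult_one smult_closed neg_eq_smult in
      \<open>auto simp: M.a_assoc M.a_comm M.a_lcomm\<close>)

end

context complex_banach_space
begin

lemma vnorm_zero: "vnorm V \<zero> = 0"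
  by (simp add: vnorm_eq_0_iff)

lemma smult_in_carrier: "x \<in> carrier V \<Longrightarrow> c \<odot> x \<in> carrier V"
  by (simp add: smult_closed)

lemma vnorm_add_ge:
  assumes "x \<in> carrier V" "y \<in> carrier V"
  shows "vnorm V y - vnorm V x \<le> vnorm V (x \<oplus> y)"
proof -
  have "y = (-1) \<odot> x \<oplus> (x \<oplus> y)"
    using assms by (simp add: smult_in_carrier neg_eq_smult M.a_assoc [symmetric])
  then have "vnorm V y \<le> vnorm V ((-1) \<odot> x) + vnorm V (x \<oplus> y)"
    using vnorm_triangle [of "(-1) \<odot> x" "x \<oplus> y"] assms by (simp add: smult_in_carrier)
  then show ?thesis using assms by (simp add: vnorm_smult)
qed

text \<open>The functional to be extended is given by its graph \<open>G\<close>.\<close>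

theorem hahn_banach:
  assumes G: "G \<subseteq> carrier V \<times> UNIV" "G \<noteq> {}"
    and G_add: "\<And>x a y b. (x, a) \<in> G \<Longrightarrow> (y, b) \<in> G \<Longrightarrow> (x \<oplus> y, a + b) \<in> G"
    and G_smult: "\<And>c x a. (x, a) \<in> G \<Longrightarrow> (c \<odot> x, c * a) \<in> G"
    and G_norm: "\<And>x a. (x, a) \<in> G \<Longrightarrow> cmod a \<le> vnorm V x"
  obtains \<phi> where "\<And>x y. x \<in> carrier V \<Longrightarrow> y \<in> carrier V \<Longrightarrow> \<phi> (x \<oplus> y) = \<phi> x + \<phi> y"
    and "\<And>c x. x \<in> carrier V \<Longrightarrow> \<phi> (c \<odot> x) = c * \<phi> x"
    and "\<And>x. x \<in> carrier V \<Longrightarrow> cmod (\<phi> x) \<le> vnorm V x"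
    and "\<And>x a. (x, a) \<in> G \<Longrightarrow> \<phi> x = a"
proof -
  interpret R: real_linear_space "carrier V" "(\<oplus>)" "\<lambda>c x. complex_of_real c \<odot> x" "\<zero>"
    by (rule real_linear_space)
  \<comment> \<open>The graph is built into the sublinear functional, so that domination alone
    forces the extension property. For linear \<psi> below \<open>p\<close>, the value at - w is at
    most - \<open>Re a\<close> when \<open>(w, a) \<in> G\<close>; applying this to the negated pair
    as well gives \<open>\<psi> w = Re a\<close>. The pair with both entries 0 gives the bound by
    the norm.\<close>
  define p where "p y = (INF (w, a)\<in>G. vnorm V (y \<oplus> w) - Re a)" for y
  have Gc: "w \<in> carrier V" if "(w, a) \<in> G" for w a using G that by blast
  have bdd: "bdd_below ((\<lambda>(w, a). vnorm V (y \<oplus> w) - Re a) ` G)" if y: "y \<in> carrier V" for y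
  proof (rule bdd_belowI2)
    fix z assume "z \<in> G"
    then obtain w a where z: "z = (w, a)" "(w, a) \<in> G" by (cases z) auto
    have "Re a \<le> vnorm V w" using G_norm [OF z(2)] complex_Re_le_cmod [of a] by simp
    then show "- vnorm V y \<le> (case z of (w, a) \<Rightarrow> vnorm V (y \<oplus> w) - Re a)"
      using vnorm_add_ge [OF y Gc [OF z(2)]] z(1) by simp
  qed
  have ple: "p y \<le> vnorm V (y \<oplus> w) - Re a" if "y \<in> carrier V" "(w, a) \<in> G" for y w a
    unfolding p_def using cINF_lower [OF bdd [OF that(1)] that(2)] by simp
  have pge: "b \<le> p y" if "\<And>w a. (w, a) \<in> G \<Longrightarrow> b \<le> vnorm V (y \<oplus> w) - Re a" for y b
    unfolding p_def using that G(2) by (intro cINF_greatest) auto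
  have "R.sublinear p"
    unfolding R.sublinear_def
  proof (intro conjI ballI allI impI)
    fix x y assume x: "x \<in> carrier V" and y: "y \<in> carrier V"
    have "p (x \<oplus> y) - (vnorm V (y \<oplus> w') - Re a') \<le> vnorm V (x \<oplus> w) - Re a"
      if w: "(w, a) \<in> G" "(w', a') \<in> G" for w a w' a'
    proof -
      have "(x \<oplus> y) \<oplus> (w \<oplus> w') = (x \<oplus> w) \<oplus> (y \<oplus> w')"
        using x y Gc [OF w(1)] Gc [OF w(2)] by (simp add: M.a_ac)
      then have "p (x \<oplus> y) \<le> vnorm V ((x \<oplus> w) \<oplus> (y \<oplus> w')) - Re (a + a')"
        using ple [OF _ G_add [OF w], of "x \<oplus> y"] x y by simp
      then show ?thesis
        using vnorm_triangle [of "x \<oplus> w" "y \<oplus> w'"] x y Gc [OF w(1)] Gc [OF w(2)] by simp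
    qed
    then have "p (x \<oplus> y) - (vnorm V (y \<oplus> w') - Re a') \<le> p x" if "(w', a') \<in> G" for w' a'
      using that by (intro pge)
    then have "p (x \<oplus> y) - p x \<le> p y"
      by (intro pge) (simp add: diff_le_eq add.commute)
    then show "p (x \<oplus> y) \<le> p x + p y" by simp
  next
    fix c :: real and x assume c: "0 < c" and x: "x \<in> carrier V"
    let ?c = "complex_of_real c"
    have sc: "vnorm V (?c \<odot> x \<oplus> ?c \<odot> w) - Re (?c * a) = c * (vnorm V (x \<oplus> w) - Re a)"
      if "w \<in> carrier V" for w a
      using that x c vnorm_smult [of "x \<oplus> w" ?c] by (simp add: smult_r_distr right_diff_distrib)
    show "p (?c \<odot> x) = c * p x"
    proof (rule antisym)
      have "p (?c \<odot> x) / c \<le> p x"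
      proof (rule pge)
        fix w a assume w: "(w, a) \<in> G"
        show "p (?c \<odot> x) / c \<le> vnorm V (x \<oplus> w) - Re a"
          using ple [OF smult_in_carrier [OF x] G_smult [OF w], of ?c ?c] sc [OF Gc [OF w], of a] c
          by (simp add: pos_divide_le_eq mult.commute)
      qed
      then show "p (?c \<odot> x) \<le> c * p x" using c by (simp add: field_simps)
      show "c * p x \<le> p (?c \<odot> x)"
      proof (rule pge)
        fix w a assume w: "(w, a) \<in> G"
        let ?d = "complex_of_real (inverse c)"
        have e: "?c \<odot> (?d \<odot> w) = w" "?c * (?d * a) = a"
          using c Gc [OF w] smult_assoc1 [of ?c ?d w] smult_one [of w]
          by (simp_all flip: of_real_mult)
        show "c * p x \<le> vnorm V (?c \<odot> x \<oplus> w) - Re a"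
          using ple [OF x G_smult [OF w], of ?d] sc [OF smult_in_carrier [OF Gc [OF w]], of ?d "?d * a"] c
          unfolding e by simp
      qed
    qed
  qed
  then obtain \<psi> where \<psi>: "\<And>x y. x \<in> carrier V \<Longrightarrow> y \<in> carrier V \<Longrightarrow> \<psi> (x \<oplus> y) = \<psi> x + \<psi> y"
    "\<And>c x. x \<in> carrier V \<Longrightarrow> \<psi> (complex_of_real c \<odot> x) = c * \<psi> x"
    "\<And>x. x \<in> carrier V \<Longrightarrow> \<psi> x \<le> p x"
    by (rule R.sublinear_dominates_linear) blast
  have zeroG: "(\<zero>, 0) \<in> G"
  proof -
    obtain w a where "(w, a) \<in> G" using G(2) by auto
    then show ?thesis using G_smult [of w a 0] smult_l_null [of w] Gc by (simp add: complex_field_def)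
  qed
  have \<psi>_norm: "\<psi> x \<le> vnorm V x" if "x \<in> carrier V" for x
    using \<psi>(3) [OF that] ple [OF that zeroG] that by simp
  have \<psi>_ge: "Re a \<le> \<psi> w" if w: "(w, a) \<in> G" for w a
  proof -
    have "\<psi> ((-1) \<odot> w) \<le> - Re a"
      using \<psi>(3) [OF smult_in_carrier [OF Gc [OF w]], of "-1"]
        ple [OF smult_in_carrier [OF Gc [OF w]] w, of "-1"] neg_eq_smult [OF Gc [OF w]] vnorm_zero by simp
    then show ?thesis using \<psi>(2) [OF Gc [OF w], of "-1"] by simp
  qed
  have \<psi>_eq: "\<psi> w = Re a" if w: "(w, a) \<in> G" for w a
    using \<psi>_ge [OF w] \<psi>_ge [OF G_smult [OF w, of "-1"]] \<psi>(2) [OF Gc [OF w], of "-1"] by simp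
  \<comment> \<open>The complex linear functional with real part \<psi>: its imaginary part is
    forced by compatibility with multiplication by \<open>\<i>\<close>.\<close>
  define \<phi> where "\<phi> x = Complex (\<psi> x) (- \<psi> (\<i> \<odot> x))" for x
  have add: "\<phi> (x \<oplus> y) = \<phi> x + \<phi> y" if "x \<in> carrier V" "y \<in> carrier V" for x y
    using that by (simp add: \<phi>_def \<psi>(1) smult_r_distr smult_in_carrier complex_eq_iff)
  have scale: "\<phi> (c \<odot> x) = c * \<phi> x" if x: "x \<in> carrier V" for c x
  proof -
    have 1: "\<psi> (Complex a b \<odot> x) = a * \<psi> x + b * \<psi> (\<i> \<odot> x)" for a b
    proof -
      have "Complex a b = complex_of_real a + complex_of_real b * \<i>" by (simp add: complex_eq_iff)
      then have "Complex a b \<odot> x = complex_of_real a \<odot> x \<oplus> complex_of_real b \<odot> (\<i> \<odot> x)"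
        using smult_l_distr [of "complex_of_real a" "complex_of_real b * \<i>" x] smult_assoc1 [of "complex_of_real b" \<i> x] x
        by simp
      then show ?thesis using x by (simp add: \<psi>(1,2) smult_in_carrier)
    qed
    have "\<psi> (\<i> \<odot> (c \<odot> x)) = \<psi> (Complex (- Im c) (Re c) \<odot> x)"
    proof -
      have "\<i> * c = Complex (- Im c) (Re c)" by (simp add: complex_eq_iff)
      then show ?thesis using smult_assoc1 [of \<i> c x] x by simp
    qed
    then show ?thesis
      using 1 [of "Re c" "Im c"] 1 [of "- Im c" "Re c"] by (simp add: \<phi>_def complex_eq_iff)
  qed
  show ?thesis
  proof (rule that [OF add scale])
    fix x assume x: "x \<in> carrier V"
    obtain u where u: "cmod u = 1" "complex_of_real (cmod (\<phi> x)) = u * \<phi> x"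
      using exists_unit_rotation by blast
    have "cmod (\<phi> x) = Re (\<phi> (u \<odot> x))" unfolding scale [OF x] u(2) [symmetric] by simp
    also have "\<dots> \<le> vnorm V (u \<odot> x)" using \<psi>_norm [OF smult_in_carrier [OF x]] by (simp add: \<phi>_def)
    finally show "cmod (\<phi> x) \<le> vnorm V x" using u(1) x by (simp add: vnorm_smult)
  next
    fix x a assume "(x, a) \<in> G"
    then show "\<phi> x = a" using \<psi>_eq [of x a] \<psi>_eq [OF G_smult, of x a \<i>] by (simp add: \<phi>_def complex_eq_iff)
  qed
qed

end

section \<open>The upper bound\<close>

definition lebesgue_constant :: "real \<Rightarrow> nat \<Rightarrow> real" where
  "lebesgue_constant \<nu> d = integral {-1..1} (\<lambda>t. \<bar>poly (kernel_poly \<nu> d) t\<bar> * (1 - t\<^sup>2) powr \<nu>) / gegenbauer_moment \<nu> 0"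

lemma integral_abs_kernel:
  fixes x :: "real ^ 'n"
  assumes "CARD('n) > 2" "\<nu> = (real CARD('n) - 3) / 2" "norm x = 1"
  shows "(AVG y. \<bar>poly (kernel_poly \<nu> d) (x \<bullet> y)\<bar>) = lebesgue_constant \<nu> d"
  unfolding lebesgue_constant_def
  by (rule integral_sphere_ridge [OF assms]) (intro continuous_intros)

lemma sphere_nonempty: "sphere (0 :: real ^ 'n) 1 \<noteq> {}"
  by simp

lemma sphere_polynomials_simps:
  "carrier (sphere_polynomials d) = (\<lambda>p. restrict p (sphere 0 1)) ` polynomials_upto d"
  "\<zero>\<^bsub>sphere_polynomials d\<^esub> = (\<lambda>x\<in>sphere 0 1. 0)"
  "f \<oplus>\<^bsub>sphere_polynomials d\<^esub> g = (\<lambda>x\<in>sphere 0 1. f x + g x)"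
  "c \<odot>\<^bsub>sphere_polynomials d\<^esub> f = (\<lambda>x\<in>sphere 0 1. c * f x)"
  "vnorm (sphere_polynomials d) f = (SUP x\<in>sphere 0 1. cmod (f x))"
  by (simp_all add: sphere_polynomials_def)

lemma bdd_above_norm_sphere:
  assumes "continuous_on UNIV (f :: 'a::euclidean_space \<Rightarrow> 'b::real_normed_vector)"
  shows "bdd_above ((\<lambda>x. norm (f x)) ` sphere 0 1)"
  by (intro bounded_imp_bdd_above compact_imp_bounded compact_continuous_image continuous_intros
    continuous_on_subset [OF assms]) auto

lemma cmod_le_sphere_norm:
  assumes f: "f \<in> carrier (sphere_polynomials d)" and x: "x \<in> sphere 0 1"
  shows "cmod (f x) \<le> vnorm (sphere_polynomials d) f"
proof -
  obtain p where p: "p \<in> polynomials_upto d" "f = restrict p (sphere 0 1)"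
    using f by (auto simp: sphere_polynomials_simps)
  have "bdd_above ((\<lambda>x. cmod (f x)) ` sphere 0 1)"
    using bdd_above_norm_sphere [OF continuous_on_polynomials_upto [OF p(1)]]
    unfolding p(2) by (simp cong: image_cong_simp)
  then show ?thesis unfolding sphere_polynomials_simps by (rule cSUP_upper2 [OF _ x order_refl])
qed

text \<open>\<open>bounded_funs\<close> asks for a bound on the whole space, where a polynomial
  factor \<open>h\<close> is in general unbounded. A second factor vanishing off the sphere repairs
  this.\<close>

lemma bounded_funs_sphere:
  fixes h :: "'a::euclidean_space \<Rightarrow> 'b::real_normed_algebra" and g :: "'a \<Rightarrow> 'b"
  assumes h: "continuous_on UNIV h" and g: "g \<in> bounded_funs" and g0: "\<And>s. s \<notin> sphere 0 1 \<Longrightarrow> g s = 0"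
  shows "(\<lambda>s. h s * g s) \<in> bounded_funs"
proof -
  obtain A where A: "\<And>s. s \<in> sphere 0 1 \<Longrightarrow> norm (h s) \<le> A"
    using bdd_above_norm_sphere [OF h] unfolding bdd_above_def by blast
  obtain B where B: "B \<ge> 0" "\<And>s. norm (g s) \<le> B" by (rule bounded_funsE [OF g]) blast
  have "norm (h s * g s) \<le> \<bar>A\<bar> * B" for s
  proof (cases "s \<in> sphere 0 1")
    case True
    then show ?thesis using A [OF True] B [of] norm_mult_ineq [of "h s" "g s"]
      by (intro order_trans [OF norm_mult_ineq] mult_mono) auto
  qed (use g0 B in simp)
  then show ?thesis by (rule bounded_funsI)
qed

lemma functional_sum:
  fixes m :: "('a \<Rightarrow> 'b::real_normed_algebra_1) \<Rightarrow> 'b"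
  assumes add: "\<And>f g. f \<in> bounded_funs \<Longrightarrow> g \<in> bounded_funs \<Longrightarrow> m (\<lambda>x. f x + g x) = m f + m g"
    and scale: "\<And>c f. f \<in> bounded_funs \<Longrightarrow> m (\<lambda>x. c * f x) = c * m f"
    and f: "\<And>i. i \<in> A \<Longrightarrow> f i \<in> bounded_funs"
  shows "m (\<lambda>s. \<Sum>i\<in>A. f i s) = (\<Sum>i\<in>A. m (f i))"
proof -
  have "m (\<lambda>s. 0) = 0"
    using scale [of "\<lambda>s. 0" 0] by (simp add: bounded_funs_const)
  then show ?thesis
    using f by (induction A rule: infinite_finite_induct) (auto simp: add bounded_funs_sum)
qed

text \<open>The reason why the constructed projection takes polynomial values: expanding
  \<open>x \<bullet> s\<close> in coordinates separates \<open>x\<close> from \<open>s\<close>, and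
  \<open>m\<close> acts only on the coefficients of the monomials in \<open>x\<close>. In the
  induction \<open>g\<close> varies, because each step absorbs a coordinate of \<open>s\<close> into
  it.\<close>

lemma functional_ridge_polynomial:
  fixes m :: "(real ^ 'n \<Rightarrow> complex) \<Rightarrow> complex"
  assumes add: "\<And>f g. f \<in> bounded_funs \<Longrightarrow> g \<in> bounded_funs \<Longrightarrow> m (\<lambda>x. f x + g x) = m f + m g"
    and scale: "\<And>c f. f \<in> bounded_funs \<Longrightarrow> m (\<lambda>x. c * f x) = c * m f"
    and g: "g \<in> bounded_funs" "\<And>s. s \<notin> sphere 0 1 \<Longrightarrow> g s = 0" and q: "degree q \<le> d"
  shows "(\<lambda>x. m (\<lambda>s. of_real (poly q (x \<bullet> s)) * g s)) \<in> polynomials_upto d"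
proof -
  have sumv: "m (\<lambda>s. \<Sum>i\<in>A. f i s) = (\<Sum>i\<in>A. m (f i))"
    if "\<And>i. i \<in> A \<Longrightarrow> f i \<in> bounded_funs" for f and A :: "'n set"
    using add scale that by (rule functional_sum)
  have sumn: "m (\<lambda>s. \<Sum>i\<in>A. f i s) = (\<Sum>i\<in>A. m (f i))"
    if "\<And>i. i \<in> A \<Longrightarrow> f i \<in> bounded_funs" for f and A :: "nat set"
    using add scale that by (rule functional_sum)
  have pow: "(\<lambda>x. m (\<lambda>s. of_real ((x \<bullet> s) ^ l) * g s)) \<in> polynomials_upto l"
    if "g \<in> bounded_funs" "\<And>s. s \<notin> sphere 0 1 \<Longrightarrow> g s = 0" for l g
    using that
  proof (induction l arbitrary: g)
    case 0
    show ?case by (simp add: polynomials_upto_const)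
  next
    case (Suc l)
    have gi: "(\<lambda>s. of_real (s $ i) * g s) \<in> bounded_funs" for i
      by (rule bounded_funs_sphere [OF _ Suc.prems]) (intro continuous_intros)
    have b: "(\<lambda>s. complex_of_real ((x \<bullet> s) ^ l) * (of_real (s $ i) * g s)) \<in> bounded_funs" for i x
      by (rule bounded_funs_sphere [OF _ gi]) (auto simp: Suc.prems intro!: continuous_intros)
    have "m (\<lambda>s. of_real ((x \<bullet> s) ^ Suc l) * g s)
        = (\<Sum>i\<in>UNIV. of_real (x $ i) * m (\<lambda>s. complex_of_real ((x \<bullet> s) ^ l) * (of_real (s $ i) * g s)))"
      for x
    proof -
      have "of_real ((x \<bullet> s) ^ Suc l) * g s
        = (\<Sum>i\<in>UNIV. complex_of_real (x $ i) * (complex_of_real ((x \<bullet> s) ^ l) * (of_real (s $ i) * g s)))" for s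
      proof -
        have "complex_of_real ((x \<bullet> s) ^ Suc l) = complex_of_real ((x \<bullet> s) ^ l) * (\<Sum>i\<in>UNIV. complex_of_real (x $ i) * complex_of_real (s $ i))"
          by (subst power_Suc, subst (1) inner_vec_def) simp
        then show ?thesis by (simp add: sum_distrib_left sum_distrib_right mult_ac)
      qed
      then show ?thesis
        by (simp only: sumv [OF bounded_funs_mult [OF bounded_funs_const b]] scale [OF b])
    qed
    moreover have "(\<lambda>x. \<Sum>i\<in>UNIV. of_real (x $ i) * m (\<lambda>s. complex_of_real ((x \<bullet> s) ^ l) * (of_real (s $ i) * g s)))
        \<in> polynomials_upto (Suc l)"
      by (intro polynomials_upto_sum polynomials_upto_coordinate Suc.IH gi) (simp add: Suc.prems)
    ultimately show ?case by simp
  qed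
  have b: "(\<lambda>s. of_real ((x \<bullet> s) ^ l) * g s) \<in> bounded_funs" for x l
    by (rule bounded_funs_sphere [OF _ g]) (intro continuous_intros)
  have "m (\<lambda>s. of_real (poly q (x \<bullet> s)) * g s)
      = (\<Sum>l\<le>degree q. of_real (coeff q l) * m (\<lambda>s. of_real ((x \<bullet> s) ^ l) * g s))" for x
  proof -
    have "of_real (poly q (x \<bullet> s)) * g s
      = (\<Sum>l\<le>degree q. complex_of_real (coeff q l) * (of_real ((x \<bullet> s) ^ l) * g s))" for s
      by (simp add: poly_altdef sum_distrib_left sum_distrib_right mult_ac)
    then show ?thesis
      by (simp only: sumn [OF bounded_funs_mult [OF bounded_funs_const b]] scale [OF b])
  qed
  moreover have "(\<lambda>x. \<Sum>l\<le>degree q. of_real (coeff q l) * m (\<lambda>s. of_real ((x \<bullet> s) ^ l) * g s)) \<in> polynomials_upto d"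
    by (intro polynomials_upto_sum polynomials_upto_scale polynomials_upto_mono [OF pow [OF g]]) (use q in auto)
  ultimately show ?thesis by simp
qed

theorem relative_projection_constant_le:
  fixes Y :: "'b normed_module" and I :: "(real ^ 'n \<Rightarrow> complex) \<Rightarrow> 'b"
  assumes n: "CARD('n) > 2" and \<nu>: "\<nu> = (real CARD('n) - 3) / 2"
    and Y: "complex_banach_space Y" and I: "isometric_embedding (sphere_polynomials d) Y I"
  shows "relative_projection_constant (I ` carrier (sphere_polynomials d)) Y \<le> ereal (lebesgue_constant \<nu> d)"
proof -
  interpret Y: complex_banach_space Y by fact
  define S where "S = sphere (0 :: real ^ 'n) 1"
  define X where "X = (sphere_polynomials d :: (real ^ 'n \<Rightarrow> complex) normed_module)"
  define kap where "kap = poly (kernel_poly \<nu> d)"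
  define L where "L = lebesgue_constant \<nu> d"
  have S0: "S \<noteq> {}" by (simp add: S_def)
  have S_borel [measurable]: "S \<in> sets borel" by (simp add: S_def)
  have kap_borel [measurable]: "(\<lambda>s. kap (x \<bullet> s)) \<in> borel_measurable borel" for x :: "real ^ 'n"
    unfolding kap_def by (intro borel_measurable_continuous_onI continuous_intros)
  have I_closed: "I f \<in> carrier Y" if "f \<in> carrier X" for f
    using I that by (auto simp: isometric_embedding_def linear_op_def X_def)
  have I_add: "I f \<oplus>\<^bsub>Y\<^esub> I g = I (\<lambda>x\<in>S. f x + g x)" if "f \<in> carrier X" "g \<in> carrier X" for f g
    using I that by (simp add: isometric_embedding_def linear_op_def X_def S_def sphere_polynomials_simps(3))
  have I_smult: "c \<odot>\<^bsub>Y\<^esub> I f = I (\<lambda>x\<in>S. c * f x)" if "f \<in> carrier X" for f c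
    using I that by (simp add: isometric_embedding_def linear_op_def X_def S_def sphere_polynomials_simps(4))
  have I_norm: "vnorm Y (I f) = vnorm X f" if "f \<in> carrier X" for f
    using I that by (simp add: isometric_embedding_def X_def)
  have X_carrier: "f \<in> carrier X \<longleftrightarrow> (\<exists>p\<in>polynomials_upto d. f = restrict p S)" for f
    by (auto simp: X_def S_def sphere_polynomials_simps(1))
  have X_add: "(\<lambda>x\<in>S. f x + g x) \<in> carrier X" if fg: "f \<in> carrier X" "g \<in> carrier X" for f g
  proof -
    obtain p q where "p \<in> polynomials_upto d" "q \<in> polynomials_upto d" "f = restrict p S" "g = restrict q S"
      using fg X_carrier by auto
    then show ?thesis
      unfolding X_carrier by (intro bexI [of _ "\<lambda>x. p x + q x"] polynomials_upto_add) auto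
  qed
  have X_smult: "(\<lambda>x\<in>S. c * f x) \<in> carrier X" if f: "f \<in> carrier X" for f c
  proof -
    obtain p where "p \<in> polynomials_upto d" "f = restrict p S" using f X_carrier by auto
    then show ?thesis
      unfolding X_carrier by (intro bexI [of _ "\<lambda>x. c * p x"] polynomials_upto_scale) auto
  qed
  have ex: "\<exists>\<phi>. (\<forall>x\<in>carrier Y. \<forall>y\<in>carrier Y. \<phi> (x \<oplus>\<^bsub>Y\<^esub> y) = \<phi> x + \<phi> y) \<and>
      (\<forall>c. \<forall>x\<in>carrier Y. \<phi> (c \<odot>\<^bsub>Y\<^esub> x) = c * \<phi> x) \<and>
      (\<forall>x\<in>carrier Y. cmod (\<phi> x) \<le> vnorm Y x) \<and> (\<forall>f\<in>carrier X. \<phi> (I f) = f s)"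
    if s: "s \<in> S" for s
  proof -
    \<comment> \<open>The graph of evaluation at \<open>s\<close> on the copy of the polynomials
      inside \<open>Y\<close>. Since \<open>I\<close> preserves norms, the evaluation is dominated
      by the norm of \<open>Y\<close>.\<close>
    define G where "G = (\<lambda>f. (I f, f s)) ` carrier X"
    have G_I: "(I h, h s) \<in> G" if "h \<in> carrier X" for h using that by (simp add: G_def)
    obtain \<phi> where \<phi>: "\<And>x y. x \<in> carrier Y \<Longrightarrow> y \<in> carrier Y \<Longrightarrow> \<phi> (x \<oplus>\<^bsub>Y\<^esub> y) = \<phi> x + \<phi> y"
      "\<And>c x. x \<in> carrier Y \<Longrightarrow> \<phi> (c \<odot>\<^bsub>Y\<^esub> x) = c * \<phi> x"
      "\<And>x. x \<in> carrier Y \<Longrightarrow> cmod (\<phi> x) \<le> vnorm Y x"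
      "\<And>x a. (x, a) \<in> G \<Longrightarrow> \<phi> x = a"
    proof (rule Y.hahn_banach [of G])
      show "G \<subseteq> carrier Y \<times> UNIV" using I_closed by (auto simp: G_def)
      show "G \<noteq> {}" using polynomials_upto_0 by (auto simp: G_def X_def sphere_polynomials_simps(1))
      show "(x \<oplus>\<^bsub>Y\<^esub> y, a + b) \<in> G" if xy: "(x, a) \<in> G" "(y, b) \<in> G" for x a y b
      proof -
        obtain f g where fg: "f \<in> carrier X" "g \<in> carrier X" "x = I f" "a = f s" "y = I g" "b = g s"
          using xy by (auto simp: G_def)
        then show ?thesis using G_I [OF X_add [OF fg(1,2)]] s by (simp add: I_add)
      qed
      show "(c \<odot>\<^bsub>Y\<^esub> x, c * a) \<in> G" if xa: "(x, a) \<in> G" for c x a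
      proof -
        obtain f where f: "f \<in> carrier X" "x = I f" "a = f s" using xa by (auto simp: G_def)
        then show ?thesis using G_I [OF X_smult [OF f(1)], of c] s by (simp add: I_smult)
      qed
      show "cmod a \<le> vnorm Y x" if "(x, a) \<in> G" for x a
        using that s cmod_le_sphere_norm by (auto simp: G_def I_norm X_def S_def)
    qed blast
    then show ?thesis by (intro exI [of _ \<phi>]) (auto simp: G_def)
  qed
  from bchoice [OF ballI [OF ex]] obtain \<phi> where
    "\<forall>s\<in>S. (\<forall>x\<in>carrier Y. \<forall>y\<in>carrier Y. \<phi> s (x \<oplus>\<^bsub>Y\<^esub> y) = \<phi> s x + \<phi> s y) \<and>
      (\<forall>c. \<forall>x\<in>carrier Y. \<phi> s (c \<odot>\<^bsub>Y\<^esub> x) = c * \<phi> s x) \<and>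
      (\<forall>x\<in>carrier Y. cmod (\<phi> s x) \<le> vnorm Y x) \<and> (\<forall>f\<in>carrier X. \<phi> s (I f) = f s)" ..
  then have \<phi>: "\<And>s x y. s \<in> S \<Longrightarrow> x \<in> carrier Y \<Longrightarrow> y \<in> carrier Y \<Longrightarrow> \<phi> s (x \<oplus>\<^bsub>Y\<^esub> y) = \<phi> s x + \<phi> s y"
      "\<And>s c x. s \<in> S \<Longrightarrow> x \<in> carrier Y \<Longrightarrow> \<phi> s (c \<odot>\<^bsub>Y\<^esub> x) = c * \<phi> s x"
      "\<And>s x. s \<in> S \<Longrightarrow> x \<in> carrier Y \<Longrightarrow> cmod (\<phi> s x) \<le> vnorm Y x"
      "\<And>s f. s \<in> S \<Longrightarrow> f \<in> carrier X \<Longrightarrow> \<phi> s (I f) = f s"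
    by blast+
  define \<psi> where "\<psi> y s = (if s \<in> S then \<phi> s y else 0)" for y s
  have \<psi>0: "\<psi> y s = 0" if "s \<notin> sphere 0 1" for y s using that by (simp add: \<psi>_def S_def)
  have \<psi>_bound: "cmod (\<psi> y s) \<le> vnorm Y y" if "y \<in> carrier Y" for y s
    using \<phi>(3) that Y.vnorm_nonneg by (simp add: \<psi>_def)
  have \<psi>_bd: "\<psi> y \<in> bounded_funs" if "y \<in> carrier Y" for y
    using \<psi>_bound [OF that] by (rule bounded_funsI)
  obtain m :: "(real ^ 'n \<Rightarrow> complex) \<Rightarrow> complex"
    where m: "\<And>f g. f \<in> bounded_funs \<Longrightarrow> g \<in> bounded_funs \<Longrightarrow> m (\<lambda>x. f x + g x) = m f + m g"
    "\<And>c f. f \<in> bounded_funs \<Longrightarrow> m (\<lambda>x. c * f x) = c * m f"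
    "\<And>f. f \<in> bounded_funs \<Longrightarrow> f \<in> borel_measurable sphere_measure \<Longrightarrow> m f = integral\<^sup>L sphere_measure f"
    "\<And>f g. f \<in> bounded_funs \<Longrightarrow> g \<in> bounded_funs \<Longrightarrow> g \<in> borel_measurable sphere_measure \<Longrightarrow>
           (\<And>x. cmod (f x) \<le> g x) \<Longrightarrow> cmod (m f) \<le> integral\<^sup>L sphere_measure g"
    by (rule positive_extension_complex [OF prob_space_sphere_measure]) blast
  define K where "K y x = m (\<lambda>s. of_real (kap (x \<bullet> s)) * \<psi> y s)" for y x
  have bd: "(\<lambda>s. of_real (kap (x \<bullet> s)) * \<psi> y s) \<in> bounded_funs" if "y \<in> carrier Y" for x y
    unfolding kap_def by (rule bounded_funs_sphere [OF _ \<psi>_bd [OF that] \<psi>0]) (intro continuous_intros)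
  have K_poly: "K y \<in> polynomials_upto d" if "y \<in> carrier Y" for y
    unfolding K_def [abs_def] kap_def
    by (rule functional_ridge_polynomial [OF m(1,2) \<psi>_bd [OF that] \<psi>0 degree_kernel_poly])
  have K_add: "K (y \<oplus>\<^bsub>Y\<^esub> z) x = K y x + K z x" if "y \<in> carrier Y" "z \<in> carrier Y" for x y z
  proof -
    have "\<psi> (y \<oplus>\<^bsub>Y\<^esub> z) s = \<psi> y s + \<psi> z s" for s using that \<phi>(1) by (simp add: \<psi>_def)
    then show ?thesis unfolding K_def by (simp add: distrib_left m(1) [OF bd bd] that)
  qed
  have K_smult: "K (c \<odot>\<^bsub>Y\<^esub> y) x = c * K y x" if "y \<in> carrier Y" for c x y
  proof -
    have "\<psi> (c \<odot>\<^bsub>Y\<^esub> y) s = c * \<psi> y s" for s using that \<phi>(2) by (simp add: \<psi>_def)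
    then show ?thesis unfolding K_def by (simp add: mult.left_commute [of _ c] m(2) [OF bd] that)
  qed
  have K_bound: "cmod (K y x) \<le> L * vnorm Y y" if y: "y \<in> carrier Y" and x: "x \<in> S" for y x
  proof -
    \<comment> \<open>A measurable majorant of the integrand: the values of \<open>\<psi> y\<close>,
      possibly not measurable, are replaced by the norm of \<open>y\<close>. The indicator keeps
      \<open>g\<close> bounded off the sphere.\<close>
    define g where "g s = \<bar>kap (x \<bullet> s)\<bar> * (indicator S s * vnorm Y y)" for s
    have i1: "(\<lambda>s. indicator S s * vnorm Y y) \<in> bounded_funs"
      by (rule bounded_funsI [of _ "\<bar>vnorm Y y\<bar>"]) (simp add: indicator_def)
    have gb: "g \<in> bounded_funs"
      unfolding g_def [abs_def] kap_def
      by (rule bounded_funs_sphere [OF _ i1]) (auto simp: S_def intro!: continuous_intros)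
    have gm: "g \<in> borel_measurable borel"
      unfolding g_def [abs_def] by measurable
    have "cmod (K y x) \<le> integral\<^sup>L sphere_measure g"
      unfolding K_def
    proof (rule m(4) [OF bd [OF y] gb])
      show "cmod (of_real (kap (x \<bullet> s)) * \<psi> y s) \<le> g s" for s
        using \<phi>(3) [OF _ y, of s] by (auto simp: g_def \<psi>_def norm_mult intro!: mult_left_mono)
    qed (use gm in simp)
    also have "\<dots> = (AVG s. \<bar>kap (x \<bullet> s)\<bar> * vnorm Y y)"
      by (rule integral_sphere_cong [OF gm]) (auto simp: g_def S_def)
    also have "\<dots> = L * vnorm Y y"
      using integral_abs_kernel [OF n \<nu>, of x d] x by (simp add: L_def kap_def S_def)
    finally show ?thesis .
  qed
  have K_proj: "K (I f) x = f x" if f: "f \<in> carrier X" and x: "x \<in> S" for f x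
  proof -
    obtain p where p: "p \<in> polynomials_upto d" "f = restrict p S" using f X_carrier by auto
    have "(\<lambda>s. of_real (kap (x \<bullet> s)) * \<psi> (I f) s) = (\<lambda>s. complex_of_real (kap (x \<bullet> s)) * (indicator S s * p s))"
      using \<phi>(4) f by (auto simp: \<psi>_def p(2) indicator_def)
    moreover have pm [measurable]: "p \<in> borel_measurable borel"
      by (intro borel_measurable_continuous_onI continuous_on_polynomials_upto [OF p(1)])
    ultimately have meas: "(\<lambda>s. of_real (kap (x \<bullet> s)) * \<psi> (I f) s) \<in> borel_measurable borel"
      by simp
    \<comment> \<open>On the copy of a polynomial the integrand is measurable, so here
      \<open>m\<close> is the integral over the sphere and the reproducing property applies.\<close>
    then have "K (I f) x = (AVG s. of_real (kap (x \<bullet> s)) * \<psi> (I f) s)"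
      unfolding K_def by (intro m(3) bd I_closed f) simp
    also have "\<dots> = (AVG s. of_real (kap (x \<bullet> s)) * p s)"
    proof (rule integral_sphere_cong [OF meas])
      show "(\<lambda>s. of_real (kap (x \<bullet> s)) * p s) \<in> borel_measurable borel" by measurable
      show "of_real (kap (x \<bullet> s)) * \<psi> (I f) s = of_real (kap (x \<bullet> s)) * p s" if "norm s = 1" for s
        using \<phi>(4) [OF _ f, of s] that by (simp add: \<psi>_def S_def p(2))
    qed
    also have "\<dots> = p x" unfolding kap_def by (rule kernel_reproducing [OF n \<nu> _ p(1)]) (use x in \<open>simp add: S_def\<close>)
    finally show ?thesis using x by (simp add: p(2))
  qed
  define Z where "Z = Y\<lparr>carrier := I ` carrier X\<rparr>"
  define P where "P y = I (restrict (K y) S)" for y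
  have KX: "restrict (K y) S \<in> carrier X" if "y \<in> carrier Y" for y
    using K_poly [OF that] X_carrier by blast
  have P_norm: "vnorm Y (P y) \<le> L * vnorm Y y" if y: "y \<in> carrier Y" for y
  proof -
    have "vnorm Y (P y) = vnorm X (restrict (K y) S)" unfolding P_def by (rule I_norm [OF KX [OF y]])
    also have "\<dots> = (SUP x\<in>S. cmod (restrict (K y) S x))" by (simp only: X_def S_def sphere_polynomials_simps(5))
    also have "\<dots> \<le> L * vnorm Y y" using S0 K_bound [OF y] by (intro cSUP_least) auto
    finally show ?thesis .
  qed
  have \<nu>0: "\<nu> \<ge> 0" using n by (simp add: \<nu>)
  have L0: "L \<ge> 0"
    unfolding L_def lebesgue_constant_def
    using gegenbauer_moment_0_pos [OF \<nu>0] \<nu>0 by (intro divide_nonneg_pos integral_nonneg integrable_gegenbauer continuous_intros) auto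
  have "linear_op Y Z P"
    unfolding linear_op_def
  proof (intro conjI ballI allI)
    show "P \<in> carrier Y \<rightarrow> carrier Z" using KX by (auto simp: P_def Z_def)
    show "P (y \<oplus>\<^bsub>Y\<^esub> z) = P y \<oplus>\<^bsub>Z\<^esub> P z" if "y \<in> carrier Y" "z \<in> carrier Y" for y z
      unfolding P_def Z_def using that by (simp add: I_add KX K_add cong: restrict_cong)
    show "P (c \<odot>\<^bsub>Y\<^esub> y) = c \<odot>\<^bsub>Z\<^esub> P y" if "y \<in> carrier Y" for c y
      unfolding P_def Z_def using that by (simp add: I_smult KX K_smult cong: restrict_cong)
  qed
  then have bop: "bounded_op Y Z P"
    unfolding bounded_op_def using P_norm by (auto simp: Z_def)
  have proj: "P y = y" if y: "y \<in> I ` carrier X" for y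
  proof -
    obtain f where f: "f \<in> carrier X" "y = I f" using y by auto
    then obtain p where "f = restrict p S" using X_carrier by auto
    then have "restrict (K (I f)) S = f" using K_proj [OF f(1)] by (auto simp: restrict_def fun_eq_iff)
    then show ?thesis by (simp add: P_def f(2))
  qed
  have "op_norm Y Z P \<le> L"
    unfolding op_norm_def
  proof (rule cSUP_least)
    \<comment> \<open>A supremum of reals is bounded by its members' bound only over a non-empty
      set; the zero vector provides a member.\<close>
    show "{x \<in> carrier Y. vnorm Y x \<le> 1} \<noteq> {}" using Y.vnorm_zero Y.M.zero_closed by force
    fix y assume "y \<in> {x \<in> carrier Y. vnorm Y x \<le> 1}"
    then have "vnorm Y (P y) \<le> L * vnorm Y y" "L * vnorm Y y \<le> L * 1"
      using P_norm mult_left_mono [OF _ L0, of "vnorm Y y" 1] by auto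
    then show "vnorm Z (P y) \<le> L" by (simp add: Z_def)
  qed
  then show ?thesis
    unfolding relative_projection_constant_def using bop proj
    by (intro INF_lower2 [of P]) (auto simp: Z_def X_def L_def)
qed

section \<open>The lower bound\<close>

lemma cring_complex_field: "cring complex_field"
proof (rule cringI)
  show "abelian_group complex_field"
  proof (rule abelian_groupI)
    fix x assume "x \<in> carrier complex_field"
    show "\<exists>y\<in>carrier complex_field. y \<oplus>\<^bsub>complex_field\<^esub> x = \<zero>\<^bsub>complex_field\<^esub>"
      by (rule bexI [of _ "-x"]) (simp_all add: complex_field_def)
  qed (simp_all add: complex_field_def)
  show "comm_monoid complex_field"
    by (rule comm_monoidI) (simp_all add: complex_field_def)
qed (simp add: complex_field_def algebra_simps)

text \<open>The operations and the norm of \<open>sphere_polynomials\<close> do not depend on the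
  degree, so replacing the carrier of degree 0 suffices. The polynomials of every degree become a
  subspace with the same operations, and the embedding is \<open>id\<close>.\<close>

definition bounded_sphere_funs :: "(real ^ 'n \<Rightarrow> complex) normed_module" where
  "bounded_sphere_funs = (sphere_polynomials 0)
     \<lparr>carrier := {f \<in> extensional (sphere 0 1). bdd_above ((\<lambda>x. cmod (f x)) ` sphere 0 1)}\<rparr>"

lemma bounded_sphere_funs_simps:
  "carrier bounded_sphere_funs = {f \<in> extensional (sphere 0 1). bdd_above ((\<lambda>x. cmod (f x)) ` sphere 0 1)}"
  "\<zero>\<^bsub>bounded_sphere_funs\<^esub> = (\<lambda>x\<in>sphere 0 1. 0)"
  "f \<oplus>\<^bsub>bounded_sphere_funs\<^esub> g = (\<lambda>x\<in>sphere 0 1. f x + g x)"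
  "c \<odot>\<^bsub>bounded_sphere_funs\<^esub> f = (\<lambda>x\<in>sphere 0 1. c * f x)"
  "vnorm bounded_sphere_funs f = (SUP x\<in>sphere 0 1. cmod (f x))"
  by (simp_all add: bounded_sphere_funs_def sphere_polynomials_simps)

lemma bounded_sphere_functionI:
  assumes "\<And>x. x \<in> sphere 0 1 \<Longrightarrow> cmod (f x) \<le> B" "f \<in> extensional (sphere 0 1)"
  shows "f \<in> carrier bounded_sphere_funs"
  using assms by (auto simp: bounded_sphere_funs_simps intro!: bdd_aboveI2)

lemma vnorm_bounded_sphere_le:
  fixes f :: "real ^ 'n \<Rightarrow> complex"
  assumes "\<And>x. x \<in> sphere 0 1 \<Longrightarrow> cmod (f x) \<le> B"
  shows "vnorm bounded_sphere_funs f \<le> B"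
  unfolding bounded_sphere_funs_simps by (rule cSUP_least [OF sphere_nonempty assms])

lemma cmod_le_vnorm_bounded_sphere:
  assumes "f \<in> carrier bounded_sphere_funs" "x \<in> sphere 0 1"
  shows "cmod (f x) \<le> vnorm bounded_sphere_funs f"
  using assms unfolding bounded_sphere_funs_simps by (auto intro!: cSUP_upper)

lemma vnorm_bounded_sphere_nonneg:
  fixes f :: "real ^ 'n \<Rightarrow> complex"
  assumes "f \<in> carrier bounded_sphere_funs" shows "0 \<le> vnorm bounded_sphere_funs f"
proof -
  obtain x where "x \<in> sphere (0 :: real ^ 'n) 1" using sphere_nonempty by blast
  from cmod_le_vnorm_bounded_sphere [OF assms this] show ?thesis
    using norm_ge_zero order_trans by blast
qed

lemma bounded_sphere_closed:
  fixes f g :: "real ^ 'n \<Rightarrow> complex"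
  assumes f: "f \<in> carrier bounded_sphere_funs"
  shows "(\<lambda>x\<in>sphere 0 1. c * f x) \<in> carrier bounded_sphere_funs"
    and "g \<in> carrier bounded_sphere_funs \<Longrightarrow> (\<lambda>x\<in>sphere 0 1. f x + g x) \<in> carrier bounded_sphere_funs"
proof -
  let ?N = "vnorm bounded_sphere_funs"
  note le = cmod_le_vnorm_bounded_sphere
  show "(\<lambda>x\<in>sphere 0 1. c * f x) \<in> carrier bounded_sphere_funs"
    by (rule bounded_sphere_functionI [of _ "cmod c * ?N f"])
      (use le [OF f] in \<open>auto simp: norm_mult intro!: mult_left_mono\<close>)
  show "(\<lambda>x\<in>sphere 0 1. f x + g x) \<in> carrier bounded_sphere_funs"
    if g: "g \<in> carrier bounded_sphere_funs"
    by (rule bounded_sphere_functionI [of _ "?N f + ?N g"])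
      (use le [OF f] le [OF g] in \<open>auto intro!: norm_triangle_le add_mono\<close>)
qed

lemma complex_banach_space_bounded_sphere_funs:
  "complex_banach_space (bounded_sphere_funs :: (real ^ 'n \<Rightarrow> complex) normed_module)"
proof -
  let ?W = "bounded_sphere_funs :: (real ^ 'n \<Rightarrow> complex) normed_module"
  let ?S = "sphere (0 :: real ^ 'n) 1"
  note simps = bounded_sphere_funs_simps(2-4)
  note le = cmod_le_vnorm_bounded_sphere
  have ext: "f \<in> extensional ?S" if "f \<in> carrier ?W" for f
    using that by (simp add: bounded_sphere_funs_simps(1))
  have undef: "f x = undefined" if "f \<in> carrier ?W" "norm x \<noteq> 1" for f x
    using extensional_arb [OF ext [OF that(1)]] that(2) by simp
  have eqI: "f = g" if "f \<in> carrier ?W" "g \<in> carrier ?W" "\<And>x. x \<in> ?S \<Longrightarrow> f x = g x" for f g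
    using extensionalityI [OF ext ext] that by blast
  have zero: "(\<lambda>x\<in>?S. 0) \<in> carrier ?W"
    by (rule bounded_sphere_functionI [of _ 0]) auto
  have ag: "abelian_group ?W"
  proof (rule abelian_groupI)
    show "\<zero>\<^bsub>?W\<^esub> \<in> carrier ?W" using zero by (simp only: simps)
    fix f assume f: "f \<in> carrier ?W"
    show "\<exists>g\<in>carrier ?W. g \<oplus>\<^bsub>?W\<^esub> f = \<zero>\<^bsub>?W\<^esub>"
    proof (rule bexI)
      show "(\<lambda>x\<in>?S. -1 * f x) \<in> carrier ?W" by (rule bounded_sphere_closed(1) [OF f])
      show "(\<lambda>x\<in>?S. -1 * f x) \<oplus>\<^bsub>?W\<^esub> f = \<zero>\<^bsub>?W\<^esub>" by (auto simp: simps fun_eq_iff)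
    qed
    show "\<zero>\<^bsub>?W\<^esub> \<oplus>\<^bsub>?W\<^esub> f = f"
      unfolding simps by (rule eqI [OF bounded_sphere_closed(2) [OF zero f] f]) simp
  qed (auto simp: simps bounded_sphere_closed zero fun_eq_iff add_ac)
  have "module complex_field ?W"
    by (rule moduleI [OF cring_complex_field ag])
      (auto simp: simps bounded_sphere_closed complex_field_def fun_eq_iff algebra_simps undef)
  then interpret module complex_field ?W .
  have neg: "\<ominus>\<^bsub>?W\<^esub> f = (\<lambda>x\<in>?S. - f x)" if f: "f \<in> carrier ?W" for f
    using bounded_sphere_closed(1) [OF f, of "-1"] f
    by (intro M.minus_equality) (auto simp: simps fun_eq_iff)
  have minus: "(f \<ominus>\<^bsub>?W\<^esub> g) x = f x - g x" if "g \<in> carrier ?W" "x \<in> ?S" for f g x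
    using that by (simp add: a_minus_def neg simps)
  show ?thesis
  proof (intro complex_banach_space.intro complex_banach_space_axioms.intro)
    show "module complex_field ?W" by (rule module_axioms)
  next
    fix f assume f: "f \<in> carrier ?W"
    show "0 \<le> vnorm ?W f" by (rule vnorm_bounded_sphere_nonneg [OF f])
    show "vnorm ?W f = 0 \<longleftrightarrow> f = \<zero>\<^bsub>?W\<^esub>"
    proof
      assume "vnorm ?W f = 0"
      then have "f x = 0" if "x \<in> ?S" for x using le [OF f that] by simp
      then show "f = \<zero>\<^bsub>?W\<^esub>" unfolding simps by (intro eqI f zero) simp
    next
      assume "f = \<zero>\<^bsub>?W\<^esub>"
      then have "vnorm ?W f \<le> 0" by (intro vnorm_bounded_sphere_le) (simp add: simps)
      then show "vnorm ?W f = 0" using vnorm_bounded_sphere_nonneg [OF f] by simp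
    qed
    show "vnorm ?W (c \<odot>\<^bsub>?W\<^esub> f) = cmod c * vnorm ?W f" for c
    proof (rule antisym)
      show "vnorm ?W (c \<odot>\<^bsub>?W\<^esub> f) \<le> cmod c * vnorm ?W f"
        using le [OF f] by (intro vnorm_bounded_sphere_le) (auto simp: simps norm_mult intro!: mult_left_mono)
      show "cmod c * vnorm ?W f \<le> vnorm ?W (c \<odot>\<^bsub>?W\<^esub> f)"
      proof (cases "c = 0")
        case True
        then show ?thesis
          using vnorm_bounded_sphere_nonneg [OF bounded_sphere_closed(1) [OF f, of c]] by (simp add: simps)
      next
        case False
        have "vnorm ?W f \<le> vnorm ?W (c \<odot>\<^bsub>?W\<^esub> f) / cmod c"
        proof (rule vnorm_bounded_sphere_le)
          fix x assume x: "x \<in> ?S"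
          have "cmod (c * f x) \<le> vnorm ?W (c \<odot>\<^bsub>?W\<^esub> f)"
            using le [OF bounded_sphere_closed(1) [OF f, of c] x] x by (simp add: simps)
          then show "cmod (f x) \<le> vnorm ?W (c \<odot>\<^bsub>?W\<^esub> f) / cmod c"
            using False by (simp add: norm_mult field_simps)
        qed
        then show ?thesis using False by (simp add: field_simps)
      qed
    qed
  next
    fix f g assume f: "f \<in> carrier ?W" and g: "g \<in> carrier ?W"
    show "vnorm ?W (f \<oplus>\<^bsub>?W\<^esub> g) \<le> vnorm ?W f + vnorm ?W g"
      using le [OF f] le [OF g]
      by (intro vnorm_bounded_sphere_le) (auto simp: simps intro!: norm_triangle_le add_mono)
  next
    fix s :: "nat \<Rightarrow> real ^ 'n \<Rightarrow> complex"
    assume "range s \<subseteq> carrier ?W"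
    then have s: "s i \<in> carrier ?W" for i by auto
    assume cauchy: "\<forall>e>0. \<exists>N. \<forall>i\<ge>N. \<forall>j\<ge>N. vnorm ?W (s i \<ominus>\<^bsub>?W\<^esub> s j) < e"
    have close: "\<exists>N. \<forall>i\<ge>N. \<forall>j\<ge>N. \<forall>x\<in>?S. cmod (s i x - s j x) < e" if e: "e > 0" for e
    proof -
      obtain N where N: "\<And>i j. i \<ge> N \<Longrightarrow> j \<ge> N \<Longrightarrow> vnorm ?W (s i \<ominus>\<^bsub>?W\<^esub> s j) < e" using cauchy e by blast
      have "cmod (s i x - s j x) < e" if "i \<ge> N" "j \<ge> N" "x \<in> ?S" for i j x
        using le [OF M.minus_closed [OF s s] that(3), of i j] N [OF that(1,2)] minus [OF s that(3)] by simp
      then show ?thesis by blast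
    qed
    \<comment> \<open>The pointwise limit. Letting \<open>j\<close> tend to infinity in the Cauchy
      estimate, which is uniform on the sphere, shows that the convergence is uniform and that
      \<open>l\<close> is bounded.\<close>
    define l where "l = (\<lambda>x\<in>?S. lim (\<lambda>i. s i x))"
    have lim: "(\<lambda>i. s i x) \<longlonglongrightarrow> l x" if x: "x \<in> ?S" for x
    proof -
      have "Cauchy (\<lambda>i. s i x)"
      proof (rule CauchyI)
        fix e :: real assume "e > 0"
        from close [OF this] show "\<exists>M. \<forall>m\<ge>M. \<forall>n\<ge>M. norm (s m x - s n x) < e" using x by blast
      qed
      then show ?thesis using x by (simp add: l_def convergent_LIMSEQ_iff [symmetric] Cauchy_convergent_iff)
    qed
    have lim_close: "\<exists>N. \<forall>i\<ge>N. \<forall>x\<in>?S. cmod (s i x - l x) \<le> e" if e: "e > 0" for e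
    proof -
      obtain N where N: "\<And>i j x. i \<ge> N \<Longrightarrow> j \<ge> N \<Longrightarrow> x \<in> ?S \<Longrightarrow> cmod (s i x - s j x) < e"
        using close [OF e] by blast
      have "cmod (s i x - l x) \<le> e" if i: "i \<ge> N" and x: "x \<in> ?S" for i x
      proof (rule LIMSEQ_le_const2)
        show "(\<lambda>j. cmod (s i x - s j x)) \<longlonglongrightarrow> cmod (s i x - l x)"
          by (intro tendsto_intros lim x)
        show "\<exists>M. \<forall>j\<ge>M. cmod (s i x - s j x) \<le> e" using N [OF i _ x] less_imp_le by blast
      qed
      then show ?thesis by blast
    qed
    obtain N where "\<forall>i\<ge>N. \<forall>x\<in>?S. cmod (s i x - l x) \<le> 1" using lim_close [OF zero_less_one] by blast
    then have N: "\<And>x. x \<in> ?S \<Longrightarrow> cmod (s N x - l x) \<le> 1" by blast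
    have l: "l \<in> carrier ?W"
    proof (rule bounded_sphere_functionI [of _ "vnorm ?W (s N) + 1"])
      fix x assume x: "x \<in> ?S"
      have "cmod (l x) \<le> cmod (s N x) + cmod (s N x - l x)"
        by (metis norm_minus_commute norm_triangle_sub)
      then show "cmod (l x) \<le> vnorm ?W (s N) + 1" using N [OF x] le [OF s x, of N] by linarith
    qed (simp add: l_def)
    have "(\<lambda>k. vnorm ?W (s k \<ominus>\<^bsub>?W\<^esub> l)) \<longlonglongrightarrow> 0"
    proof (rule LIMSEQ_I)
      fix e :: real assume e: "0 < e"
      obtain N where N: "\<And>i x. i \<ge> N \<Longrightarrow> x \<in> ?S \<Longrightarrow> cmod (s i x - l x) \<le> e / 2"
        using lim_close [of "e / 2"] e by (metis half_gt_zero)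
      have "norm (vnorm ?W (s k \<ominus>\<^bsub>?W\<^esub> l) - 0) < e" if k: "k \<ge> N" for k
      proof -
        have "vnorm ?W (s k \<ominus>\<^bsub>?W\<^esub> l) \<le> e / 2"
          by (rule vnorm_bounded_sphere_le) (simp only: minus [OF l] N [OF k])
        then show ?thesis
          using vnorm_bounded_sphere_nonneg [OF M.minus_closed [OF s l], of k] e by simp
      qed
      then show "\<exists>no. \<forall>n\<ge>no. norm (vnorm ?W (s n \<ominus>\<^bsub>?W\<^esub> l) - 0) < e" by blast
    qed
    then show "\<exists>l\<in>carrier ?W. (\<lambda>k. vnorm ?W (s k \<ominus>\<^bsub>?W\<^esub> l)) \<longlonglongrightarrow> 0" using l by blast
  qed
qed

section \<open>Zonal kernels as finite sums of products\<close>

definition tensor_index :: "real poly \<Rightarrow> (nat \<times> (nat \<Rightarrow> 'n::finite)) set" where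
  "tensor_index q = (SIGMA l:{..degree q}. PiE {..<l} (\<lambda>_. UNIV))"

definition tensor_monomial :: "nat \<times> (nat \<Rightarrow> 'n) \<Rightarrow> real ^ 'n \<Rightarrow> real" where
  "tensor_monomial j x = (\<Prod>i<fst j. x $ snd j i)"

lemma finite_tensor_index: "finite (tensor_index q)"
  by (simp add: tensor_index_def finite_PiE)

lemma continuous_on_tensor_monomial [continuous_intros]: "continuous_on A (tensor_monomial j)"
  unfolding tensor_monomial_def by (intro continuous_intros)

text \<open>Indexing by words in the coordinates, instead of monomials, expands
  \<open>(x \<bullet> y) ^ l\<close> without multinomial coefficients. The separated form lets a
  linear operator act on one variable term by term.\<close>

lemma poly_inner_tensor:
  fixes x y :: "real ^ 'n"
  shows "poly q (x \<bullet> y) = (\<Sum>j\<in>tensor_index q. coeff q (fst j) * tensor_monomial j x * tensor_monomial j y)"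
proof -
  have pow: "(x \<bullet> y) ^ l = (\<Sum>f\<in>PiE {..<l} (\<lambda>_. UNIV). tensor_monomial (l, f) x * tensor_monomial (l, f) y)" for l
  proof -
    have "(x \<bullet> y) ^ l = (\<Prod>k<l. \<Sum>i\<in>UNIV. x $ i * y $ i)" by (simp add: inner_vec_def)
    also have "\<dots> = (\<Sum>f\<in>PiE {..<l} (\<lambda>_. UNIV). \<Prod>k<l. x $ f k * y $ f k)"
      by (rule prod_sum_PiE) auto
    finally show ?thesis by (simp add: tensor_monomial_def prod.distrib)
  qed
  have "poly q (x \<bullet> y) = (\<Sum>l\<le>degree q. \<Sum>f\<in>PiE {..<l} (\<lambda>_. UNIV).
      coeff q l * tensor_monomial (l, f) x * tensor_monomial (l, f) y)"
    by (simp add: poly_altdef pow sum_distrib_left mult.assoc)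
  also have "\<dots> = (\<Sum>j\<in>tensor_index q. coeff q (fst j) * tensor_monomial j x * tensor_monomial j y)"
    unfolding tensor_index_def by (subst sum.Sigma) (auto simp: finite_PiE split_beta)
  finally show ?thesis .
qed

lemma integral_kernel_tensor:
  fixes G :: "real ^ 'n \<Rightarrow> complex"
  assumes G: "continuous_on UNIV G"
  shows "(AVG u. of_real (poly k (x \<bullet> u)) * G u)
    = (\<Sum>i\<in>tensor_index k. complex_of_real (coeff k (fst i) * tensor_monomial i x) *
        (AVG u. of_real (tensor_monomial i u) * G u))"
proof -
  have "(AVG u. of_real (poly k (x \<bullet> u)) * G u)
    = (AVG u. (\<Sum>i\<in>tensor_index k. complex_of_real (coeff k (fst i) * tensor_monomial i x) *
        (of_real (tensor_monomial i u) * G u)))"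
    by (simp add: poly_inner_tensor sum_distrib_right mult.assoc)
  also have "\<dots> = (\<Sum>i\<in>tensor_index k. AVG u. complex_of_real (coeff k (fst i) * tensor_monomial i x) *
        (of_real (tensor_monomial i u) * G u))"
    by (intro Bochner_Integration.integral_sum integrable_sphere_continuous continuous_intros G)
  finally show ?thesis by simp
qed

text \<open>Fubini together with the symmetry of \<open>x \<bullet> u\<close>, obtained by
  exchanging averages with finite sums only.\<close>

lemma integral_kernel_swap:
  fixes a G :: "real ^ 'n \<Rightarrow> complex"
  assumes a: "continuous_on UNIV a" and G: "continuous_on UNIV G"
  shows "(AVG x. a x * (AVG u. of_real (poly k (x \<bullet> u)) * G u))
    = (AVG u. (AVG x. of_real (poly k (u \<bullet> x)) * a x) * G u)"
proof -
  let ?c = "\<lambda>i. complex_of_real (coeff k (fst i))" and ?t = "\<lambda>i x. complex_of_real (tensor_monomial i x)"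
  have "(AVG x. a x * (AVG u. of_real (poly k (x \<bullet> u)) * G u))
    = (AVG x. (\<Sum>i\<in>tensor_index k. (?t i x * a x) * (?c i * (AVG u. ?t i u * G u))))"
    unfolding integral_kernel_tensor [OF G] sum_distrib_left of_real_mult by (simp only: mult_ac)
  also have "\<dots> = (\<Sum>i\<in>tensor_index k. AVG x. (?t i x * a x) * (?c i * (AVG u. ?t i u * G u)))"
    by (intro Bochner_Integration.integral_sum integrable_sphere_continuous continuous_intros a)
  also have "\<dots> = (\<Sum>i\<in>tensor_index k. AVG u. (?c i * (AVG x. ?t i x * a x)) * (?t i u * G u))"
    unfolding integral_mult_left_zero integral_mult_right_zero by (simp only: mult_ac)
  also have "\<dots> = (AVG u. (\<Sum>i\<in>tensor_index k. (?c i * (AVG x. ?t i x * a x)) * (?t i u * G u)))"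
    by (intro Bochner_Integration.integral_sum [symmetric] integrable_sphere_continuous continuous_intros G)
  also have "\<dots> = (AVG u. (AVG x. of_real (poly k (u \<bullet> x)) * a x) * G u)"
    unfolding integral_kernel_tensor [OF a] sum_distrib_right of_real_mult by (simp only: mult_ac)
  finally show ?thesis .
qed

text \<open>Substitute for averaging a projection over the rotation group: the trace pairing with a
  zonal operator only sees the identity part of the projection.\<close>

theorem integral_projection_zonal:
  fixes P :: "(real ^ 'n \<Rightarrow> complex) \<Rightarrow> (real ^ 'n \<Rightarrow> complex)"
  assumes n: "CARD('n) > 2" and \<nu>: "\<nu> = (real CARD('n) - 3) / 2"
    and P: "linear_op bounded_sphere_funs (bounded_sphere_funs\<lparr>carrier := carrier (sphere_polynomials d)\<rparr>) P"
    and proj: "\<And>f. f \<in> carrier (sphere_polynomials d) \<Longrightarrow> P f = f"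
  obtains T where "continuous_on UNIV T"
    and "\<And>x. x \<in> sphere 0 1 \<Longrightarrow> T x = P (\<lambda>y\<in>sphere 0 1. complex_of_real (poly q (x \<bullet> y))) x"
    and "(AVG x. T x) = complex_of_real
       (integral {-1..1} (\<lambda>t. poly (kernel_poly \<nu> d) t * poly q t * (1 - t\<^sup>2) powr \<nu>) / gegenbauer_moment \<nu> 0)"
proof -
  define S where "S = sphere (0 :: real ^ 'n) 1"
  define W where "W = (bounded_sphere_funs :: (real ^ 'n \<Rightarrow> complex) normed_module)"
  define X where "X = (sphere_polynomials d :: (real ^ 'n \<Rightarrow> complex) normed_module)"
  define k where "k = kernel_poly \<nu> d"
  define J where "J = (tensor_index q :: (nat \<times> (nat \<Rightarrow> 'n)) set)"
  have J: "finite J" by (simp add: J_def finite_tensor_index)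
  define E where "E = integral {-1..1} (\<lambda>t. poly k t * poly q t * (1 - t\<^sup>2) powr \<nu>) / gegenbauer_moment \<nu> 0"
  define t where "t j y = complex_of_real (tensor_monomial j y)" for j and y :: "real ^ 'n"
  define a where "a j y = of_real (coeff q (fst j)) * t j y" for j and y :: "real ^ 'n"
  have cont_t: "continuous_on UNIV (t j)" for j unfolding t_def by (intro continuous_intros)
  have cont_a: "continuous_on UNIV (a j)" for j unfolding a_def by (intro continuous_intros cont_t)
  have qxy: "complex_of_real (poly q (x \<bullet> y)) = (\<Sum>j\<in>J. a j x * t j y)" for x y :: "real ^ 'n"
    by (simp add: poly_inner_tensor J_def a_def t_def)
  have W_cont: "restrict f S \<in> carrier W" if f: "continuous_on UNIV f" for f
    using bdd_above_norm_sphere [OF f]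
    by (simp add: W_def S_def bounded_sphere_funs_simps(1) cong: image_cong_simp)
  have P_X: "P f \<in> carrier X" if "f \<in> carrier W" for f
    using P that by (auto simp: linear_op_def W_def X_def)
  have P_add: "P (\<lambda>x\<in>S. f x + g x) = (\<lambda>x\<in>S. P f x + P g x)" if "f \<in> carrier W" "g \<in> carrier W" for f g
    using P that by (simp add: linear_op_def W_def S_def bounded_sphere_funs_simps(3))
  have P_smult: "P (\<lambda>x\<in>S. c * f x) = (\<lambda>x\<in>S. c * P f x)" if "f \<in> carrier W" for f c
    using P that by (simp add: linear_op_def W_def S_def bounded_sphere_funs_simps(4))
  have "\<exists>g\<in>polynomials_upto d. P (restrict (t j) S) = restrict g S" for j
    using P_X [OF W_cont [OF cont_t [of j]]] by (auto simp: X_def S_def sphere_polynomials_simps(1))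
  then obtain G where G: "\<And>j. G j \<in> polynomials_upto d" "\<And>j. P (restrict (t j) S) = restrict (G j) S"
    by metis
  have cont_G: "continuous_on UNIV (G j)" for j by (rule continuous_on_polynomials_upto [OF G(1)])
  have comb: "P (\<lambda>y\<in>S. \<Sum>j\<in>A. c j * t j y) = (\<lambda>y\<in>S. \<Sum>j\<in>A. c j * G j y)" if "finite A" for A c
    using that
  proof (induction A rule: finite_induct)
    case empty
    have "P (\<lambda>y\<in>S. 0 * restrict (\<lambda>_. 0) S y) = (\<lambda>y\<in>S. 0 * P (restrict (\<lambda>_. 0) S) y)"
      by (rule P_smult [OF W_cont]) (intro continuous_intros)
    then show ?case by (simp only: sum.empty mult_zero_left)
  next
    case (insert j A)
    have 1: "restrict (t j) S \<in> carrier W" by (rule W_cont [OF cont_t])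
    have "(\<lambda>y\<in>S. c j * t j y) \<in> carrier W"
      by (rule W_cont) (intro continuous_intros cont_t)
    then have 2: "(\<lambda>y\<in>S. c j * restrict (t j) S y) \<in> carrier W"
      by (simp cong: restrict_cong)
    have 3: "(\<lambda>y\<in>S. \<Sum>j\<in>A. c j * t j y) \<in> carrier W"
      by (rule W_cont) (intro continuous_intros cont_t)
    have "P (\<lambda>y\<in>S. \<Sum>j\<in>insert j A. c j * t j y)
        = P (\<lambda>y\<in>S. (\<lambda>y\<in>S. c j * restrict (t j) S y) y + (\<lambda>y\<in>S. \<Sum>j\<in>A. c j * t j y) y)"
      using insert by (simp cong: restrict_cong)
    also have "\<dots> = (\<lambda>y\<in>S. \<Sum>j\<in>insert j A. c j * G j y)"
      unfolding P_add [OF 2 3] P_smult [OF 1] insert.IH G(2) using insert by (simp cong: restrict_cong)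
    finally show ?case .
  qed
  \<comment> \<open>\<open>P\<close> acts on the variable \<open>y\<close> of the kernel
    \<open>q (x \<bullet> y)\<close>, and the result is evaluated on the diagonal
    \<open>y = x\<close>; averaging over \<open>x\<close> is thus a trace. This formula for it also
    shows continuity in \<open>x\<close>.\<close>
  define T where "T x = (\<Sum>j\<in>J. a j x * G j x)" for x
  have T_eq: "T x = P (\<lambda>y\<in>S. complex_of_real (poly q (x \<bullet> y))) x" if "x \<in> S" for x
    unfolding qxy comb [OF J] T_def using that by simp
  define A where "A j u = (AVG x. of_real (poly k (u \<bullet> x)) * a j x)" for j u
  have cont_A: "continuous_on UNIV (A j)" for j
    unfolding A_def integral_kernel_tensor [OF cont_a] by (intro continuous_intros)
  \<comment> \<open>\<open>G j\<close> has degree at most \<open>d\<close> and is reproduced by the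
    kernel, which is then moved over to \<open>a j\<close>. The function \<open>A j\<close> is the
    orthogonal projection of \<open>a j\<close> onto the polynomials of degree at most
    \<open>d\<close>.\<close>
  have step: "(AVG x. a j x * G j x) = (AVG u. A j u * G j u)" for j
  proof -
    have c: "continuous_on UNIV (\<lambda>x. a j x * (AVG u. of_real (poly k (x \<bullet> u)) * G j u))"
      unfolding integral_kernel_tensor [OF cont_G] by (intro continuous_intros cont_a)
    have "(AVG x. a j x * G j x)
        = (AVG x. a j x * (AVG u. of_real (poly k (x \<bullet> u)) * G j u))"
      by (intro integral_sphere_cong borel_measurable_continuous_onI c continuous_intros cont_a cont_G)
        (simp add: k_def kernel_reproducing [OF n \<nu> _ G(1)])
    also have "\<dots> = (AVG u. A j u * G j u)"
      unfolding A_def by (rule integral_kernel_swap [OF cont_a cont_G])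
    finally show ?thesis .
  qed
  \<comment> \<open>Paired with the functions \<open>t j\<close>, the projected coefficients
    \<open>A j u\<close> give a zonal polynomial in \<open>u \<bullet> y\<close> of degree at most
    \<open>d\<close>. \<open>P\<close> fixes it, so each \<open>G j\<close> may be replaced by
    \<open>t j\<close> in the sum, and the dependence on \<open>P\<close> disappears.\<close>
  have diag: "(\<Sum>j\<in>J. A j u * G j u) = complex_of_real E" if u: "u \<in> S" for u
  proof -
    have nu: "norm u = 1" using u by (simp add: S_def)
    define r where "r = (\<Sum>m\<le>degree k. Polynomial.smult (coeff k m) (zonal_poly \<nu> q m))"
    have "degree r \<le> d"
      unfolding r_def k_def
      by (intro degree_sum_le order_trans [OF degree_smult_le] order_trans [OF degree_zonal_poly])
        (auto intro: order_trans [OF _ degree_kernel_poly])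
    have Z: "(\<Sum>j\<in>J. A j u * t j y) = (AVG x. complex_of_real (poly k (u \<bullet> x) * poly q (x \<bullet> y)))" for y
    proof -
      have "(AVG x. complex_of_real (poly k (u \<bullet> x) * poly q (x \<bullet> y)))
          = (AVG x. (\<Sum>j\<in>J. of_real (poly k (u \<bullet> x)) * a j x * t j y))"
        by (simp add: qxy sum_distrib_left mult.assoc)
      also have "\<dots> = (\<Sum>j\<in>J. AVG x. of_real (poly k (u \<bullet> x)) * a j x * t j y)"
        by (intro Bochner_Integration.integral_sum integrable_sphere_continuous continuous_intros cont_a)
      finally show ?thesis by (simp add: A_def)
    qed
    have Zr: "(\<Sum>j\<in>J. A j u * t j y) = complex_of_real (poly r (u \<bullet> y))" if y: "y \<in> S" for y
    proof -
      have ny: "norm y = 1" using y by (simp add: S_def)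
      \<comment> \<open>Here \<open>y\<close> is the pole of the kernel \<open>q\<close>, and
        \<open>u\<close> is the vector whose powers are averaged. The powers come from expanding
        \<open>k\<close>, so the degree of \<open>r\<close> is bounded by that of \<open>k\<close>,
        whatever the degree of \<open>q\<close>.\<close>
      have zonal: "(AVG x. poly q (y \<bullet> x) * (u \<bullet> x) ^ m) = poly (zonal_poly \<nu> q m) (u \<bullet> y)" for m
        using integral_zonal [OF n ny nu, of q m] unfolding \<nu> [symmetric] by (simp only: inner_commute [of u y])
      have "(AVG x. poly k (u \<bullet> x) * poly q (x \<bullet> y))
          = (AVG x. (\<Sum>m\<le>degree k. coeff k m * (poly q (y \<bullet> x) * (u \<bullet> x) ^ m)))"
        by (simp add: poly_altdef [of k] sum_distrib_left sum_distrib_right inner_commute mult_ac)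
      also have "\<dots> = (\<Sum>m\<le>degree k. AVG x. coeff k m * (poly q (y \<bullet> x) * (u \<bullet> x) ^ m))"
        by (intro Bochner_Integration.integral_sum integrable_sphere_continuous continuous_intros)
      also have "\<dots> = poly r (u \<bullet> y)"
        by (simp add: zonal r_def poly_sum)
      finally show ?thesis unfolding Z integral_complex_of_real by simp
    qed
    have "(\<lambda>y\<in>S. \<Sum>j\<in>J. A j u * G j y) = P (\<lambda>y\<in>S. \<Sum>j\<in>J. A j u * t j y)"
      by (rule comb [OF J, symmetric])
    also have "\<dots> = P (\<lambda>y\<in>S. complex_of_real (poly r (u \<bullet> y)))"
      by (simp add: Zr cong: restrict_cong)
    also have "\<dots> = (\<lambda>y\<in>S. complex_of_real (poly r (u \<bullet> y)))"
      using polynomials_upto_zonal [OF \<open>degree r \<le> d\<close>, of u]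
      by (intro proj) (auto simp: sphere_polynomials_simps(1) S_def)
    also have "\<dots> = (\<lambda>y\<in>S. \<Sum>j\<in>J. A j u * t j y)" by (simp add: Zr cong: restrict_cong)
    finally have "(\<Sum>j\<in>J. A j u * G j u) = (\<Sum>j\<in>J. A j u * t j u)" using u by (auto dest: fun_cong [of _ _ u])
    also have "\<dots> = complex_of_real (AVG x. poly k (u \<bullet> x) * poly q (u \<bullet> x))"
      unfolding Z integral_complex_of_real by (simp add: inner_commute)
    also have "(AVG x. poly k (u \<bullet> x) * poly q (u \<bullet> x)) = E"
      unfolding E_def by (rule integral_sphere_ridge [OF n \<nu> nu]) (intro continuous_intros)
    finally show ?thesis .
  qed
  have "(AVG x. T x) = (\<Sum>j\<in>J. AVG x. a j x * G j x)"
    unfolding T_def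
    by (intro Bochner_Integration.integral_sum integrable_sphere_continuous continuous_intros cont_a cont_G)
  also have "\<dots> = (\<Sum>j\<in>J. AVG u. A j u * G j u)" by (simp add: step)
  also have "\<dots> = (AVG u. (\<Sum>j\<in>J. A j u * G j u))"
    by (intro Bochner_Integration.integral_sum [symmetric] integrable_sphere_continuous continuous_intros cont_A cont_G)
  also have "\<dots> = (\<integral>u. complex_of_real E \<partial>(sphere_measure :: (real ^ 'n) measure))"
    by (intro integral_sphere_cong borel_measurable_continuous_onI continuous_intros cont_A cont_G)
      (simp add: diag S_def)
  also have "\<dots> = complex_of_real E" using sphere.prob_space [where 'a = "real ^ 'n"] by simp
  finally have "(AVG x. T x) = complex_of_real E" .
  then show ?thesis
    using T_eq unfolding E_def k_def S_def
    by (intro that [of T]) (auto simp: T_def intro!: continuous_intros cont_a cont_G)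
qed

lemma sphere_polynomials_subset:
  "carrier (sphere_polynomials d :: (real ^ 'n \<Rightarrow> complex) normed_module) \<subseteq> carrier bounded_sphere_funs"
proof
  fix f :: "real ^ 'n \<Rightarrow> complex" assume f: "f \<in> carrier (sphere_polynomials d)"
  show "f \<in> carrier bounded_sphere_funs"
    by (rule bounded_sphere_functionI [OF cmod_le_sphere_norm [OF f]])
      (use f in \<open>auto simp: sphere_polynomials_simps(1)\<close>)
qed

theorem lebesgue_constant_le_op_norm:
  fixes P :: "(real ^ 'n \<Rightarrow> complex) \<Rightarrow> (real ^ 'n \<Rightarrow> complex)"
  assumes n: "CARD('n) > 2" and \<nu>: "\<nu> = (real CARD('n) - 3) / 2"
    and P: "bounded_op bounded_sphere_funs (bounded_sphere_funs\<lparr>carrier := carrier (sphere_polynomials d)\<rparr>) P"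
    and proj: "\<And>f. f \<in> carrier (sphere_polynomials d) \<Longrightarrow> P f = f"
  shows "lebesgue_constant \<nu> d
    \<le> op_norm bounded_sphere_funs (bounded_sphere_funs\<lparr>carrier := carrier (sphere_polynomials d)\<rparr>) P"
proof -
  define W where "W = (bounded_sphere_funs :: (real ^ 'n \<Rightarrow> complex) normed_module)"
  define X where "X = (sphere_polynomials d :: (real ^ 'n \<Rightarrow> complex) normed_module)"
  define C where "C = op_norm W (W\<lparr>carrier := carrier X\<rparr>) P"
  define k where "k = poly (kernel_poly \<nu> d)"
  define I0 where "I0 = gegenbauer_moment \<nu> 0"
  define L where "L = lebesgue_constant \<nu> d"
  define w where "w t = (1 - t\<^sup>2) powr \<nu>" for t :: real
  define E where "E q = integral {-1..1} (\<lambda>t. k t * poly q t * w t) / I0" for q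
  have \<nu>0: "\<nu> \<ge> 0" using n by (simp add: \<nu>)
  have I0: "I0 > 0" unfolding I0_def by (rule gegenbauer_moment_0_pos [OF \<nu>0])
  have wi: "(\<lambda>t. f t * w t) integrable_on {-1..1}" if "continuous_on UNIV f" for f :: "real \<Rightarrow> real"
    unfolding w_def by (rule integrable_gegenbauer [OF \<nu>0 continuous_on_subset [OF that]]) simp
  have w0: "w t \<ge> 0" for t by (simp add: w_def)
  have kc: "continuous_on UNIV k" unfolding k_def by (intro continuous_intros)
  have lin: "linear_op W (W\<lparr>carrier := carrier X\<rparr>) P"
    using P by (simp add: bounded_op_def W_def X_def)
  have PX: "P f \<in> carrier X" if "f \<in> carrier W" for f
    using lin that by (auto simp: linear_op_def)
  obtain B where B: "\<And>f. f \<in> carrier W \<Longrightarrow> vnorm W (P f) \<le> B * vnorm W f"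
    using P by (auto simp: bounded_op_def W_def)
  \<comment> \<open>\<open>op_norm\<close> is a real supremum and bounds its members only if the set
    is bounded above; this is where boundedness of \<open>P\<close> enters.\<close>
  have PC: "vnorm W (P f) \<le> C" if f: "f \<in> carrier W" "vnorm W f \<le> 1" for f
  proof -
    have "bdd_above ((\<lambda>f. vnorm W (P f)) ` {f \<in> carrier W. vnorm W f \<le> 1})"
    proof (rule bdd_aboveI2)
      fix f assume f: "f \<in> {f \<in> carrier W. vnorm W f \<le> 1}"
      then have "0 \<le> vnorm W f" unfolding W_def by (intro vnorm_bounded_sphere_nonneg) simp
      then have "B * vnorm W f \<le> \<bar>B\<bar> * 1" using f by (intro mult_mono) auto
      then show "vnorm W (P f) \<le> \<bar>B\<bar>" using B [of f] f by simp
    qed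
    then have "vnorm W (P f) \<le> (SUP f\<in>{f \<in> carrier W. vnorm W f \<le> 1}. vnorm W (P f))"
      using f by (intro cSUP_upper) auto
    then show ?thesis by (simp add: C_def op_norm_def)
  qed
  \<comment> \<open>The function \<open>h x\<close> lies in the unit ball, so \<open>T x\<close>,
    the value of its image under \<open>P\<close> at \<open>x\<close>, is at most \<open>C\<close>
    in modulus; \<open>E q\<close> is the average of \<open>T\<close>.\<close>
  have key: "\<bar>E q\<bar> \<le> C" if q: "\<And>t. t \<in> {-1..1} \<Longrightarrow> \<bar>poly q t\<bar> \<le> 1" for q
  proof -
    define h where "h x = (\<lambda>y\<in>sphere 0 1. complex_of_real (poly q (x \<bullet> y)))" for x :: "real ^ 'n"
    obtain T where T: "continuous_on UNIV T" "\<And>x. x \<in> sphere 0 1 \<Longrightarrow> T x = P (h x) x"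
      "(AVG x. T x) = complex_of_real (E q)"
      using integral_projection_zonal [OF n \<nu> lin [unfolded W_def X_def] proj, of q]
      unfolding E_def k_def w_def I0_def h_def by blast
    have TC: "cmod (T x) \<le> C" if x: "norm x = 1" for x
    proof -
      have xS: "x \<in> sphere 0 1" using x by simp
      have hle: "cmod (h x y) \<le> 1" if "y \<in> sphere 0 1" for y
        using q [OF norm_inner_unit [OF x, of y]] that by (simp add: h_def)
      have hW: "h x \<in> carrier W"
        unfolding W_def by (rule bounded_sphere_functionI [OF hle]) (auto simp: h_def extensional_def)
      have "cmod (P (h x) x) \<le> vnorm X (P (h x))"
        using cmod_le_sphere_norm [OF _ xS] PX [OF hW] unfolding X_def by blast
      also have "\<dots> = vnorm W (P (h x))"
        by (simp add: X_def W_def sphere_polynomials_simps(5) bounded_sphere_funs_simps(5))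
      also have "\<dots> \<le> C"
        by (rule PC [OF hW]) (unfold W_def, rule vnorm_bounded_sphere_le [OF hle])
      finally show ?thesis by (simp add: T(2) [OF xS])
    qed
    have "\<bar>E q\<bar> = cmod (AVG x. T x)" by (simp add: T(3))
    also have "\<dots> \<le> (AVG x. cmod (T x))" by (rule integral_norm_bound)
    also have "\<dots> \<le> (\<integral>x. C \<partial>(sphere_measure :: (real ^ 'n) measure))"
    proof (rule integral_mono_AE)
      show "integrable sphere_measure (\<lambda>x. cmod (T x))"
        by (intro integrable_sphere_continuous continuous_intros T(1))
      show "AE x in sphere_measure. cmod (T x) \<le> C"
        using AE_sphere_measure by eventually_elim (rule TC)
    qed simp
    also have "\<dots> = C" using sphere.prob_space [where 'a = "real ^ 'n"] by simp
    finally show ?thesis .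
  qed
  have C0: "C \<ge> 0" using key [of 0] by (simp add: E_def)
  have L_eq: "L = integral {-1..1} (\<lambda>t. \<bar>k t\<bar> * w t) / I0"
    by (simp add: L_def lebesgue_constant_def k_def w_def I0_def)
  have L0: "L \<ge> 0"
    unfolding L_eq using I0 by (intro divide_nonneg_pos integral_nonneg wi continuous_intros kc) (auto simp: w0)
  \<comment> \<open>Three errors add up: \<open>e\<close> from smoothing the sign,
    \<open>e * L\<close> from the polynomial approximation, and \<open>e * C\<close> from rescaling
    the polynomial to absolute value at most 1.\<close>
  have est: "L \<le> C + e * (1 + L + C)" if e: "e > 0" for e
  proof -
    \<comment> \<open>A continuous stand-in for the sign of \<open>k\<close>: the product
      \<open>k t * g t\<close> is within \<open>e\<close> of the absolute value of
      \<open>k t\<close>.\<close>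
    define g where "g t = k t / (\<bar>k t\<bar> + e)" for t
    have pos: "\<bar>k t\<bar> + e > 0" for t using e by (simp add: add_nonneg_pos)
    have gc: "continuous_on {-1..1} g"
      unfolding g_def using pos
      by (intro continuous_intros continuous_on_subset [OF kc]) (auto simp: less_imp_neq [symmetric])
    obtain p where p: "\<And>t. t \<in> {-1..1} \<Longrightarrow> \<bar>g t - poly p t\<bar> < e"
      by (rule Weierstrass_poly [OF gc e]) blast
    have g1: "\<bar>g t\<bar> \<le> 1" for t
      unfolding g_def abs_divide using pos [of t] e by (simp add: abs_of_pos)
    have "\<bar>E (Polynomial.smult (1 / (1 + e)) p)\<bar> \<le> C"
    proof (rule key)
      fix t :: real assume "t \<in> {-1..1}"
      then have "\<bar>poly p t\<bar> \<le> 1 + e" using p [of t] g1 [of t] by linarith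
      then show "\<bar>poly (Polynomial.smult (1 / (1 + e)) p) t\<bar> \<le> 1"
        using e by (simp add: abs_divide)
    qed
    moreover have "E (Polynomial.smult (1 / (1 + e)) p) = E p / (1 + e)"
    proof -
      have "integral {-1..1} (\<lambda>t. k t * poly (Polynomial.smult (1 / (1 + e)) p) t * w t)
          = integral {-1..1} (\<lambda>t. 1 / (1 + e) * (k t * poly p t * w t))"
        by (intro integral_cong) simp
      then show ?thesis by (simp add: E_def)
    qed
    ultimately have "E p \<le> C * (1 + e)" using e by (simp add: abs_divide pos_divide_le_eq abs_le_iff)
    moreover have "L - e - e * L \<le> E p"
    proof -
      have "((\<lambda>t. w t) has_integral I0) {-1..1}"
        using has_integral_gegenbauer_moment [OF \<nu>0, of 0] by (simp add: I0_def w_def)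
      moreover have "((\<lambda>t. \<bar>k t\<bar> * w t) has_integral (L * I0)) {-1..1}"
        using integrable_integral [OF wi [of "\<lambda>t. \<bar>k t\<bar>"]] I0 by (simp add: L_eq continuous_intros kc)
      ultimately have "((\<lambda>t. \<bar>k t\<bar> * w t - e * w t - e * (\<bar>k t\<bar> * w t)) has_integral (L * I0 - e * I0 - e * (L * I0))) {-1..1}"
        by (intro has_integral_diff has_integral_mult_right)
      moreover have "((\<lambda>t. k t * poly p t * w t) has_integral (E p * I0)) {-1..1}"
        using integrable_integral [OF wi [of "\<lambda>t. k t * poly p t"]] I0 by (simp add: E_def continuous_intros kc)
      ultimately have "L * I0 - e * I0 - e * (L * I0) \<le> E p * I0"
      proof (rule has_integral_le)
        fix t :: real assume t: "t \<in> {-1..1}"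
        have "\<bar>k t\<bar> - e \<le> k t * g t"
        proof -
          have "(\<bar>k t\<bar> - e) * (\<bar>k t\<bar> + e) \<le> k t * k t"
            using e by (simp add: algebra_simps)
          then have "\<bar>k t\<bar> - e \<le> k t * k t / (\<bar>k t\<bar> + e)" using pos [of t] by (simp add: pos_le_divide_eq)
          then show ?thesis by (simp add: g_def)
        qed
        moreover have "k t * g t - k t * poly p t \<le> e * \<bar>k t\<bar>"
        proof -
          have "k t * (g t - poly p t) \<le> \<bar>k t\<bar> * \<bar>g t - poly p t\<bar>" by (metis abs_ge_self abs_mult)
          also have "\<dots> \<le> \<bar>k t\<bar> * e" using p [OF t] by (intro mult_left_mono) auto
          finally show ?thesis by (simp add: algebra_simps)
        qed
        ultimately have "\<bar>k t\<bar> - e - e * \<bar>k t\<bar> \<le> k t * poly p t" by linarith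
        then have "(\<bar>k t\<bar> - e - e * \<bar>k t\<bar>) * w t \<le> k t * poly p t * w t"
          by (rule mult_right_mono [OF _ w0])
        then show "\<bar>k t\<bar> * w t - e * w t - e * (\<bar>k t\<bar> * w t) \<le> k t * poly p t * w t"
          by (simp add: left_diff_distrib mult.assoc)
      qed
      then have "(L - e - e * L) * I0 \<le> E p * I0" by (simp add: algebra_simps)
      then show ?thesis using I0 by (simp add: mult_le_cancel_right)
    qed
    ultimately show ?thesis by (simp add: algebra_simps)
  qed
  have "L \<le> C"
  proof (rule field_le_epsilon)
    fix e :: real assume e: "e > 0"
    define D where "D = 1 + L + C"
    have D: "D > 0" using L0 C0 by (simp add: D_def)
    then show "L \<le> C + e" using est [of "e / D"] e by (simp add: D_def [symmetric])
  qed
  then show ?thesis by (simp add: L_def C_def W_def X_def)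
qed

text \<open>The space of bounded functions sits in the right summand of the universe and attains the
  supremum. The upper estimate holds for Banach spaces on every type, so the value is the same for
  each choice of the left summand.\<close>

lemma projection_constant_sphere_polynomials:
  assumes n: "CARD('n :: finite) > 2" and \<nu>: "\<nu> = (real CARD('n) - 3) / 2"
  shows "projection_constant TYPE('b + (real ^ 'n \<Rightarrow> complex))
      (sphere_polynomials d :: (real ^ 'n \<Rightarrow> complex) normed_module) = ereal (lebesgue_constant \<nu> d)"
proof (rule antisym)
  let ?X = "sphere_polynomials d :: (real ^ 'n \<Rightarrow> complex) normed_module"
  let ?W = "bounded_sphere_funs :: (real ^ 'n \<Rightarrow> complex) normed_module"
  let ?h = "Inr :: (real ^ 'n \<Rightarrow> complex) \<Rightarrow> 'b + (real ^ 'n \<Rightarrow> complex)"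
  show "projection_constant TYPE('b + (real ^ 'n \<Rightarrow> complex)) ?X \<le> ereal (lebesgue_constant \<nu> d)"
    unfolding projection_constant_def
    by (rule SUP_least) (auto intro: relative_projection_constant_le [OF n \<nu>])
  have emb: "isometric_embedding ?X ?W id"
    unfolding isometric_embedding_def linear_op_def
    using sphere_polynomials_subset [of d]
    by (auto simp: sphere_polynomials_simps(3-5) bounded_sphere_funs_simps(3-5))
  have "ereal (lebesgue_constant \<nu> d) \<le> relative_projection_constant (carrier ?X) ?W"
    unfolding relative_projection_constant_def
    by (rule INF_greatest) (auto intro!: lebesgue_constant_le_op_norm [OF n \<nu>])
  also have "\<dots> \<le> relative_projection_constant (?h ` carrier ?X) (transport ?h ?W)"
    by (rule relative_projection_constant_transport_le [OF _ complex_banach_space_bounded_sphere_funs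
      sphere_polynomials_subset]) simp
  also have "\<dots> = relative_projection_constant ((?h \<circ> id) ` carrier ?X) (transport ?h ?W)" by simp
  also have "\<dots> \<le> projection_constant TYPE('b + (real ^ 'n \<Rightarrow> complex)) ?X"
    unfolding projection_constant_def
    by (rule SUP_upper2 [of "(transport ?h ?W, ?h \<circ> id)"])
      (use complex_banach_space_transport [of ?h, OF _ complex_banach_space_bounded_sphere_funs]
        isometric_embedding_transport [of ?h, OF _ emb] in auto)
  finally show "ereal (lebesgue_constant \<nu> d) \<le> projection_constant TYPE('b + (real ^ 'n \<Rightarrow> complex)) ?X" .
qed

section \<open>Evaluation of the constant\<close>

lemma Gamma_duplication_real:
  fixes z :: real
  assumes "z > 0"
  shows "Gamma z * Gamma (z + 1/2) = 2 powr (1 - 2 * z) * sqrt pi * Gamma (2 * z)"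
proof -
  have nonpos: "complex_of_real y \<notin> \<int>\<^sub>\<le>\<^sub>0" if "y > 0" for y
    using that by (auto elim!: nonpos_Ints_cases simp: complex_eq_iff)
  have "Gamma (complex_of_real z) * Gamma (complex_of_real z + 1/2)
      = exp ((1 - 2 * complex_of_real z) * of_real (ln 2)) * of_real (sqrt pi) * Gamma (2 * complex_of_real z)"
    by (rule Gamma_legendre_duplication) (use nonpos [of z] nonpos [of "z + 1/2"] assms in auto)
  also have "complex_of_real z + 1/2 = complex_of_real (z + 1/2)" by simp
  also have "2 * complex_of_real z = complex_of_real (2 * z)" by simp
  also have "exp ((1 - complex_of_real (2 * z)) * of_real (ln 2)) = complex_of_real (exp ((1 - 2 * z) * ln 2))"
    by (simp flip: exp_of_real)
  finally have "complex_of_real (Gamma z * Gamma (z + 1/2))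
      = complex_of_real (exp ((1 - 2 * z) * ln 2) * sqrt pi * Gamma (2 * z))"
    unfolding Gamma_complex_of_real by (simp only: of_real_mult)
  then show ?thesis unfolding of_real_eq_iff by (simp add: powr_def)
qed

text \<open>Writing Beta through Gamma leaves
  \<open>2 powr (2 * \<nu> + 1) * Gamma (\<nu> + 1)\<close>. Legendre duplication at
  \<open>\<nu> + 1\<close> turns this into
  \<open>sqrt pi * Gamma (2 * \<nu> + 2) / Gamma (\<nu> + 3 / 2)\<close>, where
  \<open>2 * \<nu> + 2\<close> is n - 1 and \<open>\<nu> + 3 / 2\<close> is n/2.\<close>

lemma inverse_kernel_norm:
  assumes "\<nu> \<ge> 0"
  shows "1 / kernel_norm \<nu> d = Gamma (\<nu> + 3 / 2) / (sqrt pi * Gamma (2 * \<nu> + 2)) *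
    (Gamma (real d + 2 * \<nu> + 2) / Gamma (real d + \<nu> + 1))"
proof -
  have pos: "Gamma (\<nu> + 3 / 2) > 0" "Gamma (2 * \<nu> + 2) > 0" "Gamma (real d + 2 * \<nu> + 2) > 0"
    "Gamma (real d + \<nu> + 1) > 0" "Gamma (\<nu> + 1) > 0"
    using assms by (auto intro!: Gamma_real_pos)
  have gam: "Gamma (\<nu> + 1) * Gamma (\<nu> + 3 / 2) = 2 powr (- (2 * \<nu> + 1)) * (sqrt pi * Gamma (2 * \<nu> + 2))"
    using Gamma_duplication_real [of "\<nu> + 1"] assms by (simp add: algebra_simps)
  have one: "2 powr (2 * \<nu> + 1) * 2 powr (- (2 * \<nu> + 1)) = (1 :: real)"
    by (simp flip: powr_add)
  have dup: "2 powr (2 * \<nu> + 1) * Gamma (\<nu> + 1) * Gamma (\<nu> + 3 / 2) = sqrt pi * Gamma (2 * \<nu> + 2)"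
    unfolding mult.assoc [of _ "Gamma (\<nu> + 1)"] gam by (simp only: mult.assoc [symmetric] one mult_1)
  have "kernel_norm \<nu> d * Gamma (\<nu> + 3 / 2) = sqrt pi * Gamma (2 * \<nu> + 2) * Gamma (real d + \<nu> + 1) / Gamma (real d + 2 * \<nu> + 2)"
    unfolding dup [symmetric] by (simp add: kernel_norm_def Beta_def add_ac)
  then have "kernel_norm \<nu> d = sqrt pi * Gamma (2 * \<nu> + 2) * Gamma (real d + \<nu> + 1) / Gamma (real d + 2 * \<nu> + 2) / Gamma (\<nu> + 3 / 2)"
    using pos by (simp add: nonzero_eq_divide_eq mult_ac)
  then show ?thesis by simp
qed

theorem theorem4p10:
  fixes d :: nat
  assumes "CARD('n :: finite) > 2" and "d \<ge> 1"
  shows "projection_constant TYPE('b + (real ^ 'n \<Rightarrow> complex))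
           (sphere_polynomials d :: (real ^ 'n \<Rightarrow> complex) normed_module) =
         ereal (let n = real CARD('n) in
           Gamma (n / 2) / (sqrt pi * Gamma (n - 1)) *
           (Gamma (real d + n - 1) / Gamma (real d + (n - 1) / 2)) *
           integral {-1..1} (\<lambda>t. \<bar>poly (jacobi_poly d ((n - 1) / 2) ((n - 3) / 2)) t\<bar> *
             (1 - t\<^sup>2) powr ((n - 3) / 2)))"
proof -
  define n where "n = real CARD('n)"
  define \<nu> where "\<nu> = (n - 3) / 2"
  define J where "J = poly (jacobi_poly d (\<nu> + 1) \<nu>)"
  have \<nu>0: "\<nu> \<ge> 0" using assms(1) by (simp add: \<nu>_def n_def)
  have n: "n / 2 = \<nu> + 3 / 2" "n - 1 = 2 * \<nu> + 2" "(2 * \<nu> + 2) / 2 = \<nu> + 1"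
    "real d + n - 1 = real d + 2 * \<nu> + 2" "real d + (\<nu> + 1) = real d + \<nu> + 1"
    by (simp_all add: \<nu>_def field_simps)
  have pos: "gegenbauer_moment \<nu> 0 > 0" "kernel_norm \<nu> d > 0"
    using gegenbauer_moment_0_pos [OF \<nu>0] kernel_norm_pos [OF \<nu>0] by auto
  have "integral {-1..1} (\<lambda>t. \<bar>poly (kernel_poly \<nu> d) t\<bar> * (1 - t\<^sup>2) powr \<nu>)
      = integral {-1..1} (\<lambda>t. gegenbauer_moment \<nu> 0 / kernel_norm \<nu> d * (\<bar>J t\<bar> * (1 - t\<^sup>2) powr \<nu>))"
    using pos by (intro integral_cong) (simp add: kernel_poly_def J_def abs_mult abs_of_pos)
  \<comment> \<open>\<open>gegenbauer_moment \<nu> 0\<close> occurs once as a factor of the kernel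
    and once as the total mass of the weight, and cancels.\<close>
  then have "lebesgue_constant \<nu> d = 1 / kernel_norm \<nu> d * integral {-1..1} (\<lambda>t. \<bar>J t\<bar> * (1 - t\<^sup>2) powr \<nu>)"
    using pos by (simp add: lebesgue_constant_def)
  then have "projection_constant TYPE('b + (real ^ 'n \<Rightarrow> complex))
      (sphere_polynomials d :: (real ^ 'n \<Rightarrow> complex) normed_module)
      = ereal (1 / kernel_norm \<nu> d * integral {-1..1} (\<lambda>t. \<bar>J t\<bar> * (1 - t\<^sup>2) powr \<nu>))"
    using projection_constant_sphere_polynomials [OF assms(1), of \<nu> d, where 'b = 'b] by (simp add: \<nu>_def n_def)
  then show ?thesis
    unfolding Let_def n_def [symmetric] n inverse_kernel_norm [OF \<nu>0] J_def \<nu>_def [symmetric] .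
qed

end
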